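(* Let $\rho\in[0,1)$ and let $\beta^{(0)}\in\mathscr{A}^*$ be arbitrary. Define recursively, for $n\ge1$, $$v_\rho^{(n)}:=v^{\beta^{(n-1)}},\qquad \alpha_\rho^{(n)}:=\alpha^*(\beta^{(n-1)}),\qquad \beta^{(n)}:=\rho\,\beta^{(n-1)}+(1-\rho)\,\alpha_\rho^{(n)} .$$ Then $(v_\rho^{(n)})_{n\ge1}$ converges uniformly on $[0,T]\times\mathscr{X}$ to the unique solution $v$ of the $N$-NLL equation, and $(\alpha_\rho^{(n)})_{n\ge1}$ converges uniformly on $[0,T]\times\mathscr{X}$ to the unique Markov perfect equilibrium, which is given by $\alpha(t,x,\mu)=\hat\alpha(x,\mu,\Delta_xv(t,\cdot,\mu))$ for $(t,x,\mu)\in[0,T]\times\mathscr{X}$.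
   Context: Setting. $N,d$ are positive integers, $T>0$, $\mathcal{X}=\{1,\dots,d\}$, $\Sigma^{d-1}_N=\{\mu\in\{0,1/N,2/N,\dots,1\}^d:\mu_1+\dots+\mu_d=1\}$, $\mathscr{X}=\mathcal{X}\times\Sigma^{d-1}_N$, $\mathbb{R}_+=[0,\infty)$. For $\mu\in\Sigma_N^{d-1}$ put $n^\mu_x=N\mu_x$; $e_x$ is the $x$-th unit vector of $\mathbb{R}^d$ and $e_{x,z}=\frac1N(e_x-e_z)$. Vectors in $\mathbb{R}^{d-1}$ attached to a state $x$ are indexed by $y\in\mathcal{X}\setminus\{x\}$ (in increasing order); e.g. $\alpha_y(t,x,\mu)$, $y\ne x$, is the rate of moving from $x$ to $y$. $|\cdot|_2$ is the Euclidean norm on $\mathbb{R}^k$; for $\psi:[0,T]\times\mathscr{X}\to\mathbb{R}^k$, $\psi(t)$ denotes the function $\psi(t,\cdot,\cdot)$ and $|\psi(t)|_2^2=\sum_{(x,\mu)\in\mathscr{X}}|\psi(t,x,\mu)|_2^2$. Data. Fixed functions $\lambda^0,\lambda^1:\mathscr{X}\to\mathbb{R}_+^{d-1}$, $g:\mathscr{X}\to\mathbb{R}_+$, and a continuous $\ell:\mathscr{X}\times\mathbb{R}_+^{d-1}\to\mathbb{R}_+$ for which there is $\gamma>0$ with $\tau\ell(x,\mu,a')+(1-\tau)\ell(x,\mu,a)-\ell(x,\mu,\tau a'+(1-\tau)a)\ge\gamma\tau(1-\tau)|a'-a|_2^2$ for all $(x,\mu)\in\mathscr{X}$, $a,a'\in\mathbb{R}_+^{d-1}$,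 $\tau\in[0,1]$. Controls and dynamics. $\mathscr{A}$ is the set of Lipschitz continuous functions $\alpha:[0,T]\times\mathscr{X}\to\mathbb{R}_+^{d-1}$. For $\alpha,\beta\in\mathscr{A}$ and $\varphi:\mathscr{X}\to\mathbb{R}$, $$(\mathscr{L}^\alpha_x\varphi)(t,x,\mu)=\sum_{y\ne x}(\lambda^0_y(x,\mu)+\lambda^1_y(x,\mu)\alpha_y(t,x,\mu))[\varphi(y,\mu)-\varphi(x,\mu)],$$ $$(\mathscr{L}^\beta_\mu\varphi)(t,x,\mu)=\sum_{y\ne z}n^\mu_z\big(\lambda^0_y(z,\mu+e_{x,z})+\lambda^1_y(z,\mu+e_{x,z})\beta_y(t,z,\mu+e_{x,z})\big)[\varphi(x,\mu+e_{y,z})-\varphi(x,\mu)]$$ (sum over ordered pairs $y\neq z$ in $\mathcal{X}$; terms with $n^\mu_z=0$ are zero). $\Xi_t=(X_t,\mu_t)$ is the time-inhomogeneous Markov chain on $\mathscr{X}$ with generator $\mathscr{L}^\alpha_x+\mathscr{L}^\beta_\mu$, and $\mathbb{E}^{\alpha\otimes\beta}$ its expectation. Set $J(t,x,\mu,\alpha;\beta)=\mathbb{E}^{\alpha\otimes\beta}\big[\int_t^T\ell(\Xi_u,\alpha(u,\Xi_u))\,du+g(\Xi_T)\,\big|\,\Xi_t=(x,\mu)\big]$ and $v^\beta(t,x,\mu)=\inf_{\alpha\in\mathscr{A}}J(t,x,\mu,\alpha;\beta)$. Hamiltonian and best response. For $\varphi:\mathcal{X}\to\mathbb{R}$, $\Delta_x\varphi=(\varphi(y)-\varphi(x))_{y\ne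 x}\in\mathbb{R}^{d-1}$. $H(x,\mu,p)=\inf_{a\in\mathbb{R}_+^{d-1}}\{\ell(x,\mu,a)+\sum_{y\ne x}(\lambda^0_y(x,\mu)+\lambda^1_y(x,\mu)a_y)p_y\}$, and $\hat\alpha(x,\mu,p)$ is its unique minimizer. It is classical that $v^\beta$ is the unique classical solution of $-\frac{d}{dt}v^\beta(t,x,\mu)=H(x,\mu,\Delta_xv^\beta(t,\cdot,\mu))+(\mathscr{L}^\beta_\mu v^\beta(t))(t,x,\mu)$, $v^\beta(T,x,\mu)=g(x,\mu)$. The best response to $\beta$ is $\alpha^*(\beta)(t,x,\mu)=\hat\alpha(x,\mu,\Delta_xv^\beta(t,\cdot,\mu))$, which lies in $\mathscr{A}$. A (symmetric) Markov perfect equilibrium is $\alpha\in\mathscr{A}$ with $\alpha=\alpha^*(\alpha)$. $N$-NLL equation: $-\frac{d}{dt}v(t,x,\mu)=H(x,\mu,\Delta_xv(t,\cdot,\mu))+(\mathscr{L}^\alpha_\mu v(t))(t,x,\mu)$ with $\alpha(t,x,\mu)=\hat\alpha(x,\mu,\Delta_xv(t,\cdot,\mu))$ and $v(T,x,\mu)=g(x,\mu)$. It is known (Gomes–Mohr–Souza) that it has a unique classical solution $v$ and that the corresponding $\alpha$ is the unique Markov perfect equilibrium. The set $\mathscr{A}^*$: $c_a>0$ is a fixed constant such that $|\alpha^*(\beta)(t,x,\mu)|_2\le c_a$ for all $\beta\in\mathscr{A}$, $(t,x,\mu)\in[0,T]\times\mathscr{X}$ (such a constant exists), and $\mathscr{A}^*=\{\alpha\in\mathscr{A}:\sup_{t\in[0,T]}|\alpha(t)|_2\le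 c_a\}$. *)

theory Defs
  imports "HOL-Probability.Probability"
begin

text \<open>
  The set of player states is the index type \<^typ>\<open>'d\<close> (so \<open>d = CARD('d)\<close>). A vector of
  \<open>\<real>\<^sup>d\<^sup>-\<^sup>1\<close> attached to a state \<open>x\<close>, with coordinates indexed by \<open>y \<noteq> x\<close>, is a vector of
  \<open>real^'d\<close> whose \<open>x\<close>-coordinate is zero; this embedding preserves the Euclidean norm.
\<close>

type_synonym 'd state = "'d \<times> (real^'d)"
type_synonym 'd control = "real \<Rightarrow> 'd state \<Rightarrow> real^'d"

record 'd game =
  players :: nat
  horizon :: real
  rate0 :: "'d state \<Rightarrow> real^'d"
  rate1 :: "'d state \<Rightarrow> real^'d"
  running :: "'d state \<Rightarrow> real^'d \<Rightarrow> real"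
  final :: "'d state \<Rightarrow> real"

definition nonneg_vecs :: "'d::finite \<Rightarrow> (real^'d) set" where
  "nonneg_vecs x = {a. a $ x = 0 \<and> (\<forall>y. 0 \<le> a $ y)}"

definition simplex_grid :: "nat \<Rightarrow> (real^'d::finite) set" where
  "simplex_grid N =
     {\<mu>. (\<forall>y. \<exists>k\<le>N. \<mu> $ y = real k / real N) \<and> (\<Sum>y\<in>UNIV. \<mu> $ y) = 1}"

definition states :: "'d::finite game \<Rightarrow> 'd state set" where
  "states G = UNIV \<times> simplex_grid (players G)"

definition shift :: "'d::finite game \<Rightarrow> 'd \<Rightarrow> 'd \<Rightarrow> real^'d" where
  "shift G x z = (1 / real (players G)) *\<^sub>R (axis x 1 - axis z 1)"

text \<open>
  The state space is finite, so for every metric on it joint Lipschitz continuity in time and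
  state is Lipschitz continuity in time, uniformly over the states.
\<close>

definition controls :: "'d::finite game \<Rightarrow> 'd control set" where
  "controls G =
     {\<alpha>. (\<forall>t\<in>{0..horizon G}. \<forall>\<xi>\<in>states G. \<alpha> t \<xi> \<in> nonneg_vecs (fst \<xi>)) \<and>
          (\<exists>L. \<forall>\<xi>\<in>states G. L-lipschitz_on {0..horizon G} (\<lambda>t. \<alpha> t \<xi>))}"

definition state_norm :: "'d::finite game \<Rightarrow> ('d state \<Rightarrow> real^'d) \<Rightarrow> real" where
  "state_norm G \<psi> = sqrt (\<Sum>\<xi>\<in>states G. (norm (\<psi> \<xi>))\<^sup>2)"

definition bounded_controls :: "'d::finite game \<Rightarrow> real \<Rightarrow> 'd control set" where
  "bounded_controls G c = {\<alpha> \<in> controls G. \<forall>t\<in>{0..horizon G}. state_norm G (\<alpha> t) \<le> c}"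

definition gen_x ::
  "'d::finite game \<Rightarrow> 'd control \<Rightarrow> ('d state \<Rightarrow> real) \<Rightarrow> real \<Rightarrow> 'd state \<Rightarrow> real" where
  "gen_x G \<alpha> \<phi> t \<xi> = (case \<xi> of (x, \<mu>) \<Rightarrow>
     \<Sum>y\<in>UNIV - {x}. (rate0 G (x, \<mu>) $ y + rate1 G (x, \<mu>) $ y * \<alpha> t (x, \<mu>) $ y)
                       * (\<phi> (y, \<mu>) - \<phi> (x, \<mu>)))"

text \<open>
  If \<open>\<mu> $ z = 0\<close> then \<open>\<mu> + shift G x z\<close> may leave the simplex; the factor \<open>N \<mu>\<^sub>z\<close> removes the
  corresponding summand.
\<close>

definition gen_mu ::
  "'d::finite game \<Rightarrow> 'd control \<Rightarrow> ('d state \<Rightarrow> real) \<Rightarrow> real \<Rightarrow> 'd state \<Rightarrow> real" where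
  "gen_mu G \<beta> \<phi> t \<xi> = (case \<xi> of (x, \<mu>) \<Rightarrow>
     \<Sum>(y, z)\<in>{(y, z). y \<noteq> z}. real (players G) * \<mu> $ z *
        (rate0 G (z, \<mu> + shift G x z) $ y
          + rate1 G (z, \<mu> + shift G x z) $ y * \<beta> t (z, \<mu> + shift G x z) $ y)
        * (\<phi> (x, \<mu> + shift G y z) - \<phi> (x, \<mu>)))"

text \<open>
  \<open>markov_chain S T A M X s\<^sub>0 \<xi>\<^sub>0\<close>: under \<open>M\<close>, the process \<open>X\<close> on \<open>[s\<^sub>0, T]\<close> is a Markov chain with
  right-continuous paths with left limits in the finite set \<open>S\<close>, started in \<open>\<xi>\<^sub>0\<close> at time \<open>s\<^sub>0\<close>,
  with time-dependent generator \<open>A\<close>, where \<open>A \<phi> s \<zeta>\<close> is the right derivative at \<open>h = 0\<close> of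
  \<open>E[\<phi>(X\<^sub>s\<^sub>+\<^sub>h) | X\<^sub>s = \<zeta>]\<close>. Right derivatives do not see jumps at deterministic times; these are
  excluded by the stochastic continuity.
\<close>

definition past_events ::
  "'w measure \<Rightarrow> (real \<Rightarrow> 'w \<Rightarrow> 's) \<Rightarrow> real \<Rightarrow> real \<Rightarrow> 'w set set" where
  "past_events M X s\<^sub>0 s = sigma_sets (space M) {X r -` B \<inter> space M | r B. r \<in> {s\<^sub>0..s}}"

definition markov_chain ::
  "'s set \<Rightarrow> real \<Rightarrow> (('s \<Rightarrow> real) \<Rightarrow> real \<Rightarrow> 's \<Rightarrow> real) \<Rightarrow>
     'w measure \<Rightarrow> (real \<Rightarrow> 'w \<Rightarrow> 's) \<Rightarrow> real \<Rightarrow> 's \<Rightarrow> bool" where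
  "markov_chain S T A M X s\<^sub>0 \<xi>\<^sub>0 \<longleftrightarrow>
     prob_space M \<and>
     (\<forall>u\<in>{s\<^sub>0..T}. X u \<in> measurable M (count_space S)) \<and>
     (AE \<omega> in M. X s\<^sub>0 \<omega> = \<xi>\<^sub>0) \<and>
     (\<forall>\<omega>\<in>space M. \<forall>u\<in>{s\<^sub>0..<T}. eventually (\<lambda>r. X r \<omega> = X u \<omega>) (at_right u)) \<and>
     (\<forall>\<omega>\<in>space M. \<forall>u\<in>{s\<^sub>0<..T}. \<exists>\<zeta>. eventually (\<lambda>r. X r \<omega> = \<zeta>) (at_left u)) \<and>
     (\<forall>u\<in>{s\<^sub>0..T}.
        ((\<lambda>r. measure M {\<omega>\<in>space M. X r \<omega> \<noteq> X u \<omega>}) \<longlongrightarrow> 0) (at u within {s\<^sub>0..T})) \<and>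
     (\<forall>s\<in>{s\<^sub>0..T}. \<forall>u\<in>{s..T}. \<forall>E\<in>past_events M X s\<^sub>0 s. \<forall>\<zeta>\<in>S. \<forall>\<eta>\<in>S.
        measure M {\<omega>\<in>space M. X s \<omega> = \<zeta> \<and> \<omega> \<in> E} > 0 \<longrightarrow>
        cond_prob M (\<lambda>\<omega>. X u \<omega> = \<eta>) (\<lambda>\<omega>. X s \<omega> = \<zeta> \<and> \<omega> \<in> E)
          = cond_prob M (\<lambda>\<omega>. X u \<omega> = \<eta>) (\<lambda>\<omega>. X s \<omega> = \<zeta>)) \<and>
     (\<forall>\<phi>. \<forall>s\<in>{s\<^sub>0..<T}. \<forall>\<zeta>\<in>S. measure M {\<omega>\<in>space M. X s \<omega> = \<zeta>} > 0 \<longrightarrow>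
        ((\<lambda>h. ((\<Sum>\<eta>\<in>S. \<phi> \<eta> * cond_prob M (\<lambda>\<omega>. X (s + h) \<omega> = \<eta>) (\<lambda>\<omega>. X s \<omega> = \<zeta>)) - \<phi> \<zeta>) / h)
           \<longlongrightarrow> A \<phi> s \<zeta>) (at_right 0))"

text \<open>
  \<open>\<P> \<alpha> \<beta> t \<xi>\<close> plays the role of the law of the chain, driven by \<open>\<alpha>\<close> and \<open>\<beta>\<close> and conditioned on
  \<open>\<Xi>\<^sub>t = \<xi>\<close>; the process \<open>\<Xi>\<close> is a common one, as on path space.
\<close>

type_synonym ('d, 'w) chain_laws =
  "'d control \<Rightarrow> 'd control \<Rightarrow> real \<Rightarrow> 'd state \<Rightarrow> 'w measure"

definition realizes_chains ::
  "'d::finite game \<Rightarrow> ('d, 'w) chain_laws \<Rightarrow> (real \<Rightarrow> 'w \<Rightarrow> 'd state) \<Rightarrow> bool" where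
  "realizes_chains G \<P> \<Xi> \<longleftrightarrow>
     (\<forall>\<alpha>\<in>controls G. \<forall>\<beta>\<in>controls G. \<forall>t\<in>{0..horizon G}. \<forall>\<xi>\<in>states G.
        markov_chain (states G) (horizon G)
          (\<lambda>\<phi> s \<zeta>. gen_x G \<alpha> \<phi> s \<zeta> + gen_mu G \<beta> \<phi> s \<zeta>) (\<P> \<alpha> \<beta> t \<xi>) \<Xi> t \<xi>)"

definition cost ::
  "'d::finite game \<Rightarrow> ('d, 'w) chain_laws \<Rightarrow> (real \<Rightarrow> 'w \<Rightarrow> 'd state) \<Rightarrow>
     real \<Rightarrow> 'd state \<Rightarrow> 'd control \<Rightarrow> 'd control \<Rightarrow> real" where
  "cost G \<P> \<Xi> t \<xi> \<alpha> \<beta> =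
     (LINT \<omega>|\<P> \<alpha> \<beta> t \<xi>.
        (LBINT u:{t..horizon G}. running G (\<Xi> u \<omega>) (\<alpha> u (\<Xi> u \<omega>))) + final G (\<Xi> (horizon G) \<omega>))"

definition val ::
  "'d::finite game \<Rightarrow> ('d, 'w) chain_laws \<Rightarrow> (real \<Rightarrow> 'w \<Rightarrow> 'd state) \<Rightarrow>
     'd control \<Rightarrow> real \<Rightarrow> 'd state \<Rightarrow> real" where
  "val G \<P> \<Xi> \<beta> t \<xi> = (INF \<alpha>\<in>controls G. cost G \<P> \<Xi> t \<xi> \<alpha> \<beta>)"

definition diff_vec :: "'d::finite \<Rightarrow> ('d \<Rightarrow> real) \<Rightarrow> real^'d" where
  "diff_vec x \<phi> = (\<chi> y. \<phi> y - \<phi> x)"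

definition pre_hamiltonian ::
  "'d::finite game \<Rightarrow> 'd state \<Rightarrow> real^'d \<Rightarrow> real^'d \<Rightarrow> real" where
  "pre_hamiltonian G \<xi> p a =
     running G \<xi> a + (\<Sum>y\<in>UNIV - {fst \<xi>}. (rate0 G \<xi> $ y + rate1 G \<xi> $ y * a $ y) * p $ y)"

definition hamiltonian :: "'d::finite game \<Rightarrow> 'd state \<Rightarrow> real^'d \<Rightarrow> real" where
  "hamiltonian G \<xi> p = (INF a\<in>nonneg_vecs (fst \<xi>). pre_hamiltonian G \<xi> p a)"

definition minimizer :: "'d::finite game \<Rightarrow> 'd state \<Rightarrow> real^'d \<Rightarrow> real^'d" where
  "minimizer G \<xi> p =
     (THE a. is_arg_min (pre_hamiltonian G \<xi> p) (\<lambda>a. a \<in> nonneg_vecs (fst \<xi>)) a)"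

definition feedback :: "'d::finite game \<Rightarrow> (real \<Rightarrow> 'd state \<Rightarrow> real) \<Rightarrow> 'd control" where
  "feedback G v t \<xi> = (case \<xi> of (x, \<mu>) \<Rightarrow> minimizer G (x, \<mu>) (diff_vec x (\<lambda>y. v t (y, \<mu>))))"

definition best_response ::
  "'d::finite game \<Rightarrow> ('d, 'w) chain_laws \<Rightarrow> (real \<Rightarrow> 'w \<Rightarrow> 'd state) \<Rightarrow>
     'd control \<Rightarrow> 'd control" where
  "best_response G \<P> \<Xi> \<beta> = feedback G (val G \<P> \<Xi> \<beta>)"

definition markov_perfect_eq ::
  "'d::finite game \<Rightarrow> ('d, 'w) chain_laws \<Rightarrow> (real \<Rightarrow> 'w \<Rightarrow> 'd state) \<Rightarrow> 'd control \<Rightarrow> bool" where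
  "markov_perfect_eq G \<P> \<Xi> \<alpha> \<longleftrightarrow>
     \<alpha> \<in> controls G \<and>
     (\<forall>t\<in>{0..horizon G}. \<forall>\<xi>\<in>states G. \<alpha> t \<xi> = best_response G \<P> \<Xi> \<alpha> t \<xi>)"

definition NLL_solution :: "'d::finite game \<Rightarrow> (real \<Rightarrow> 'd state \<Rightarrow> real) \<Rightarrow> bool" where
  "NLL_solution G v \<longleftrightarrow>
     (\<forall>(x, \<mu>)\<in>states G.
        v (horizon G) (x, \<mu>) = final G (x, \<mu>) \<and>
        (\<exists>v'. continuous_on {0..horizon G} v' \<and>
           (\<forall>t\<in>{0..horizon G}.
              ((\<lambda>s. v s (x, \<mu>)) has_real_derivative v' t) (at t within {0..horizon G}) \<and>
              - v' t = hamiltonian G (x, \<mu>) (diff_vec x (\<lambda>y. v t (y, \<mu>)))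
                       + gen_mu G (feedback G v) (v t) t (x, \<mu>))))"

end

theory Submission
  imports Defs
begin

text \<open>
  The value \<open>v\<^sup>\<beta>\<close> solves a Hamilton-Jacobi-Bellman system of ordinary differential equations on the
  finite state space. If \<open>v\<close> and \<open>v'\<close> are the values for \<open>\<beta>\<close> and \<open>\<beta>'\<close>, then at a maximal state of
  \<open>v(t) - v'(t)\<close> the Hamiltonians satisfy \<open>H(\<Delta>v) \<le> H(\<Delta>v')\<close> and the generator is nonpositive, so only
  the change of the population control drives the difference. Hence, by a minimum principle,
  \<open>|\<beta> - \<beta>'|(t) \<le> D exp(\<kappa>(T - t))\<close> implies \<open>|v - v'|(t) \<le> (C / \<kappa>) D exp(\<kappa>(T - t))\<close>. The minimizer
  of the Hamiltonian is Lipschitz by strong convexity, so for large \<open>\<kappa>\<close> the best response is a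
  contraction in the norm with this weight, and so is its average with the identity. The limit
  of the iteration is the equilibrium; uniform convergence of the values and of their time
  derivatives gives the \<open>N\<close>-NLL equation.
\<close>

section \<open>One-sided derivatives, a minimum principle, and finite systems of differential equations\<close>

text \<open>The value is an infimum of expectations under abstract chain laws, so it must first be
  tied to a differential equation. A chain is known only through right derivatives of conditional
  expectations and stochastic continuity. The verification argument therefore differentiates
  expectations along the law of the chain from the right, and concludes because a continuous
  function with nonnegative right derivative cannot decrease. All constants in the contraction
  estimate have to be uniform in the population control, although its rates enter the equation as
  coefficients. This works because the population generator has a sign at extremal states whatever
  the size of its rates: the value stays in \<open>{0..value_bound}\<close> for every control, and
  one weight serves all iterates. Solutions of the \<open>N\<close>-NLL equation are exactly the
  solutions of the Hamilton-Jacobi-Bellman equation whose population control is their own feedback.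
  This reduces their uniqueness to that of the equilibrium.\<close>

text \<open>A small upward tilt makes the right derivative strictly positive. The tilted function
  then has no maximum before \<open>b\<close>, and a maximum at \<open>b\<close> contradicts
  \<open>k b < k a\<close>.\<close>

lemma nondecreasing_if_right_derivative_nonneg:
  fixes f :: "real \<Rightarrow> real"
  assumes "a \<le> b" and cont: "continuous_on {a..b} f"
    and der: "\<And>s. s \<in> {a..<b} \<Longrightarrow> (f has_real_derivative f' s) (at_right s)"
    and nonneg: "\<And>s. s \<in> {a..<b} \<Longrightarrow> f' s \<ge> 0"
  shows "f a \<le> f b"
proof (rule ccontr)
  assume "\<not> f a \<le> f b"
  then have ab: "a < b" and fab: "f b < f a"
    using \<open>a \<le> b\<close> by (auto simp: less_le)
  \<comment> \<open>Half the mean rate of descent, so that the tilt recovers only half of the drop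
    from \<open>a\<close> to \<open>b\<close>.\<close>
  define e where "e = (f a - f b) / (2 * (b - a))"
  define k where "k = (\<lambda>s. f s + e * (s - a))"
  have e: "e > 0" using ab fab by (simp add: e_def)
  have "e * (b - a) = (f a - f b) / 2" using ab by (simp add: e_def divide_simps)
  then have kb: "k b < k a" using fab by (simp add: k_def)
  have "continuous_on {a..b} k"
    unfolding k_def using cont by (intro continuous_intros)
  then obtain c where c: "c \<in> {a..b}" and cmax: "\<And>s. s \<in> {a..b} \<Longrightarrow> k s \<le> k c"
    using continuous_attains_sup[of "{a..b}" k] ab by auto
  have "c < b"
    using c kb cmax[of a] ab by (cases "c = b") auto
  then have "(f has_real_derivative f' c) (at_right c)" "f' c \<ge> 0"
    using der nonneg c by auto
  then have "(k has_real_derivative f' c + e) (at_right c)" "f' c + e > 0"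
    unfolding k_def using e by (auto intro!: derivative_eq_intros)
  from has_real_derivative_pos_inc_right[OF this] obtain d where
    d: "d > 0" "\<And>h. h > 0 \<Longrightarrow> h < d \<Longrightarrow> k c < k (c + h)" by auto
  define h where "h = min (d / 2) (b - c)"
  have "h > 0" "h < d" "c + h \<in> {a..b}"
    using d \<open>c < b\<close> c by (auto simp: h_def min_def)
  with d(2)[of h] cmax[of "c + h"] show False by simp
qed

text \<open>
  The perturbation \<open>u + e (T - t)\<close> turns the weak inequality at minima into a strict one, which
  is incompatible with an interior minimum over time and state.
\<close>

lemma finite_minimum_principle:
  fixes u :: "real \<Rightarrow> 's \<Rightarrow> real"
  assumes fin: "finite S"
    and der: "\<And>t \<xi>. t \<in> {0..T} \<Longrightarrow> \<xi> \<in> S \<Longrightarrow>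
      ((\<lambda>s. u s \<xi>) has_real_derivative u' t \<xi>) (at t within {0..T})"
    and final: "\<And>\<xi>. \<xi> \<in> S \<Longrightarrow> u T \<xi> \<ge> 0"
    and min: "\<And>t \<xi>. t \<in> {0..T} \<Longrightarrow> \<xi> \<in> S \<Longrightarrow> (\<And>\<eta>. \<eta> \<in> S \<Longrightarrow> u t \<xi> \<le> u t \<eta>) \<Longrightarrow> u' t \<xi> \<le> 0"
    and t: "t \<in> {0..T}" and \<xi>: "\<xi> \<in> S"
  shows "u t \<xi> \<ge> 0"
proof (rule ccontr)
  assume neg: "\<not> u t \<xi> \<ge> 0"
  \<comment> \<open>The tilt adds at most \<open>- u t \<xi> / 2\<close> at the bad point, which
    leaves \<open>U\<close> negative there; \<open>T + 1\<close> avoids a division by zero when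
    \<open>T = 0\<close>.\<close>
  define e where "e = - u t \<xi> / (2 * (T + 1))"
  define U where "U = (\<lambda>s \<eta>. u s \<eta> + e * (T - s))"
  have e: "e > 0" using neg t by (auto simp: e_def divide_simps)
  have "e * (T - t) \<le> e * (T + 1)" using e t by (intro mult_left_mono) auto
  also have "\<dots> = - u t \<xi> / 2" using t by (simp add: e_def divide_simps)
  finally have Uneg: "U t \<xi> < 0" using neg by (simp add: U_def)
  have cont: "continuous_on {0..T} (\<lambda>s. U s \<eta>)" if "\<eta> \<in> S" for \<eta>
    unfolding U_def using DERIV_continuous_on[OF der[OF _ that]] by (intro continuous_intros) auto
  have "\<exists>c\<in>{0..T}. \<forall>s\<in>{0..T}. U c \<eta> \<le> U s \<eta>" if "\<eta> \<in> S" for \<eta>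
    by (rule continuous_attains_inf) (use cont[OF that] t in auto)
  then obtain c where c: "\<And>\<eta>. \<eta> \<in> S \<Longrightarrow> c \<eta> \<in> {0..T}"
    and cmin: "\<And>\<eta> s. \<eta> \<in> S \<Longrightarrow> s \<in> {0..T} \<Longrightarrow> U (c \<eta>) \<eta> \<le> U s \<eta>"
    by metis
  obtain z where z: "z \<in> S" "\<And>\<eta>. \<eta> \<in> S \<Longrightarrow> U (c z) z \<le> U (c \<eta>) \<eta>"
    using ex_is_arg_min_if_finite[OF fin, of "\<lambda>\<eta>. U (c \<eta>) \<eta>"] \<xi>
    by (auto simp: is_arg_min_linorder)
  have zmin: "U (c z) z \<le> U s \<eta>" if "s \<in> {0..T}" "\<eta> \<in> S" for s \<eta>
    using z(2)[OF that(2)] cmin[OF that(2,1)] by linarith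
  \<comment> \<open>At \<open>T\<close> the tilt vanishes and \<open>u\<close> is nonnegative,
    whereas the minimum is negative; so the minimal point lies before \<open>T\<close> and time can
    move forward from it.\<close>
  have "c z \<noteq> T"
    using zmin[OF t \<xi>] Uneg final[OF z(1)] by (auto simp: U_def)
  then have cT: "c z \<in> {0..<T}" using c[OF z(1)] by auto
  have "u (c z) z \<le> u (c z) \<eta>" if "\<eta> \<in> S" for \<eta>
    using zmin[of "c z", OF _ that] cT by (auto simp: U_def)
  then have "u' (c z) z - e < 0"
    using min[of "c z" z] cT z(1) e by fastforce
  moreover have "((\<lambda>s. U s z) has_real_derivative u' (c z) z - e) (at (c z) within {0..T})"
    unfolding U_def using der[of "c z" z] cT z(1) by (auto intro!: derivative_eq_intros)
  ultimately obtain d where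
    d: "d > 0" "\<And>h. h > 0 \<Longrightarrow> c z + h \<in> {0..T} \<Longrightarrow> h < d \<Longrightarrow> U (c z + h) z < U (c z) z"
    using has_real_derivative_neg_dec_right by blast
  define h where "h = min (d / 2) (T - c z)"
  have "h > 0" "h < d" "c z + h \<in> {0..T}"
    using d cT by (auto simp: h_def min_def)
  with d(2)[of h] zmin[of "c z + h" z] z(1) show False by fastforce
qed

section \<open>Uniform limits and backward Picard iteration\<close>

text \<open>Telescoping turns the sequence into a series of increments, to which the Weierstrass
  M-test applies.\<close>

lemma geometric_uniform_limit:
  fixes u :: "nat \<Rightarrow> 'a \<Rightarrow> 'b::banach"
  assumes bound: "\<And>n x. x \<in> X \<Longrightarrow> norm (u (Suc n) x - u n x) \<le> C * q ^ n"
    and q: "0 \<le> q" "q < 1"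
  obtains l where "uniform_limit X u l sequentially"
proof -
  have "uniform_limit X (\<lambda>n x. \<Sum>i<n. u (Suc i) x - u i x)
      (\<lambda>x. \<Sum>i. u (Suc i) x - u i x) sequentially"
    by (rule Weierstrass_m_test[where M = "\<lambda>n. C * q ^ n"])
      (use bound q in \<open>auto intro!: summable_mult summable_geometric\<close>)
  then have "uniform_limit X (\<lambda>n x. (\<Sum>i<n. u (Suc i) x - u i x) + u 0 x)
      (\<lambda>x. (\<Sum>i. u (Suc i) x - u i x) + u 0 x) sequentially"
    by (intro uniform_limit_add uniform_limit_const)
  moreover have "(\<Sum>i<n. u (Suc i) x - u i x) + u 0 x = u n x" for n x
    by (induction n) (auto simp: algebra_simps)
  ultimately show ?thesis using that by simp
qed

text \<open>The theorem on sequences of derivatives provides a limit \<open>g\<close> of its own.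
  Pointwise limits are unique, so \<open>g\<close> and \<open>U\<close> agree on the interval and
  the derivative carries over to \<open>U\<close>.\<close>

lemma has_real_derivative_uniform_limit:
  fixes u :: "nat \<Rightarrow> real \<Rightarrow> real"
  assumes der: "\<And>n t. t \<in> {a..b} \<Longrightarrow> (u n has_real_derivative u' n t) (at t within {a..b})"
    and lim': "uniform_limit {a..b} u' U' sequentially"
    and lim: "\<And>t. t \<in> {a..b} \<Longrightarrow> (\<lambda>n. u n t) \<longlonglongrightarrow> U t"
    and t: "t \<in> {a..b}"
  shows "(U has_real_derivative U' t) (at t within {a..b})"
proof -
  have "\<exists>g. \<forall>x\<in>{a..b}. (\<lambda>n. u n x) \<longlonglongrightarrow> g x \<and> (g has_derivative (*) (U' x)) (at x within {a..b})"
  proof (rule has_derivative_sequence)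
    show "\<forall>\<^sub>F n in sequentially. \<forall>x\<in>{a..b}. \<forall>h. norm (u' n x * h - U' x * h) \<le> e * norm h"
      if "e > 0" for e
      using uniform_limitD[OF lim' that]
      by eventually_elim
        (auto simp: dist_norm left_diff_distrib[symmetric] abs_mult less_imp_le mult_right_mono)
    show "(u n has_derivative (*) (u' n x)) (at x within {a..b})" if "x \<in> {a..b}" for n x
      using der[OF that] by (simp add: has_field_derivative_def)
  qed (use t lim in auto)
  then obtain g where g: "\<And>x. x \<in> {a..b} \<Longrightarrow> (\<lambda>n. u n x) \<longlonglongrightarrow> g x"
    "\<And>x. x \<in> {a..b} \<Longrightarrow> (g has_real_derivative U' x) (at x within {a..b})"
    unfolding has_field_derivative_def by blast
  have "g x = U x" if "x \<in> {a..b}" for x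
    using g(1)[OF that] lim[OF that] by (rule LIMSEQ_unique)
  then show ?thesis
    using has_field_derivative_transform_within[OF g(2)[OF t], of 1] t by auto
qed

text \<open>Integrating the weight gains a factor \<open>1 / \<kappa>\<close>. This is what makes
  Picard iteration a contraction on the whole time interval at once.\<close>

lemma integral_exp_weight_le:
  fixes f :: "real \<Rightarrow> real"
  assumes "\<kappa> > 0" "t \<le> T" "C \<ge> 0" and cont: "continuous_on {t..T} f"
    and bound: "\<And>s. s \<in> {t..T} \<Longrightarrow> \<bar>f s\<bar> \<le> C * exp (\<kappa> * (T - s))"
  shows "\<bar>integral {t..T} f\<bar> \<le> C / \<kappa> * exp (\<kappa> * (T - t))"
proof -
  have "((\<lambda>s. - (C / \<kappa>) * exp (\<kappa> * (T - s))) has_vector_derivative C * exp (\<kappa> * (T - s)))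
      (at s within {t..T})" for s
    unfolding has_real_derivative_iff_has_vector_derivative[symmetric]
    using assms(1) by (auto intro!: derivative_eq_intros simp: field_simps)
  then have int: "((\<lambda>s. C * exp (\<kappa> * (T - s))) has_integral
      - (C / \<kappa>) * exp (\<kappa> * (T - T)) - - (C / \<kappa>) * exp (\<kappa> * (T - t))) {t..T}"
    using assms(2) by (intro fundamental_theorem_of_calculus) auto
  have "norm (integral {t..T} f) \<le> integral {t..T} (\<lambda>s. C * exp (\<kappa> * (T - s)))"
    by (rule integral_norm_bound_integral)
      (use bound int in \<open>auto intro!: integrable_continuous_interval cont continuous_intros\<close>)
  also have "\<dots> = C / \<kappa> * exp (\<kappa> * (T - t)) - C / \<kappa>"
    using integral_unique[OF int] by simp
  also have "\<dots> \<le> C / \<kappa> * exp (\<kappa> * (T - t))"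
    using assms by simp
  finally show ?thesis by simp
qed

text \<open>Picard iteration backwards from the final time. The Lipschitz bound compares functions
  on \<open>S\<close> only, so it also says that \<open>F\<close> ignores values outside
  \<open>S\<close>.\<close>

lemma finite_ode_solution:
  fixes F :: "real \<Rightarrow> ('s \<Rightarrow> real) \<Rightarrow> 's \<Rightarrow> real"
  assumes fin: "finite S" and T: "T \<ge> 0" and K: "K > 0"
    and lip: "\<And>t \<xi> \<phi> \<psi> D. t \<in> {0..T} \<Longrightarrow> \<xi> \<in> S \<Longrightarrow> (\<And>\<eta>. \<eta> \<in> S \<Longrightarrow> \<bar>\<phi> \<eta> - \<psi> \<eta>\<bar> \<le> D) \<Longrightarrow>
      \<bar>F t \<phi> \<xi> - F t \<psi> \<xi>\<bar> \<le> K * D"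
    and cont: "\<And>u \<xi>. \<xi> \<in> S \<Longrightarrow> (\<And>\<eta>. \<eta> \<in> S \<Longrightarrow> continuous_on {0..T} (\<lambda>t. u t \<eta>)) \<Longrightarrow>
      continuous_on {0..T} (\<lambda>t. F t (u t) \<xi>)"
  obtains u where "\<And>\<xi>. \<xi> \<in> S \<Longrightarrow> u T \<xi> = g \<xi>"
    and "\<And>t \<xi>. t \<in> {0..T} \<Longrightarrow> \<xi> \<in> S \<Longrightarrow>
      ((\<lambda>s. u s \<xi>) has_real_derivative - F t (u t) \<xi>) (at t within {0..T})"
proof -
  define U where
    "U = rec_nat (\<lambda>t. g) (\<lambda>_ u t \<xi>. g \<xi> + integral {t..T} (\<lambda>s. F s (u s) \<xi>))"
  have U_0: "U 0 = (\<lambda>t. g)"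
    and U_Suc: "U (Suc n) = (\<lambda>t \<xi>. g \<xi> + integral {t..T} (\<lambda>s. F s (U n s) \<xi>))" for n
    by (auto simp: U_def)
  have contU: "continuous_on {0..T} (\<lambda>t. U n t \<xi>)" if "\<xi> \<in> S" for n \<xi>
    using that
  proof (induction n arbitrary: \<xi>)
    case (Suc n)
    have "continuous_on {0..T} (\<lambda>s. F s (U n s) \<xi>)"
      using Suc by (intro cont) auto
    then have "((\<lambda>t. U (Suc n) t \<xi>) has_real_derivative - F t (U n t) \<xi>) (at t within {0..T})"
      if "t \<in> {0..T}" for t
      unfolding U_Suc using that
      by (auto intro!: derivative_eq_intros integral_has_real_derivative')
    then show ?case by (rule DERIV_continuous_on)
  qed (simp add: U_0)
  have derU: "((\<lambda>t. U (Suc n) t \<xi>) has_real_derivative - F t (U n t) \<xi>) (at t within {0..T})"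
    if "t \<in> {0..T}" "\<xi> \<in> S" for n t \<xi>
    unfolding U_Suc using that cont contU
    by (auto intro!: derivative_eq_intros integral_has_real_derivative')
  have "\<exists>C0. \<forall>t\<in>{0..T}. \<bar>F t g \<xi>\<bar> \<le> C0" if "\<xi> \<in> S" for \<xi>
  proof -
    have "compact ((\<lambda>t. F t g \<xi>) ` {0..T})"
      using cont[OF that, of "\<lambda>_. g"] by (intro compact_continuous_image) auto
    then show ?thesis
      using compact_imp_bounded bounded_iff by (metis imageI real_norm_def)
  qed
  then obtain c where c: "\<And>t \<xi>. \<xi> \<in> S \<Longrightarrow> t \<in> {0..T} \<Longrightarrow> \<bar>F t g \<xi>\<bar> \<le> c \<xi>" by metis
  define C where "C = (\<Sum>\<xi>\<in>S. \<bar>c \<xi>\<bar>)"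
  have C: "\<bar>F t g \<xi>\<bar> \<le> C" if "\<xi> \<in> S" "t \<in> {0..T}" for t \<xi>
    using c[OF that] member_le_sum[OF that(1), of "\<lambda>\<xi>. \<bar>c \<xi>\<bar>"] fin by (simp add: C_def)
  have C0: "C \<ge> 0" by (simp add: C_def sum_nonneg)
  \<comment> \<open>Twice the Lipschitz constant, so that each Picard step contracts by
    \<open>K / \<kappa> = 1/2\<close> in the weighted norm.\<close>
  define \<kappa> where "\<kappa> = 2 * K"
  have \<kappa>: "\<kappa> > 0" using K by (simp add: \<kappa>_def)
  have step: "\<bar>U (Suc n) t \<xi> - U n t \<xi>\<bar> \<le> C / \<kappa> * (1/2) ^ n * exp (\<kappa> * (T - t))"
    if "t \<in> {0..T}" "\<xi> \<in> S" for n t \<xi>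
    using that
  proof (induction n arbitrary: t \<xi>)
    case 0
    have "C \<le> C * exp (\<kappa> * (T - s))" if "s \<le> T" for s
      using mult_left_mono[of 1 "exp (\<kappa> * (T - s))" C] C0 \<kappa> that by simp
    then have "\<bar>integral {t..T} (\<lambda>s. F s g \<xi>)\<bar> \<le> C / \<kappa> * exp (\<kappa> * (T - t))"
      using 0 C0 \<kappa>
      by (intro integral_exp_weight_le)
        (auto intro!: continuous_on_subset[OF cont[of \<xi> "\<lambda>_. g"]] intro: order.trans[OF C])
    then show ?case by (simp add: U_Suc U_0)
  next
    case (Suc n)
    have int: "(\<lambda>s. F s (U m s) \<xi>) integrable_on {t..T}" for m
      by (rule integrable_continuous_interval, rule continuous_on_subset[OF cont])
        (use Suc.prems contU in auto)
    have "\<bar>integral {t..T} (\<lambda>s. F s (U (Suc n) s) \<xi> - F s (U n s) \<xi>)\<bar>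
        \<le> (K * (C / \<kappa> * (1/2) ^ n)) / \<kappa> * exp (\<kappa> * (T - t))"
    proof (rule integral_exp_weight_le)
      show "continuous_on {t..T} (\<lambda>s. F s (U (Suc n) s) \<xi> - F s (U n s) \<xi>)"
        using Suc.prems contU
        by (intro continuous_intros) (auto intro!: continuous_on_subset[OF cont])
      show "\<bar>F s (U (Suc n) s) \<xi> - F s (U n s) \<xi>\<bar> \<le> K * (C / \<kappa> * (1/2) ^ n) * exp (\<kappa> * (T - s))"
        if "s \<in> {t..T}" for s
        using lip[of s \<xi> "U (Suc n) s" "U n s" "C / \<kappa> * (1/2) ^ n * exp (\<kappa> * (T - s))"]
          Suc that by (simp add: mult.assoc)
    qed (use \<kappa> Suc.prems K C0 in auto)
    also have "(K * (C / \<kappa> * (1/2) ^ n)) / \<kappa> = C / \<kappa> * (1/2) ^ Suc n"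
      using K by (simp add: \<kappa>_def field_simps)
    finally show ?case
      unfolding U_Suc[of "Suc n"] U_Suc[of n] using int[of "Suc n"] int[of n]
      by (simp add: U_Suc integral_diff)
  qed
  have "norm (U (Suc n) (fst p) (snd p) - U n (fst p) (snd p)) \<le> C / \<kappa> * exp (\<kappa> * T) * (1/2) ^ n"
    if "p \<in> {0..T} \<times> S" for n p
  proof -
    have "exp (\<kappa> * (T - fst p)) \<le> exp (\<kappa> * T)" using that \<kappa> by (auto simp: mem_Times_iff)
    then have "C / \<kappa> * (1/2) ^ n * exp (\<kappa> * (T - fst p)) \<le> C / \<kappa> * (1/2) ^ n * exp (\<kappa> * T)"
      using C0 \<kappa> by (intro mult_left_mono) auto
    then show ?thesis
      using step[of "fst p" "snd p" n] that by (auto simp: mem_Times_iff mult_ac)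
  qed
  then obtain l where l: "uniform_limit ({0..T} \<times> S) (\<lambda>n p. U n (fst p) (snd p)) l sequentially"
    by (rule geometric_uniform_limit) auto
  define u where "u = (\<lambda>t \<xi>. l (t, \<xi>))"
  have lim: "(\<lambda>n. U n t \<xi>) \<longlonglongrightarrow> u t \<xi>" if "t \<in> {0..T}" "\<xi> \<in> S" for t \<xi>
    using tendsto_uniform_limitI[OF l, of "(t, \<xi>)"] that by (simp add: u_def)
  have "u T \<xi> = g \<xi>" if "\<xi> \<in> S" for \<xi>
  proof -
    have "U n T \<xi> = g \<xi>" for n by (cases n) (auto simp: U_0 U_Suc)
    then show ?thesis using lim[of T \<xi>] that T by (simp add: LIMSEQ_const_iff)
  qed
  moreover have "((\<lambda>s. u s \<xi>) has_real_derivative - F t (u t) \<xi>) (at t within {0..T})"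
    if t: "t \<in> {0..T}" and \<xi>: "\<xi> \<in> S" for t \<xi>
  proof (rule has_real_derivative_uniform_limit[OF derU[OF _ \<xi>] _ _ t])
    show "(\<lambda>n. U (Suc n) s \<xi>) \<longlonglongrightarrow> u s \<xi>" if "s \<in> {0..T}" for s
      using lim[OF that \<xi>] by (rule LIMSEQ_Suc)
    show "uniform_limit {0..T} (\<lambda>n s. - F s (U n s) \<xi>) (\<lambda>s. - F s (u s) \<xi>) sequentially"
    proof (rule uniform_limitI)
      fix e :: real assume "e > 0"
      then have "e / (2 * K) > 0" using K by simp
      from uniform_limitD[OF l this]
      show "\<forall>\<^sub>F n in sequentially. \<forall>s\<in>{0..T}. dist (- F s (U n s) \<xi>) (- F s (u s) \<xi>) < e"
      proof eventually_elim
        case (elim n)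
        show ?case
        proof
          fix s assume s: "s \<in> {0..T}"
          have "\<bar>F s (U n s) \<xi> - F s (u s) \<xi>\<bar> \<le> K * (e / (2 * K))"
            using elim s by (intro lip[OF s \<xi>]) (force simp: u_def dist_real_def)
          then show "dist (- F s (U n s) \<xi>) (- F s (u s) \<xi>) < e"
            using K \<open>e > 0\<close> by (simp add: dist_real_def abs_minus_commute)
        qed
      qed
    qed
  qed
  ultimately show ?thesis by (rule that)
qed

section \<open>Finite-state Markov chains\<close>

text \<open>Fubini's theorem needs the path to be jointly measurable in time and outcome, while only
  each \<open>X u\<close> is assumed measurable. Right continuity helps: sampling at the next grid
  time gives jointly measurable approximations that eventually equal the path.\<close>

lemma integral_jump_path:
  fixes M :: "'w measure" and c :: "real \<Rightarrow> 's \<Rightarrow> real"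
  assumes "prob_space M" and fin: "finite S" and ab: "a \<le> b"
    and meas: "\<And>u. u \<in> {a..b} \<Longrightarrow> X u \<in> measurable M (count_space S)"
    and right_cont: "\<And>\<omega> u. \<omega> \<in> space M \<Longrightarrow> u \<in> {a..<b} \<Longrightarrow>
      eventually (\<lambda>r. X r \<omega> = X u \<omega>) (at_right u)"
    and cont: "\<And>\<zeta>. \<zeta> \<in> S \<Longrightarrow> continuous_on {a..b} (\<lambda>u. c u \<zeta>)"
  shows "integrable M (\<lambda>\<omega>. LBINT u:{a..b}. c u (X u \<omega>))"
    and "(LINT \<omega>|M. (LBINT u:{a..b}. c u (X u \<omega>)))
      = (LBINT u:{a..b}. (\<Sum>\<zeta>\<in>S. measure M {\<omega>\<in>space M. X u \<omega> = \<zeta>} * c u \<zeta>))"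
proof -
  interpret prob_space M by fact
  interpret P: pair_sigma_finite lborel M ..
  \<comment> \<open>The next multiple of \<open>1 / (n + 1)\<close> strictly to the right of
    \<open>u\<close>, clipped to the interval. It approaches \<open>u\<close> from the side on which
    paths are locally constant.\<close>
  define p where "p = (\<lambda>n::nat. \<lambda>u::real. min b (max a ((of_int \<lfloor>real (Suc n) * u\<rfloor> + 1) / real (Suc n))))"
  have p_range: "p n u \<in> {a..b}" for n u using ab by (auto simp: p_def)
  have p_ge: "p n u \<ge> u" and p_less: "p n u \<le> u + 1 / real (Suc n)" if "u \<in> {a..b}" for n u
  proof -
    have "real (Suc n) * u \<le> of_int \<lfloor>real (Suc n) * u\<rfloor> + 1" by linarith
    then have "u \<le> (of_int \<lfloor>real (Suc n) * u\<rfloor> + 1) / real (Suc n)"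
      by (simp add: pos_le_divide_eq mult.commute del: of_nat_Suc)
    then show "p n u \<ge> u" using that by (auto simp: p_def)
    have "of_int \<lfloor>real (Suc n) * u\<rfloor> + 1 \<le> real (Suc n) * u + 1" by linarith
    then have "(of_int \<lfloor>real (Suc n) * u\<rfloor> + 1) / real (Suc n) \<le> (real (Suc n) * u + 1) / real (Suc n)"
      by (intro divide_right_mono) auto
    then have "(of_int \<lfloor>real (Suc n) * u\<rfloor> + 1) / real (Suc n) \<le> u + 1 / real (Suc n)"
      by (simp add: add_divide_distrib del: of_nat_Suc)
    moreover have "0 \<le> 1 / real (Suc n)" by simp
    ultimately show "p n u \<le> u + 1 / real (Suc n)"
      using that unfolding p_def atLeastAtMost_iff by linarith
  qed
  \<comment> \<open>States are discrete, so convergence means being eventually equal. At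
    \<open>u = b\<close> the clipping gives \<open>p n u = u\<close>, hence right continuity before
    \<open>b\<close> suffices.\<close>
  have ev: "\<forall>\<^sub>F n in sequentially. X (p n u) \<omega> = X u \<omega>" if "\<omega> \<in> space M" "u \<in> {a..b}" for \<omega> u
  proof (cases "u = b")
    case True
    then have "p n u = u" for n using p_range[of n u] p_ge[of u n] that by auto
    then show ?thesis by simp
  next
    case False
    then have "eventually (\<lambda>r. X r \<omega> = X u \<omega>) (at_right u)"
      using right_cont that by auto
    then obtain e where e: "e > u" "\<And>r. r > u \<Longrightarrow> r < e \<Longrightarrow> X r \<omega> = X u \<omega>"
      by (auto simp: eventually_at_right_field)
    have "(\<lambda>n. u + 1 / real (Suc n)) \<longlonglongrightarrow> u + 0"
      by (intro tendsto_intros LIMSEQ_Suc[OF lim_1_over_n])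
    then have "\<forall>\<^sub>F n in sequentially. u + 1 / real (Suc n) < e"
      using e(1) by (intro order_tendstoD) auto
    then show ?thesis
    proof eventually_elim
      case (elim n)
      then show ?case
        using p_ge[OF that(2), of n] p_less[OF that(2), of n] e(2)[of "p n u"]
        by (cases "p n u = u") auto
    qed
  qed
  define I where "I = (\<lambda>\<zeta> (u, \<omega>). indicator {a..b} u * indicator {\<omega>. X u \<omega> = \<zeta>} \<omega> :: real)"
  have I_meas [measurable]: "I \<zeta> \<in> borel_measurable (lborel \<Otimes>\<^sub>M M)" if "\<zeta> \<in> S" for \<zeta>
  proof (rule borel_measurable_LIMSEQ_real)
    fix n
    have "(\<lambda>q. X (p n (fst q)) (snd q)) \<in> measurable (lborel \<Otimes>\<^sub>M M) (count_space S)"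
      unfolding p_def
    \<comment> \<open>For a fixed value \<open>k\<close> of the floor the sampling time no longer
      depends on \<open>u\<close>, and there are only countably many values.\<close>
    proof (rule measurable_compose_countable'
        [where g = "\<lambda>q. \<lfloor>real (Suc n) * fst q\<rfloor>" and I = UNIV
           and f = "\<lambda>k q. X (min b (max a ((of_int k + 1) / real (Suc n)))) (snd q)"])
      show "(\<lambda>q. X (min b (max a ((of_int k + 1) / real (Suc n)))) (snd q))
          \<in> measurable (lborel \<Otimes>\<^sub>M M) (count_space S)" for k :: int
        by (rule measurable_compose[OF measurable_snd meas]) (use ab in auto)
      show "(\<lambda>q. \<lfloor>real (Suc n) * fst q\<rfloor>) \<in> measurable (lborel \<Otimes>\<^sub>M M) (count_space UNIV)"
        by measurable
    qed auto
    then have "(\<lambda>q. indicator {\<zeta>} (X (p n (fst q)) (snd q)) :: real) \<in> borel_measurable (lborel \<Otimes>\<^sub>M M)"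
      by (rule measurable_compose) auto
    then show "(\<lambda>q. indicator {a..b} (fst q) * indicator {\<zeta>} (X (p n (fst q)) (snd q)) :: real)
        \<in> borel_measurable (lborel \<Otimes>\<^sub>M M)"
      by measurable
  next
    fix q :: "real \<times> 'w"
    assume q: "q \<in> space (lborel \<Otimes>\<^sub>M M)"
    show "(\<lambda>n. indicator {a..b} (fst q) * indicator {\<zeta>} (X (p n (fst q)) (snd q)) :: real) \<longlonglongrightarrow> I \<zeta> q"
    proof (cases "fst q \<in> {a..b}")
      case True
      then have "\<forall>\<^sub>F n in sequentially. X (p n (fst q)) (snd q) = X (fst q) (snd q)"
        using q by (intro ev) (auto simp: space_pair_measure)
      then have "\<forall>\<^sub>F n in sequentially.
          indicator {a..b} (fst q) * indicator {\<zeta>} (X (p n (fst q)) (snd q)) = I \<zeta> q"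
        by eventually_elim (simp add: I_def case_prod_unfold indicator_def)
      then show ?thesis by (rule tendsto_eventually)
    qed (simp add: I_def case_prod_unfold)
  qed
  define c' where "c' = (\<lambda>\<zeta> u. indicator {a..b} u * c u \<zeta>)"
  have c'_meas [measurable]: "c' \<zeta> \<in> borel_measurable lborel" if "\<zeta> \<in> S" for \<zeta>
    using borel_measurable_continuous_on_indicator[OF _ cont[OF that]]
    by (simp add: c'_def)
  have c'_int: "integrable lborel (c' \<zeta>)" if "\<zeta> \<in> S" for \<zeta>
    using borel_integrable_atLeastAtMost'[OF cont[OF that]]
    by (simp add: c'_def set_integrable_def)
  have term_int: "integrable (lborel \<Otimes>\<^sub>M M) (\<lambda>(u, \<omega>). c' \<zeta> u * I \<zeta> (u, \<omega>))" if \<zeta>: "\<zeta> \<in> S" for \<zeta>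
  proof (rule Bochner_Integration.integrable_bound)
    show "integrable (lborel \<Otimes>\<^sub>M M) (\<lambda>(u, \<omega>). c' \<zeta> u)"
    proof (rule P.Fubini_integrable)
      show "(\<lambda>(u, \<omega>). c' \<zeta> u) \<in> borel_measurable (lborel \<Otimes>\<^sub>M M)"
        using \<zeta> by measurable
    qed (use c'_int[OF \<zeta>] in \<open>auto simp: prob_space\<close>)
    show "(\<lambda>(u, \<omega>). c' \<zeta> u * I \<zeta> (u, \<omega>)) \<in> borel_measurable (lborel \<Otimes>\<^sub>M M)"
      using \<zeta> by (simp add: case_prod_unfold) measurable
  qed (auto simp: I_def indicator_def)
  have int: "integrable (lborel \<Otimes>\<^sub>M M) (\<lambda>(u, \<omega>). (\<Sum>\<zeta>\<in>S. c' \<zeta> u * I \<zeta> (u, \<omega>)))"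
    using term_int by (simp add: case_prod_unfold)
  \<comment> \<open>With finitely many states, the cost along the path is a finite sum of products
    of a function of time and an indicator, each integrable on the product space.\<close>
  have expand: "indicator {a..b} u *\<^sub>R c u (X u \<omega>) = (\<Sum>\<zeta>\<in>S. c' \<zeta> u * I \<zeta> (u, \<omega>))"
    if "\<omega> \<in> space M" for u \<omega>
  proof (cases "u \<in> {a..b}")
    case True
    then have "X u \<omega> \<in> S" using measurable_space[OF meas that] by auto
    then show ?thesis
      using True fin sum.remove[OF fin, of "X u \<omega>" "\<lambda>\<zeta>. c' \<zeta> u * I \<zeta> (u, \<omega>)"]
      by (auto simp: c'_def I_def indicator_def intro!: sum.neutral)
  qed (simp add: c'_def)
  have path: "(LBINT u:{a..b}. c u (X u \<omega>)) = (LINT u|lborel. (\<Sum>\<zeta>\<in>S. c' \<zeta> u * I \<zeta> (u, \<omega>)))"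
    if "\<omega> \<in> space M" for \<omega>
    using expand[OF that] by (simp add: set_lebesgue_integral_def)
  have "integrable M (\<lambda>\<omega>. LINT u|lborel. (\<Sum>\<zeta>\<in>S. c' \<zeta> u * I \<zeta> (u, \<omega>)))"
    using P.integrable_snd[OF int] .
  then show "integrable M (\<lambda>\<omega>. LBINT u:{a..b}. c u (X u \<omega>))"
    by (subst Bochner_Integration.integrable_cong[OF refl path])
  have "(LINT \<omega>|M. (LBINT u:{a..b}. c u (X u \<omega>)))
      = (LINT \<omega>|M. LINT u|lborel. (\<Sum>\<zeta>\<in>S. c' \<zeta> u * I \<zeta> (u, \<omega>)))"
    by (rule Bochner_Integration.integral_cong[OF refl path])
  also have "\<dots> = (LINT u|lborel. (LINT \<omega>|M. (\<Sum>\<zeta>\<in>S. c' \<zeta> u * I \<zeta> (u, \<omega>))))"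
    using P.Fubini_integral[OF int] .
  also have "\<dots> = (LINT u|lborel. indicator {a..b} u *\<^sub>R
      (\<Sum>\<zeta>\<in>S. measure M {\<omega>\<in>space M. X u \<omega> = \<zeta>} * c u \<zeta>))"
  proof (rule Bochner_Integration.integral_cong[OF refl])
    fix u :: real
    show "(LINT \<omega>|M. (\<Sum>\<zeta>\<in>S. c' \<zeta> u * I \<zeta> (u, \<omega>))) =
        indicator {a..b} u *\<^sub>R (\<Sum>\<zeta>\<in>S. measure M {\<omega>\<in>space M. X u \<omega> = \<zeta>} * c u \<zeta>)"
    proof (cases "u \<in> {a..b}")
      case True
      have "{\<omega>\<in>space M. X u \<omega> = \<zeta>} \<in> sets M" if "\<zeta> \<in> S" for \<zeta>
        using measurable_sets[OF meas[OF True], of "{\<zeta>}"] that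
        by (simp add: vimage_def Int_def conj_commute)
      then have "has_bochner_integral M (\<lambda>\<omega>. indicator {\<omega>\<in>space M. X u \<omega> = \<zeta>} \<omega> * c u \<zeta>)
          (measure M {\<omega>\<in>space M. X u \<omega> = \<zeta>} * c u \<zeta>)" if "\<zeta> \<in> S" for \<zeta>
        using that
        by (intro has_bochner_integral_mult_left has_bochner_integral_real_indicator)
          (auto simp: emeasure_eq_measure)
      then have "has_bochner_integral M (\<lambda>\<omega>. c' \<zeta> u * I \<zeta> (u, \<omega>))
          (measure M {\<omega>\<in>space M. X u \<omega> = \<zeta>} * c u \<zeta>)" if "\<zeta> \<in> S" for \<zeta>
        using that True
        by (subst has_bochner_integral_cong[OF refl, where
              g = "\<lambda>\<omega>. indicator {\<omega>\<in>space M. X u \<omega> = \<zeta>} \<omega> * c u \<zeta>", OF _ refl])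
          (auto simp: c'_def I_def indicator_def)
      then have "has_bochner_integral M (\<lambda>\<omega>. (\<Sum>\<zeta>\<in>S. c' \<zeta> u * I \<zeta> (u, \<omega>)))
          (\<Sum>\<zeta>\<in>S. measure M {\<omega>\<in>space M. X u \<omega> = \<zeta>} * c u \<zeta>)"
        by (rule has_bochner_integral_sum)
      then show ?thesis using True by (simp add: has_bochner_integral_integral_eq)
    qed (simp add: c'_def)
  qed
  finally show "(LINT \<omega>|M. (LBINT u:{a..b}. c u (X u \<omega>)))
      = (LBINT u:{a..b}. (\<Sum>\<zeta>\<in>S. measure M {\<omega>\<in>space M. X u \<omega> = \<zeta>} * c u \<zeta>))"
    by (simp add: set_lebesgue_integral_def)
qed


section \<open>Laws of a single chain\<close>

context
  fixes S :: "'s set" and T A and M :: "'w measure" and X and s\<^sub>0 :: real and \<xi>\<^sub>0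
  assumes chain: "markov_chain S T A M X s\<^sub>0 \<xi>\<^sub>0" and fin: "finite S"
begin

interpretation prob_space M
  using chain by (simp add: markov_chain_def)

abbreviation (input) law :: "real \<Rightarrow> 's \<Rightarrow> real" where
  "law u \<eta> \<equiv> measure M {\<omega>\<in>space M. X u \<omega> = \<eta>}"

lemma chain_measurable: "u \<in> {s\<^sub>0..T} \<Longrightarrow> X u \<in> measurable M (count_space S)"
  using chain by (simp add: markov_chain_def)

lemma chain_events: "u \<in> {s\<^sub>0..T} \<Longrightarrow> \<eta> \<in> S \<Longrightarrow> {\<omega>\<in>space M. X u \<omega> = \<eta>} \<in> events"
  using measurable_sets[OF chain_measurable, of u "{\<eta>}"]
  by (simp add: vimage_def Int_def conj_commute)

lemma chain_in_states: "u \<in> {s\<^sub>0..T} \<Longrightarrow> \<omega> \<in> space M \<Longrightarrow> X u \<omega> \<in> S"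
  using measurable_space[OF chain_measurable] by auto

lemma chain_expectation:
  fixes f :: "'s \<Rightarrow> real"
  assumes u: "u \<in> {s\<^sub>0..T}"
  shows "has_bochner_integral M (\<lambda>\<omega>. f (X u \<omega>)) (\<Sum>\<zeta>\<in>S. law u \<zeta> * f \<zeta>)"
proof -
  have "has_bochner_integral M (\<lambda>\<omega>. \<Sum>\<zeta>\<in>S. indicator {\<omega>\<in>space M. X u \<omega> = \<zeta>} \<omega> * f \<zeta>)
      (\<Sum>\<zeta>\<in>S. law u \<zeta> * f \<zeta>)"
    using chain_events[OF u]
    by (intro has_bochner_integral_sum has_bochner_integral_mult_left
        has_bochner_integral_real_indicator) (auto simp: emeasure_eq_measure)
  moreover have "(\<Sum>\<zeta>\<in>S. indicator {\<omega>\<in>space M. X u \<omega> = \<zeta>} \<omega> * f \<zeta>) = f (X u \<omega>)"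
    if "\<omega> \<in> space M" for \<omega>
    using fin chain_in_states[OF u that] that
    by (subst sum.remove[OF fin, of "X u \<omega>"]) (auto simp: indicator_def intro!: sum.neutral)
  ultimately show ?thesis
    by (subst has_bochner_integral_cong[OF refl _ refl]) auto
qed

lemma chain_start:
  assumes "s\<^sub>0 \<le> T"
  shows "(\<Sum>\<zeta>\<in>S. f \<zeta> * law s\<^sub>0 \<zeta>) = f \<xi>\<^sub>0"
proof -
  have start: "s\<^sub>0 \<in> {s\<^sub>0..T}" using assms by simp
  have "AE \<omega> in M. X s\<^sub>0 \<omega> = \<xi>\<^sub>0" using chain by (simp add: markov_chain_def)
  then have "(LINT \<omega>|M. f (X s\<^sub>0 \<omega>)) = (LINT \<omega>|M. f \<xi>\<^sub>0)"
    using borel_measurable_has_bochner_integral[OF chain_expectation[OF start, of f]]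
    by (intro integral_cong_AE) auto
  also have "\<dots> = f \<xi>\<^sub>0" by (simp add: prob_space)
  finally show ?thesis
    using has_bochner_integral_integral_eq[OF chain_expectation[OF start, of f]]
    by (simp add: mult.commute)
qed

text \<open>The laws at two times differ by at most the probability that the states differ, which
  tends to zero by stochastic continuity. Right-continuous paths alone would allow the law to jump
  from the left.\<close>

lemma chain_law_continuous:
  assumes \<eta>: "\<eta> \<in> S"
  shows "continuous_on {s\<^sub>0..T} (\<lambda>u. law u \<eta>)"
  unfolding continuous_on_def
proof
  fix u assume u: "u \<in> {s\<^sub>0..T}"
  have lim: "((\<lambda>r. measure M {\<omega>\<in>space M. X r \<omega> \<noteq> X u \<omega>}) \<longlongrightarrow> 0) (at u within {s\<^sub>0..T})"
    using chain u by (simp add: markov_chain_def)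
  have "\<bar>law r \<eta> - law u \<eta>\<bar> \<le> measure M {\<omega>\<in>space M. X r \<omega> \<noteq> X u \<omega>}" if r: "r \<in> {s\<^sub>0..T}" for r
  proof -
    have D: "{\<omega>\<in>space M. X r \<omega> \<noteq> X u \<omega>} \<in> events"
    proof -
      \<comment> \<open>Equality of the two states is a finite union over the possible common
        values, which makes the event measurable.\<close>
      have "{\<omega>\<in>space M. X r \<omega> \<noteq> X u \<omega>} = space M -
          (\<Union>\<zeta>\<in>S. {\<omega>\<in>space M. X r \<omega> = \<zeta>} \<inter> {\<omega>\<in>space M. X u \<omega> = \<zeta>})"
        using chain_in_states[OF u] by auto
      then show ?thesis
        using fin chain_events[OF u] chain_events[OF r]
        by (simp only:) (intro sets.Diff sets.top sets.finite_UN sets.Int; simp)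
    qed
    have "law r \<eta> \<le> measure M ({\<omega>\<in>space M. X u \<omega> = \<eta>} \<union> {\<omega>\<in>space M. X r \<omega> \<noteq> X u \<omega>})"
      using D chain_events[OF u \<eta>] by (intro finite_measure_mono) auto
    also have "\<dots> \<le> law u \<eta> + measure M {\<omega>\<in>space M. X r \<omega> \<noteq> X u \<omega>}"
      using D chain_events[OF u \<eta>] by (intro measure_Un_le) auto
    finally have 1: "law r \<eta> \<le> law u \<eta> + measure M {\<omega>\<in>space M. X r \<omega> \<noteq> X u \<omega>}" .
    have "law u \<eta> \<le> measure M ({\<omega>\<in>space M. X r \<omega> = \<eta>} \<union> {\<omega>\<in>space M. X r \<omega> \<noteq> X u \<omega>})"
      using D chain_events[OF r \<eta>] by (intro finite_measure_mono) auto
    also have "\<dots> \<le> law r \<eta> + measure M {\<omega>\<in>space M. X r \<omega> \<noteq> X u \<omega>}"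
      using D chain_events[OF r \<eta>] by (intro measure_Un_le) auto
    finally show ?thesis using 1 by linarith
  qed
  then have "\<forall>\<^sub>F r in at u within {s\<^sub>0..T}.
      norm (law r \<eta> - law u \<eta>) \<le> measure M {\<omega>\<in>space M. X r \<omega> \<noteq> X u \<omega>}"
    by (auto simp: eventually_at_filter)
  from Lim_null_comparison[OF this lim]
  show "((\<lambda>r. law r \<eta>) \<longlongrightarrow> law u \<eta>) (at u within {s\<^sub>0..T})"
    by (subst Lim_null)
qed

lemma chain_law_step:
  assumes s: "s \<in> {s\<^sub>0..T}" and r: "r \<in> {s\<^sub>0..T}" and \<eta>: "\<eta> \<in> S"
  shows "law r \<eta> = (\<Sum>\<zeta>\<in>S. law s \<zeta> * cond_prob M (\<lambda>\<omega>. X r \<omega> = \<eta>) (\<lambda>\<omega>. X s \<omega> = \<zeta>))"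
proof -
  have ev: "{\<omega>\<in>space M. X r \<omega> = \<eta> \<and> X s \<omega> = \<zeta>} \<in> events" if "\<zeta> \<in> S" for \<zeta>
  proof -
    have "{\<omega>\<in>space M. X r \<omega> = \<eta> \<and> X s \<omega> = \<zeta>} = {\<omega>\<in>space M. X r \<omega> = \<eta>} \<inter> {\<omega>\<in>space M. X s \<omega> = \<zeta>}"
      by auto
    then show ?thesis using chain_events[OF r \<eta>] chain_events[OF s that] by simp
  qed
  have "law r \<eta> = measure M (\<Union>\<zeta>\<in>S. {\<omega>\<in>space M. X r \<omega> = \<eta> \<and> X s \<omega> = \<zeta>})"
    using chain_in_states[OF s] by (intro arg_cong[where f = "measure M"]) auto
  also have "\<dots> = (\<Sum>\<zeta>\<in>S. measure M {\<omega>\<in>space M. X r \<omega> = \<eta> \<and> X s \<omega> = \<zeta>})"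
    using fin ev by (intro finite_measure_finite_Union) (auto simp: disjoint_family_on_def)
  also have "\<dots> = (\<Sum>\<zeta>\<in>S. law s \<zeta> * cond_prob M (\<lambda>\<omega>. X r \<omega> = \<eta>) (\<lambda>\<omega>. X s \<omega> = \<zeta>))"
  proof (rule sum.cong[OF refl])
    fix \<zeta> assume \<zeta>: "\<zeta> \<in> S"
    \<comment> \<open>If \<open>law s \<zeta> = 0\<close>, the conditional probability is a quotient
      by zero, but then the joint event has measure zero as well.\<close>
    have "measure M {\<omega>\<in>space M. X r \<omega> = \<eta> \<and> X s \<omega> = \<zeta>} \<le> law s \<zeta>"
      using chain_events[OF s \<zeta>] by (intro finite_measure_mono) auto
    then show "measure M {\<omega>\<in>space M. X r \<omega> = \<eta> \<and> X s \<omega> = \<zeta>}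
        = law s \<zeta> * cond_prob M (\<lambda>\<omega>. X r \<omega> = \<eta>) (\<lambda>\<omega>. X s \<omega> = \<zeta>)"
      using measure_nonneg[of M "{\<omega>\<in>space M. X r \<omega> = \<eta> \<and> X s \<omega> = \<zeta>}"]
      by (cases "law s \<zeta> = 0") (auto simp: cond_prob_def)
  qed
  finally show ?thesis .
qed

text \<open>The forward equation tested against a fixed \<open>\<phi>\<close>: average the generator
  limits over the state at time \<open>s\<close>. Where \<open>law s \<zeta> = 0\<close> no limit is
  assumed, but such states carry no weight.\<close>

lemma chain_law_right_derivative:
  assumes s: "s \<in> {s\<^sub>0..<T}"
  shows "((\<lambda>h. ((\<Sum>\<eta>\<in>S. \<phi> \<eta> * law (s + h) \<eta>) - (\<Sum>\<eta>\<in>S. \<phi> \<eta> * law s \<eta>)) / h)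
    \<longlongrightarrow> (\<Sum>\<zeta>\<in>S. law s \<zeta> * A \<phi> s \<zeta>)) (at_right 0)"
proof -
  let ?q = "\<lambda>h \<zeta>. ((\<Sum>\<eta>\<in>S. \<phi> \<eta> * cond_prob M (\<lambda>\<omega>. X (s + h) \<omega> = \<eta>) (\<lambda>\<omega>. X s \<omega> = \<zeta>)) - \<phi> \<zeta>) / h"
  have "((\<lambda>h. law s \<zeta> * ?q h \<zeta>) \<longlongrightarrow> law s \<zeta> * A \<phi> s \<zeta>) (at_right 0)" if "\<zeta> \<in> S" for \<zeta>
  proof (cases "law s \<zeta> = 0")
    case False
    then have "law s \<zeta> > 0" using measure_nonneg[of M] by (simp add: less_le)
    then have "((\<lambda>h. ?q h \<zeta>) \<longlongrightarrow> A \<phi> s \<zeta>) (at_right 0)"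
      using chain s that by (simp add: markov_chain_def)
    then show ?thesis by (intro tendsto_intros)
  qed simp
  then have "((\<lambda>h. \<Sum>\<zeta>\<in>S. law s \<zeta> * ?q h \<zeta>) \<longlongrightarrow> (\<Sum>\<zeta>\<in>S. law s \<zeta> * A \<phi> s \<zeta>)) (at_right 0)"
    by (rule tendsto_sum)
  moreover have "\<forall>\<^sub>F h in at_right 0. (\<Sum>\<zeta>\<in>S. law s \<zeta> * ?q h \<zeta>)
      = ((\<Sum>\<eta>\<in>S. \<phi> \<eta> * law (s + h) \<eta>) - (\<Sum>\<eta>\<in>S. \<phi> \<eta> * law s \<eta>)) / h"
  proof (rule eventually_at_rightI[of 0 "T - s"])
    fix h assume "h \<in> {0<..<T - s}"
    then have "s \<in> {s\<^sub>0..T}" "s + h \<in> {s\<^sub>0..T}" using s by auto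
    note step = chain_law_step[OF this]
    have "(\<Sum>\<eta>\<in>S. \<phi> \<eta> * law (s + h) \<eta>) = (\<Sum>\<eta>\<in>S. \<Sum>\<zeta>\<in>S. law s \<zeta> * (\<phi> \<eta> *
        cond_prob M (\<lambda>\<omega>. X (s + h) \<omega> = \<eta>) (\<lambda>\<omega>. X s \<omega> = \<zeta>)))"
      using step by (intro sum.cong refl) (simp add: sum_distrib_left mult_ac)
    also have "\<dots> = (\<Sum>\<zeta>\<in>S. law s \<zeta> * (\<Sum>\<eta>\<in>S. \<phi> \<eta> *
        cond_prob M (\<lambda>\<omega>. X (s + h) \<omega> = \<eta>) (\<lambda>\<omega>. X s \<omega> = \<zeta>)))"
      by (subst sum.swap) (simp add: sum_distrib_left)
    finally show "(\<Sum>\<zeta>\<in>S. law s \<zeta> * ?q h \<zeta>)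
        = ((\<Sum>\<eta>\<in>S. \<phi> \<eta> * law (s + h) \<eta>) - (\<Sum>\<eta>\<in>S. \<phi> \<eta> * law s \<eta>)) / h"
      by (simp add: sum_subtractf[symmetric] sum_divide_distrib right_diff_distrib mult.commute)
  qed (use s in auto)
  ultimately show ?thesis by (rule Lim_transform_eventually)
qed

section \<open>Verification along a chain\<close>

context
  fixes w w' c :: "real \<Rightarrow> 's \<Rightarrow> real"
  assumes T: "s\<^sub>0 \<le> T"
    and der: "\<And>s \<eta>. s \<in> {s\<^sub>0..T} \<Longrightarrow> \<eta> \<in> S \<Longrightarrow>
      ((\<lambda>s. w s \<eta>) has_real_derivative w' s \<eta>) (at s within {s\<^sub>0..T})"
    and c: "\<And>\<eta>. \<eta> \<in> S \<Longrightarrow> continuous_on {s\<^sub>0..T} (\<lambda>u. c u \<eta>)"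
begin

lemma chain_value_right_derivative:
  assumes s: "s \<in> {s\<^sub>0..<T}"
  shows "((\<lambda>s. (\<Sum>\<eta>\<in>S. w s \<eta> * law s \<eta>) + integral {s\<^sub>0..s} (\<lambda>u. \<Sum>\<eta>\<in>S. law u \<eta> * c u \<eta>))
    has_real_derivative (\<Sum>\<eta>\<in>S. law s \<eta> * (w' s \<eta> + A (w s) s \<eta> + c s \<eta>))) (at_right s)"
proof -
  have right: "at s within {s..T} = at_right s"
    using s by (intro at_within_Icc_at_right) auto
  have to_right: "(f has_real_derivative D) (at_right s)"
    if "(f has_real_derivative D) (at s within {s\<^sub>0..T})" for f D
    using DERIV_subset[OF that, of "{s..T}"] s unfolding right by auto
  have "((\<lambda>h. (w (s + h) \<eta> - w s \<eta>) / h * law (s + h) \<eta>) \<longlongrightarrow> w' s \<eta> * law s \<eta>) (at_right 0)"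
    if \<eta>: "\<eta> \<in> S" for \<eta>
  proof (rule tendsto_mult)
    have "((\<lambda>s. w s \<eta>) has_real_derivative w' s \<eta>) (at_right s)"
      using der s \<eta> by (intro to_right) auto
    then show "((\<lambda>h. (w (s + h) \<eta> - w s \<eta>) / h) \<longlongrightarrow> w' s \<eta>) (at_right 0)"
      unfolding has_field_derivative_iff filterlim_at_right_to_0[of _ _ s] by (simp add: add.commute)
    have "((\<lambda>u. law u \<eta>) \<longlongrightarrow> law s \<eta>) (at s within {s..T})"
      using continuous_on_subset[OF chain_law_continuous[OF \<eta>], of "{s..T}"] s
      by (auto simp: continuous_on_def)
    then show "((\<lambda>h. law (s + h) \<eta>) \<longlongrightarrow> law s \<eta>) (at_right 0)"
      unfolding right filterlim_at_right_to_0[of _ _ s] by (simp add: add.commute)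
  qed
  then have "((\<lambda>h. (\<Sum>\<eta>\<in>S. (w (s + h) \<eta> - w s \<eta>) / h * law (s + h) \<eta>) +
      ((\<Sum>\<eta>\<in>S. w s \<eta> * law (s + h) \<eta>) - (\<Sum>\<eta>\<in>S. w s \<eta> * law s \<eta>)) / h) \<longlongrightarrow>
      (\<Sum>\<eta>\<in>S. w' s \<eta> * law s \<eta>) + (\<Sum>\<zeta>\<in>S. law s \<zeta> * A (w s) s \<zeta>)) (at_right 0)"
    using s by (intro tendsto_add tendsto_sum chain_law_right_derivative) auto
  moreover have "(\<Sum>\<eta>\<in>S. (w (s + h) \<eta> - w s \<eta>) / h * law (s + h) \<eta>) +
      ((\<Sum>\<eta>\<in>S. w s \<eta> * law (s + h) \<eta>) - (\<Sum>\<eta>\<in>S. w s \<eta> * law s \<eta>)) / h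
    = ((\<Sum>\<eta>\<in>S. w (s + h) \<eta> * law (s + h) \<eta>) - (\<Sum>\<eta>\<in>S. w s \<eta> * law s \<eta>)) / h" for h
    by (simp add: left_diff_distrib diff_divide_distrib sum_subtractf sum_divide_distrib)
  ultimately have "((\<lambda>s. \<Sum>\<eta>\<in>S. w s \<eta> * law s \<eta>) has_real_derivative
      (\<Sum>\<eta>\<in>S. w' s \<eta> * law s \<eta>) + (\<Sum>\<zeta>\<in>S. law s \<zeta> * A (w s) s \<zeta>)) (at_right s)"
    unfolding has_field_derivative_iff filterlim_at_right_to_0[of _ _ s] by (simp add: add.commute)
  moreover have "((\<lambda>s. integral {s\<^sub>0..s} (\<lambda>u. \<Sum>\<eta>\<in>S. law u \<eta> * c u \<eta>)) has_real_derivative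
      (\<Sum>\<eta>\<in>S. law s \<eta> * c s \<eta>)) (at_right s)"
    using s
    by (intro to_right integral_has_real_derivative continuous_intros chain_law_continuous c) auto
  ultimately have "((\<lambda>s. (\<Sum>\<eta>\<in>S. w s \<eta> * law s \<eta>) +
        integral {s\<^sub>0..s} (\<lambda>u. \<Sum>\<eta>\<in>S. law u \<eta> * c u \<eta>)) has_real_derivative
      (\<Sum>\<eta>\<in>S. w' s \<eta> * law s \<eta>) + (\<Sum>\<eta>\<in>S. law s \<eta> * A (w s) s \<eta>) +
      (\<Sum>\<eta>\<in>S. law s \<eta> * c s \<eta>)) (at_right s)"
    by (rule DERIV_add)
  then show ?thesis by (simp add: sum.distrib distrib_left distrib_right mult.commute)
qed

lemma chain_value_continuous:
  "continuous_on {s\<^sub>0..T}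
    (\<lambda>s. (\<Sum>\<eta>\<in>S. w s \<eta> * law s \<eta>) + integral {s\<^sub>0..s} (\<lambda>u. \<Sum>\<eta>\<in>S. law u \<eta> * c u \<eta>))"
proof (intro continuous_intros chain_law_continuous)
  show "continuous_on {s\<^sub>0..T} (\<lambda>s. w s \<eta>)" if "\<eta> \<in> S" for \<eta>
    using der[OF _ that] by (rule DERIV_continuous_on)
  have "((\<lambda>s. integral {s\<^sub>0..s} (\<lambda>u. \<Sum>\<eta>\<in>S. law u \<eta> * c u \<eta>)) has_real_derivative
      (\<Sum>\<eta>\<in>S. law s \<eta> * c s \<eta>)) (at s within {s\<^sub>0..T})" if "s \<in> {s\<^sub>0..T}" for s
    using that by (intro integral_has_real_derivative continuous_intros chain_law_continuous c) auto
  then show "continuous_on {s\<^sub>0..T} (\<lambda>s. integral {s\<^sub>0..s} (\<lambda>u. \<Sum>\<eta>\<in>S. law u \<eta> * c u \<eta>))"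
    by (rule DERIV_continuous_on)
qed

text \<open>Exchanging expectation and time integral leaves only the laws: the cost is the value at
  \<open>T\<close> of the function differentiated in
  \<open>chain_value_right_derivative\<close>.\<close>

lemma chain_cost:
  "(LINT \<omega>|M. (LBINT u:{s\<^sub>0..T}. c u (X u \<omega>)) + w T (X T \<omega>))
    = (\<Sum>\<eta>\<in>S. w T \<eta> * law T \<eta>) + integral {s\<^sub>0..T} (\<lambda>u. \<Sum>\<eta>\<in>S. law u \<eta> * c u \<eta>)"
proof -
  have right_const: "eventually (\<lambda>r. X r \<omega> = X u \<omega>) (at_right u)"
    if "\<omega> \<in> space M" "u \<in> {s\<^sub>0..<T}" for \<omega> u
    using chain that by (simp add: markov_chain_def)
  note path = integral_jump_path
      [where c = c, OF prob_space_axioms fin T chain_measurable right_const c, simplified]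
  have final: "has_bochner_integral M (\<lambda>\<omega>. w T (X T \<omega>)) (\<Sum>\<zeta>\<in>S. law T \<zeta> * w T \<zeta>)"
    using T by (intro chain_expectation) auto
  have "(LINT \<omega>|M. (LBINT u:{s\<^sub>0..T}. c u (X u \<omega>)) + w T (X T \<omega>))
      = (LBINT u:{s\<^sub>0..T}. (\<Sum>\<eta>\<in>S. law u \<eta> * c u \<eta>)) + (\<Sum>\<eta>\<in>S. law T \<eta> * w T \<eta>)"
    using path(1) final
    by (subst Bochner_Integration.integral_add)
      (auto simp: has_bochner_integral_iff path(2))
  also have "(LBINT u:{s\<^sub>0..T}. (\<Sum>\<eta>\<in>S. law u \<eta> * c u \<eta>))
      = integral {s\<^sub>0..T} (\<lambda>u. \<Sum>\<eta>\<in>S. law u \<eta> * c u \<eta>)"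
    by (intro set_borel_integral_eq_integral borel_integrable_atLeastAtMost' continuous_intros
        chain_law_continuous c)
  finally show ?thesis by (simp add: mult.commute)
qed

text \<open>The assumption makes the right derivative of expected value plus accumulated cost
  nonnegative; this sum is \<open>w s\<^sub>0 \<xi>\<^sub>0\<close> at the start and the total cost
  at \<open>T\<close>.\<close>

lemma chain_cost_ge:
  assumes "\<And>s \<eta>. s \<in> {s\<^sub>0..<T} \<Longrightarrow> \<eta> \<in> S \<Longrightarrow> w' s \<eta> + A (w s) s \<eta> + c s \<eta> \<ge> 0"
  shows "w s\<^sub>0 \<xi>\<^sub>0 \<le> (LINT \<omega>|M. (LBINT u:{s\<^sub>0..T}. c u (X u \<omega>)) + w T (X T \<omega>))"
  using nondecreasing_if_right_derivative_nonneg
    [OF T chain_value_continuous chain_value_right_derivative sum_nonneg] assms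
  by (simp add: chain_cost chain_start[OF T])

lemma chain_cost_eq:
  assumes "\<And>s \<eta>. s \<in> {s\<^sub>0..<T} \<Longrightarrow> \<eta> \<in> S \<Longrightarrow> w' s \<eta> + A (w s) s \<eta> + c s \<eta> = 0"
  shows "(LINT \<omega>|M. (LBINT u:{s\<^sub>0..T}. c u (X u \<omega>)) + w T (X T \<omega>)) = w s\<^sub>0 \<xi>\<^sub>0"
proof (rule antisym)
  show "w s\<^sub>0 \<xi>\<^sub>0 \<le> (LINT \<omega>|M. (LBINT u:{s\<^sub>0..T}. c u (X u \<omega>)) + w T (X T \<omega>))"
    using assms by (intro chain_cost_ge) auto
  show "(LINT \<omega>|M. (LBINT u:{s\<^sub>0..T}. c u (X u \<omega>)) + w T (X T \<omega>)) \<le> w s\<^sub>0 \<xi>\<^sub>0"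
    \<comment> \<open>The same monotonicity for the negated function, whose right derivative is zero
      as well.\<close>
    using nondecreasing_if_right_derivative_nonneg
      [OF T continuous_on_minus[OF chain_value_continuous] DERIV_minus[OF chain_value_right_derivative]]
      assms
    by (simp add: chain_cost chain_start[OF T])
qed

end

end

section \<open>Hamiltonian and feedback controls\<close>

lemma finite_simplex_grid: "finite (simplex_grid N :: (real^'d::finite) set)"
proof (rule finite_subset)
  let ?V = "(\<lambda>k. real k / real N) ` {..N}"
  show "(simplex_grid N :: (real^'d) set) \<subseteq> vec_lambda ` (PiE UNIV (\<lambda>_. ?V))"
  proof
    fix \<mu> :: "real^'d" assume "\<mu> \<in> simplex_grid N"
    then have "vec_nth \<mu> \<in> PiE UNIV (\<lambda>_. ?V)" by (fastforce simp: simplex_grid_def)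
    then show "\<mu> \<in> vec_lambda ` (PiE UNIV (\<lambda>_. ?V))" by (metis image_eqI vec_nth_inverse)
  qed
qed (auto intro!: finite_PiE)

lemma finite_states: "finite (states G)"
  by (simp add: states_def finite_simplex_grid)

lemma simplex_grid_nonneg: "\<mu> \<in> simplex_grid N \<Longrightarrow> 0 \<le> \<mu> $ z"
  by (auto simp: simplex_grid_def) (metis divide_nonneg_nonneg of_nat_0_le_iff)

lemma simplex_grid_le_1:
  assumes "\<mu> \<in> simplex_grid N"
  shows "\<mu> $ z \<le> 1"
  using member_le_sum[of z UNIV "\<lambda>y. \<mu> $ y"] simplex_grid_nonneg[OF assms] assms
  by (simp add: simplex_grid_def)

lemma simplex_grid_shift:
  fixes G :: "'d::finite game"
  assumes N: "players G \<ge> 1" and \<mu>: "\<mu> \<in> simplex_grid (players G)" and z: "\<mu> $ z \<noteq> 0"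
  shows "\<mu> + shift G y z \<in> simplex_grid (players G)"
proof (cases "y = z")
  case True
  then show ?thesis using \<mu> by (simp add: shift_def)
next
  case False
  let ?N = "players G"
  obtain k where k: "\<And>i. k i \<le> ?N" "\<And>i. \<mu> $ i = real (k i) / real ?N"
    using \<mu> unfolding simplex_grid_def by (simp; metis)
  have sum1: "(\<Sum>i\<in>UNIV. \<mu> $ i) = 1" using \<mu> by (simp add: simplex_grid_def)
  have kz: "k z \<ge> 1" using z k(2)[of z] by (cases "k z") auto
  \<comment> \<open>The counts at \<open>y\<close> and \<open>z\<close> together do not exceed the
    number of players, so a count of at least one at \<open>z\<close> leaves room for one more at
    \<open>y\<close>.\<close>
  have "(\<Sum>i\<in>{y, z}. \<mu> $ i) \<le> (\<Sum>i\<in>UNIV. \<mu> $ i)"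
    by (intro sum_mono2) (auto simp: simplex_grid_nonneg[OF \<mu>])
  then have "real (k y) / real ?N + real (k z) / real ?N \<le> 1"
    using False sum1 by (simp add: k(2))
  then have ky: "k y + k z \<le> ?N" using N by (simp add: add_divide_distrib[symmetric] flip: of_nat_add)
  define k' where "k' = (\<lambda>i. if i = y then k y + 1 else if i = z then k z - 1 else k i)"
  have "(\<mu> + shift G y z) $ i = real (k' i) / real ?N" for i
    using False kz by (simp add: k'_def k(2) shift_def axis_def add_divide_distrib diff_divide_distrib of_nat_diff)
  moreover have "k' i \<le> ?N" for i using k(1)[of i] ky kz by (auto simp: k'_def)
  moreover have "(\<Sum>i\<in>UNIV. (\<mu> + shift G y z) $ i) = 1"
    using sum1 by (simp add: shift_def sum.distrib axis_def right_diff_distrib sum_subtractf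
        sum_divide_distrib[symmetric])
  ultimately show ?thesis unfolding simplex_grid_def by blast
qed

lemma closed_nonneg_vecs: "closed (nonneg_vecs x)"
proof -
  have "nonneg_vecs x = {a. a $ x = 0} \<inter> (\<Inter>y. {a. 0 \<le> a $ y})"
    by (auto simp: nonneg_vecs_def)
  then show ?thesis
    by (auto intro!: closed_Int closed_INT closed_Collect_eq closed_Collect_le continuous_intros)
qed

lemma zero_nonneg_vecs [simp]: "0 \<in> nonneg_vecs x"
  by (simp add: nonneg_vecs_def)

lemma convex_nonneg_vecs:
  "a \<in> nonneg_vecs x \<Longrightarrow> b \<in> nonneg_vecs x \<Longrightarrow> \<tau> \<in> {0..1} \<Longrightarrow>
    \<tau> *\<^sub>R a + (1 - \<tau>) *\<^sub>R b \<in> nonneg_vecs x"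
  by (auto simp: nonneg_vecs_def)

text \<open>The argument of the Hamiltonian that a state function produces. Its coordinate at
  \<open>fst \<xi>\<close> is zero, in line with the embedding of vectors indexed by the other
  states.\<close>

definition slope :: "('d::finite state \<Rightarrow> real) \<Rightarrow> 'd state \<Rightarrow> real^'d" where
  "slope \<phi> \<xi> = diff_vec (fst \<xi>) (\<lambda>y. \<phi> (y, snd \<xi>))"

lemma slope_nth: "slope \<phi> \<xi> $ y = \<phi> (y, snd \<xi>) - \<phi> \<xi>"
  by (simp add: slope_def diff_vec_def)

lemma feedback_eq: "feedback G w t \<xi> = minimizer G \<xi> (slope (w t) \<xi>)"
  by (simp add: feedback_def slope_def case_prod_unfold)

lemma state_fst_swap: "\<xi> \<in> states G \<Longrightarrow> (y, snd \<xi>) \<in> states G"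
  by (auto simp: states_def)

lemma slope_cong:
  "\<xi> \<in> states G \<Longrightarrow> (\<And>\<eta>. \<eta> \<in> states G \<Longrightarrow> \<phi> \<eta> = \<psi> \<eta>) \<Longrightarrow> slope \<phi> \<xi> = slope \<psi> \<xi>"
  by (simp add: vec_eq_iff slope_nth state_fst_swap)

lemma slope_diff_le:
  assumes "\<xi> \<in> states G" "\<And>\<eta>. \<eta> \<in> states G \<Longrightarrow> \<bar>\<phi> \<eta> - \<psi> \<eta>\<bar> \<le> D"
  shows "\<bar>slope \<phi> \<xi> $ y - slope \<psi> \<xi> $ y\<bar> \<le> 2 * D"
  using assms(2)[OF assms(1)] assms(2)[OF state_fst_swap[OF assms(1), of y]]
  by (simp add: slope_nth)

lemma slope_bound:
  assumes "\<xi> \<in> states G" "\<And>\<eta>. \<eta> \<in> states G \<Longrightarrow> \<phi> \<eta> \<in> {0..B}"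
  shows "\<bar>slope \<phi> \<xi> $ y\<bar> \<le> B"
  using assms(2)[OF assms(1)] assms(2)[OF state_fst_swap[OF assms(1), of y]]
  by (auto simp: slope_nth abs_le_iff)

text \<open>The pre-Hamiltonian without the running cost: linear in \<open>p\<close>, affine in
  \<open>a\<close>. For \<open>p = slope \<phi> \<xi>\<close> it is the generator of the player's
  own state applied to \<open>\<phi>\<close>.\<close>

definition drift :: "'d::finite game \<Rightarrow> 'd state \<Rightarrow> real^'d \<Rightarrow> real^'d \<Rightarrow> real" where
  "drift G \<xi> p a = (\<Sum>y\<in>UNIV - {fst \<xi>}. (rate0 G \<xi> $ y + rate1 G \<xi> $ y * a $ y) * p $ y)"

lemma pre_hamiltonian_eq: "pre_hamiltonian G \<xi> p a = running G \<xi> a + drift G \<xi> p a"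
  by (simp add: pre_hamiltonian_def drift_def)

lemma gen_x_eq_drift: "gen_x G \<alpha> \<phi> t \<xi> = drift G \<xi> (slope \<phi> \<xi>) (\<alpha> t \<xi>)"
  by (simp add: gen_x_def drift_def slope_nth case_prod_unfold)

lemma drift_convex_combination:
  "drift G \<xi> p (\<tau> *\<^sub>R a + (1 - \<tau>) *\<^sub>R b) = \<tau> * drift G \<xi> p a + (1 - \<tau>) * drift G \<xi> p b"
  unfolding drift_def sum_distrib_left sum.distrib[symmetric]
  by (rule sum.cong) (auto simp: algebra_simps)

lemma drift_diff: "drift G \<xi> p a - drift G \<xi> q a = drift G \<xi> (p - q) a"
  by (simp add: drift_def sum_subtractf[symmetric] right_diff_distrib)

locale convex_game =
  fixes G :: "'d::finite game" and \<gamma> :: real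
  assumes N: "players G \<ge> 1"
    and T: "horizon G > 0"
    and rate0: "\<And>\<xi>. \<xi> \<in> states G \<Longrightarrow> rate0 G \<xi> \<in> nonneg_vecs (fst \<xi>)"
    and rate1: "\<And>\<xi>. \<xi> \<in> states G \<Longrightarrow> rate1 G \<xi> \<in> nonneg_vecs (fst \<xi>)"
    and final_nonneg: "\<And>\<xi>. \<xi> \<in> states G \<Longrightarrow> final G \<xi> \<ge> 0"
    and running_nonneg:
      "\<And>\<xi> a. \<xi> \<in> states G \<Longrightarrow> a \<in> nonneg_vecs (fst \<xi>) \<Longrightarrow> running G \<xi> a \<ge> 0"
    and running_cont:
      "\<And>\<xi>. \<xi> \<in> states G \<Longrightarrow> continuous_on (nonneg_vecs (fst \<xi>)) (running G \<xi>)"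
    and gamma: "\<gamma> > 0"
    and running_convex:
      "\<And>\<xi> a a' \<tau>. \<xi> \<in> states G \<Longrightarrow> a \<in> nonneg_vecs (fst \<xi>) \<Longrightarrow> a' \<in> nonneg_vecs (fst \<xi>) \<Longrightarrow>
         \<tau> \<in> {0..1} \<Longrightarrow>
         \<tau> * running G \<xi> a' + (1 - \<tau>) * running G \<xi> a
           - running G \<xi> (\<tau> *\<^sub>R a' + (1 - \<tau>) *\<^sub>R a) \<ge> \<gamma> * \<tau> * (1 - \<tau>) * (norm (a' - a))\<^sup>2"
begin

text \<open>The summand 1 keeps the bound positive when all rates vanish, so that constants built
  from it may appear in denominators.\<close>

definition rate_bound :: real where
  "rate_bound = (\<Sum>\<xi>\<in>states G. norm (rate0 G \<xi>) + norm (rate1 G \<xi>)) + 1"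

lemma rate_bound_pos: "rate_bound > 0"
  unfolding rate_bound_def by (intro add_nonneg_pos sum_nonneg) auto

lemma rate_bounds:
  assumes \<xi>: "\<xi> \<in> states G"
  shows "0 \<le> rate0 G \<xi> $ y" "rate0 G \<xi> $ y \<le> rate_bound"
    "0 \<le> rate1 G \<xi> $ y" "rate1 G \<xi> $ y \<le> rate_bound"
proof -
  have "norm (rate0 G \<xi>) + norm (rate1 G \<xi>) \<le> rate_bound"
    using member_le_sum[OF \<xi>, of "\<lambda>\<xi>. norm (rate0 G \<xi>) + norm (rate1 G \<xi>)"] finite_states[of G]
    by (simp add: rate_bound_def)
  moreover have "rate0 G \<xi> $ y \<le> norm (rate0 G \<xi>)" "rate1 G \<xi> $ y \<le> norm (rate1 G \<xi>)"
    using component_le_norm_cart by (auto intro: order.trans[OF abs_ge_self])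
  ultimately show "rate0 G \<xi> $ y \<le> rate_bound" "rate1 G \<xi> $ y \<le> rate_bound"
    by (smt (verit) norm_ge_zero)+
qed (use rate0[OF \<xi>] rate1[OF \<xi>] in \<open>auto simp: nonneg_vecs_def\<close>)

lemma abs_drift_le:
  assumes \<xi>: "\<xi> \<in> states G" and p: "\<And>y. \<bar>p $ y\<bar> \<le> D"
  shows "\<bar>drift G \<xi> p a\<bar> \<le> real CARD('d) * (rate_bound * (1 + norm a) * D)"
proof -
  have D: "D \<ge> 0" using p[of undefined] by linarith
  have "\<bar>(rate0 G \<xi> $ y + rate1 G \<xi> $ y * a $ y) * p $ y\<bar> \<le> rate_bound * (1 + norm a) * D" for y
  proof -
    have "\<bar>rate0 G \<xi> $ y + rate1 G \<xi> $ y * a $ y\<bar> \<le> \<bar>rate0 G \<xi> $ y\<bar> + \<bar>rate1 G \<xi> $ y\<bar> * \<bar>a $ y\<bar>"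
      by (rule order.trans[OF abs_triangle_ineq]) (simp add: abs_mult)
    also have "\<dots> \<le> rate_bound + rate_bound * norm a"
      using rate_bounds[OF \<xi>, of y] component_le_norm_cart[of a y]
      by (intro add_mono mult_mono) auto
    finally show ?thesis
      using p[of y] D rate_bound_pos unfolding abs_mult
      by (intro mult_mono) (auto simp: distrib_left)
  qed
  then have "\<bar>drift G \<xi> p a\<bar> \<le> (\<Sum>y\<in>UNIV - {fst \<xi>}. rate_bound * (1 + norm a) * D)"
    unfolding drift_def by (intro order.trans[OF sum_abs] sum_mono)
  also have "\<dots> \<le> (\<Sum>y\<in>(UNIV::'d set). rate_bound * (1 + norm a) * D)"
    using D rate_bound_pos by (intro sum_mono2) auto
  finally show ?thesis by simp
qed

lemma drift_nonneg:
  assumes "\<xi> \<in> states G" "a \<in> nonneg_vecs (fst \<xi>)" "\<And>y. p $ y \<ge> 0"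
  shows "drift G \<xi> p a \<ge> 0"
  unfolding drift_def using rate_bounds[OF assms(1)] assms
  by (intro sum_nonneg mult_nonneg_nonneg add_nonneg_nonneg) (auto simp: nonneg_vecs_def)

section \<open>Minimizers of the strongly convex pre-Hamiltonian\<close>

text \<open>Strong convexity at the midpoint of \<open>a\<close> and \<open>0\<close>, together with
  nonnegativity of the cost there.\<close>

lemma running_growth:
  assumes \<xi>: "\<xi> \<in> states G" and a: "a \<in> nonneg_vecs (fst \<xi>)"
  shows "running G \<xi> a \<ge> \<gamma> / 2 * (norm a)\<^sup>2 - running G \<xi> 0"
proof -
  have "running G \<xi> ((1/2) *\<^sub>R a + (1 - 1/2) *\<^sub>R 0) \<ge> 0"
    using running_nonneg[OF \<xi> convex_nonneg_vecs[OF a zero_nonneg_vecs, of "1/2"]] by simp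
  then show ?thesis
    using running_convex[OF \<xi> zero_nonneg_vecs a, of "1/2"] by simp
qed

lemma pre_hamiltonian_convex:
  assumes "\<xi> \<in> states G" "a \<in> nonneg_vecs (fst \<xi>)" "b \<in> nonneg_vecs (fst \<xi>)" "\<tau> \<in> {0..1}"
  shows "pre_hamiltonian G \<xi> p (\<tau> *\<^sub>R b + (1 - \<tau>) *\<^sub>R a) \<le>
    \<tau> * pre_hamiltonian G \<xi> p b + (1 - \<tau>) * pre_hamiltonian G \<xi> p a
      - \<gamma> * \<tau> * (1 - \<tau>) * (norm (b - a))\<^sup>2"
  using running_convex[OF assms]
  unfolding pre_hamiltonian_eq drift_convex_combination distrib_left by linarith

lemma continuous_on_pre_hamiltonian:
  "\<xi> \<in> states G \<Longrightarrow> continuous_on (nonneg_vecs (fst \<xi>)) (pre_hamiltonian G \<xi> p)"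
  unfolding pre_hamiltonian_def using running_cont by (intro continuous_intros) auto

text \<open>The cost grows quadratically and the drift only linearly, so beyond some radius nothing
  beats the zero control, and compactness of the remaining part gives a minimum.\<close>

lemma minimizer_exists:
  assumes \<xi>: "\<xi> \<in> states G"
  shows "\<exists>a\<in>nonneg_vecs (fst \<xi>). \<forall>b\<in>nonneg_vecs (fst \<xi>). pre_hamiltonian G \<xi> p a \<le> pre_hamiltonian G \<xi> p b"
proof -
  define B where "B = real CARD('d) * (rate_bound * norm p)"
  define K where "K = running G \<xi> 0 + B + \<bar>pre_hamiltonian G \<xi> p 0\<bar>"
  \<comment> \<open>Makes \<open>\<gamma> / 2 * R\<close> exceed \<open>B + K\<close>: the quadratic
    term absorbs the linear drift and leaves \<open>K * norm b\<close>. By the summand 1 this is at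
    least \<open>K\<close>, which covers all constant terms.\<close>
  define R where "R = 1 + 2 * (B + K) / \<gamma>"
  have B: "B \<ge> 0" using rate_bound_pos by (simp add: B_def)
  have K: "K \<ge> 0" using B running_nonneg[OF \<xi> zero_nonneg_vecs] by (simp add: K_def)
  have R: "R \<ge> 1" using B K gamma by (simp add: R_def)
  have outside: "pre_hamiltonian G \<xi> p 0 \<le> pre_hamiltonian G \<xi> p b"
    if b: "b \<in> nonneg_vecs (fst \<xi>)" and large: "norm b > R" for b
  proof -
    have "\<bar>drift G \<xi> p b\<bar> \<le> B * (1 + norm b)"
      using abs_drift_le[OF \<xi>, of p "norm p" b] component_le_norm_cart[of p]
      by (simp add: B_def mult_ac)
    then have "pre_hamiltonian G \<xi> p b \<ge> \<gamma> / 2 * (norm b)\<^sup>2 - running G \<xi> 0 - B * (1 + norm b)"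
      using running_growth[OF \<xi> b] by (simp add: pre_hamiltonian_eq)
    moreover have "\<gamma> / 2 * (norm b)\<^sup>2 \<ge> (B + K) * norm b"
    proof -
      have "(B + K) * norm b \<le> (\<gamma> / 2 * R) * norm b"
        using gamma by (intro mult_right_mono) (auto simp: R_def field_simps)
      also have "\<dots> \<le> (\<gamma> / 2 * norm b) * norm b"
        using gamma large by (intro mult_right_mono mult_left_mono) auto
      finally show ?thesis by (simp add: power2_eq_square)
    qed
    moreover have "K * norm b \<ge> K" using K R large mult_left_mono[of 1 "norm b" K] by simp
    ultimately show ?thesis by (simp add: K_def algebra_simps)
  qed
  have "\<exists>a\<in>nonneg_vecs (fst \<xi>) \<inter> cball 0 R. \<forall>b\<in>nonneg_vecs (fst \<xi>) \<inter> cball 0 R.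
      pre_hamiltonian G \<xi> p a \<le> pre_hamiltonian G \<xi> p b"
  proof (rule continuous_attains_inf)
    show "compact (nonneg_vecs (fst \<xi>) \<inter> cball 0 R)"
      by (intro closed_Int_compact closed_nonneg_vecs compact_cball)
    show "nonneg_vecs (fst \<xi>) \<inter> cball 0 R \<noteq> {}"
      using R zero_nonneg_vecs by (metis IntI empty_iff mem_cball_0 norm_zero order.trans zero_le_one)
    show "continuous_on (nonneg_vecs (fst \<xi>) \<inter> cball 0 R) (pre_hamiltonian G \<xi> p)"
      by (rule continuous_on_subset[OF continuous_on_pre_hamiltonian[OF \<xi>]]) auto
  qed
  then obtain a where a: "a \<in> nonneg_vecs (fst \<xi>)"
    and amin: "\<And>b. b \<in> nonneg_vecs (fst \<xi>) \<Longrightarrow> norm b \<le> R \<Longrightarrow>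
      pre_hamiltonian G \<xi> p a \<le> pre_hamiltonian G \<xi> p b"
    by auto
  have "pre_hamiltonian G \<xi> p a \<le> pre_hamiltonian G \<xi> p b" if "b \<in> nonneg_vecs (fst \<xi>)" for b
    using outside[OF that] amin[OF that] amin[OF zero_nonneg_vecs] R by (cases "norm b \<le> R") auto
  then show ?thesis using a by blast
qed

text \<open>Compare \<open>a\<close> with points of the segment towards \<open>b\<close>. Dividing
  by the step \<open>1 - \<tau>\<close> leaves a factor \<open>\<tau>\<close> in the convexity term,
  which disappears as \<open>\<tau>\<close> tends to 1.\<close>

lemma strong_minimum:
  assumes \<xi>: "\<xi> \<in> states G" and a: "a \<in> nonneg_vecs (fst \<xi>)" and b: "b \<in> nonneg_vecs (fst \<xi>)"
    and min: "\<And>b. b \<in> nonneg_vecs (fst \<xi>) \<Longrightarrow> pre_hamiltonian G \<xi> p a \<le> pre_hamiltonian G \<xi> p b"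
  shows "\<gamma> * (norm (b - a))\<^sup>2 \<le> pre_hamiltonian G \<xi> p b - pre_hamiltonian G \<xi> p a"
proof (rule field_le_mult_one_interval)
  fix \<tau> :: real assume \<tau>: "0 < \<tau>" "\<tau> < 1"
  have "pre_hamiltonian G \<xi> p a \<le> pre_hamiltonian G \<xi> p ((1 - \<tau>) *\<^sub>R b + (1 - (1 - \<tau>)) *\<^sub>R a)"
    using \<tau> by (intro min convex_nonneg_vecs a b) auto
  also have "\<dots> \<le> (1 - \<tau>) * pre_hamiltonian G \<xi> p b + (1 - (1 - \<tau>)) * pre_hamiltonian G \<xi> p a
      - \<gamma> * (1 - \<tau>) * (1 - (1 - \<tau>)) * (norm (b - a))\<^sup>2"
    using \<tau> by (intro pre_hamiltonian_convex \<xi> a b) auto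
  finally have "(1 - \<tau>) * (\<tau> * (\<gamma> * (norm (b - a))\<^sup>2)) \<le>
      (1 - \<tau>) * (pre_hamiltonian G \<xi> p b - pre_hamiltonian G \<xi> p a)"
    by (simp add: algebra_simps)
  then show "\<tau> * (\<gamma> * (norm (b - a))\<^sup>2) \<le> pre_hamiltonian G \<xi> p b - pre_hamiltonian G \<xi> p a"
    using \<tau> by simp
qed

text \<open>Strong convexity makes the minimizer unique, which is what allows the definite
  description in \<open>minimizer\<close> to denote it.\<close>

lemma
  assumes \<xi>: "\<xi> \<in> states G"
  shows minimizer_in: "minimizer G \<xi> p \<in> nonneg_vecs (fst \<xi>)"
    and minimizer_le: "\<And>b. b \<in> nonneg_vecs (fst \<xi>) \<Longrightarrow>
      pre_hamiltonian G \<xi> p (minimizer G \<xi> p) \<le> pre_hamiltonian G \<xi> p b"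
proof -
  obtain a where a: "a \<in> nonneg_vecs (fst \<xi>)"
    "\<And>b. b \<in> nonneg_vecs (fst \<xi>) \<Longrightarrow> pre_hamiltonian G \<xi> p a \<le> pre_hamiltonian G \<xi> p b"
    using minimizer_exists[OF \<xi>] by blast
  have "minimizer G \<xi> p = a"
    unfolding minimizer_def
  proof (rule the_equality)
    show "is_arg_min (pre_hamiltonian G \<xi> p) (\<lambda>a. a \<in> nonneg_vecs (fst \<xi>)) a"
      using a by (simp add: is_arg_min_linorder)
  next
    fix b assume "is_arg_min (pre_hamiltonian G \<xi> p) (\<lambda>a. a \<in> nonneg_vecs (fst \<xi>)) b"
    then have b: "b \<in> nonneg_vecs (fst \<xi>)" "pre_hamiltonian G \<xi> p b \<le> pre_hamiltonian G \<xi> p a"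
      using a by (auto simp: is_arg_min_linorder)
    then have "\<gamma> * (norm (b - a))\<^sup>2 \<le> 0"
      using strong_minimum[OF \<xi> a(1) b(1) a(2)] by simp
    then show "b = a" using gamma by (simp add: mult_le_0_iff)
  qed
  then show "minimizer G \<xi> p \<in> nonneg_vecs (fst \<xi>)"
    "\<And>b. b \<in> nonneg_vecs (fst \<xi>) \<Longrightarrow>
      pre_hamiltonian G \<xi> p (minimizer G \<xi> p) \<le> pre_hamiltonian G \<xi> p b"
    using a by auto
qed

lemma hamiltonian_eq:
  "\<xi> \<in> states G \<Longrightarrow> hamiltonian G \<xi> p = pre_hamiltonian G \<xi> p (minimizer G \<xi> p)"
  unfolding hamiltonian_def
  by (rule cInf_eq_minimum) (auto intro: minimizer_in minimizer_le)

lemma hamiltonian_le: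
  "\<xi> \<in> states G \<Longrightarrow> b \<in> nonneg_vecs (fst \<xi>) \<Longrightarrow> hamiltonian G \<xi> p \<le> pre_hamiltonian G \<xi> p b"
  by (simp add: hamiltonian_eq minimizer_le)

lemma hamiltonian_nonneg:
  "\<xi> \<in> states G \<Longrightarrow> (\<And>y. p $ y \<ge> 0) \<Longrightarrow> hamiltonian G \<xi> p \<ge> 0"
  unfolding hamiltonian_eq pre_hamiltonian_eq
  by (intro add_nonneg_nonneg running_nonneg drift_nonneg minimizer_in)

text \<open>Insert the minimizer for \<open>q\<close> into the infimum for \<open>p\<close>: the
  running costs cancel and a drift linear in \<open>p - q\<close> remains. Its size yields Lipschitz
  bounds, its sign the comparison of solutions.\<close>

lemma hamiltonian_diff_le:
  "\<xi> \<in> states G \<Longrightarrow> hamiltonian G \<xi> p - hamiltonian G \<xi> q \<le> drift G \<xi> (p - q) (minimizer G \<xi> q)"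
  using hamiltonian_le[OF _ minimizer_in, of \<xi> p q]
  by (simp add: hamiltonian_eq[of \<xi> q] pre_hamiltonian_eq flip: drift_diff)

definition minimizer_lip :: real where
  "minimizer_lip = real CARD('d) * rate_bound / (2 * \<gamma>)"

lemma minimizer_lip_pos: "minimizer_lip > 0"
  using rate_bound_pos gamma by (simp add: minimizer_lip_def)

text \<open>Add the two strong minimality estimates, each tested with the other minimizer. Running
  costs and \<open>rate0\<close> cancel; what remains is linear in the distance \<open>d\<close> of
  the minimizers, against \<open>2 * \<gamma> * d\<^sup>2\<close> on the left.\<close>

lemma minimizer_lipschitz:
  assumes \<xi>: "\<xi> \<in> states G" and D: "\<And>y. \<bar>p $ y - q $ y\<bar> \<le> D"
  shows "norm (minimizer G \<xi> p - minimizer G \<xi> q) \<le> minimizer_lip * D"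
proof -
  let ?a = "minimizer G \<xi> p" and ?b = "minimizer G \<xi> q"
  define d where "d = norm (?a - ?b)"
  have D0: "D \<ge> 0" using D[of undefined] by linarith
  have "\<gamma> * d\<^sup>2 \<le> pre_hamiltonian G \<xi> p ?b - pre_hamiltonian G \<xi> p ?a"
    unfolding d_def norm_minus_commute[of ?a]
    by (intro strong_minimum \<xi> minimizer_in minimizer_le)
  moreover have "\<gamma> * d\<^sup>2 \<le> pre_hamiltonian G \<xi> q ?a - pre_hamiltonian G \<xi> q ?b"
    unfolding d_def by (intro strong_minimum \<xi> minimizer_in minimizer_le)
  ultimately have "2 * \<gamma> * d\<^sup>2 \<le> drift G \<xi> (p - q) ?b - drift G \<xi> (p - q) ?a"
    by (simp add: pre_hamiltonian_eq flip: drift_diff)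
  also have "\<dots> = (\<Sum>y\<in>UNIV - {fst \<xi>}. rate1 G \<xi> $ y * (?b - ?a) $ y * (p $ y - q $ y))"
    by (simp add: drift_def algebra_simps flip: sum_subtractf)
  also have "\<dots> \<le> (\<Sum>y\<in>UNIV - {fst \<xi>}. rate_bound * d * D)"
  proof (rule sum_mono)
    fix y
    have "rate1 G \<xi> $ y * (?b - ?a) $ y * (p $ y - q $ y) \<le>
        \<bar>rate1 G \<xi> $ y\<bar> * \<bar>(?b - ?a) $ y\<bar> * \<bar>p $ y - q $ y\<bar>"
      by (metis abs_ge_self abs_mult)
    also have "\<dots> \<le> rate_bound * d * D"
      using rate_bounds[OF \<xi>, of y] D[of y] component_le_norm_cart[of "?b - ?a" y] rate_bound_pos
      unfolding d_def norm_minus_commute[of ?a]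
      by (intro mult_mono mult_nonneg_nonneg) auto
    finally show "rate1 G \<xi> $ y * (?b - ?a) $ y * (p $ y - q $ y) \<le> rate_bound * d * D" .
  qed
  also have "\<dots> \<le> (\<Sum>y\<in>(UNIV::'d set). rate_bound * d * D)"
    using D0 rate_bound_pos by (intro sum_mono2) (auto simp: d_def)
  finally have *: "(2 * \<gamma> * d) * d \<le> (real CARD('d) * rate_bound * D) * d"
    by (simp add: power2_eq_square mult_ac)
  show ?thesis
  proof (cases "d = 0")
    case True
    then show ?thesis using D0 minimizer_lip_pos by (simp add: d_def)
  next
    case False
    then have "2 * \<gamma> * d \<le> real CARD('d) * rate_bound * D"
      using * by (simp add: d_def)
    then show ?thesis using gamma by (simp add: minimizer_lip_def d_def field_simps)
  qed
qed

text \<open>The size at slope zero plus the Lipschitz growth up to slopes of size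
  \<open>B\<close>.\<close>

definition minimizer_bound :: "real \<Rightarrow> real" where
  "minimizer_bound B = (\<Sum>\<xi>\<in>states G. norm (minimizer G \<xi> 0)) + minimizer_lip * B"

lemma norm_minimizer_le:
  assumes \<xi>: "\<xi> \<in> states G" and B: "\<And>y. \<bar>p $ y\<bar> \<le> B"
  shows "norm (minimizer G \<xi> p) \<le> minimizer_bound B"
proof -
  have "norm (minimizer G \<xi> p) \<le> norm (minimizer G \<xi> 0) + norm (minimizer G \<xi> p - minimizer G \<xi> 0)"
    by (rule norm_triangle_sub)
  also have "\<dots> \<le> minimizer_bound B"
    unfolding minimizer_bound_def
    using B by (intro add_mono minimizer_lipschitz \<xi> member_le_sum finite_states) auto
  finally show ?thesis .
qed

definition hamiltonian_lip :: "real \<Rightarrow> real" where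
  "hamiltonian_lip B = real CARD('d) * (rate_bound * (1 + minimizer_bound B))"

text \<open>The drift at a minimizer is controlled by the size of that minimizer, which grows with
  the slope; hence a constant that depends on \<open>B\<close>.\<close>

lemma hamiltonian_lipschitz:
  assumes \<xi>: "\<xi> \<in> states G" and p: "\<And>y. \<bar>p $ y\<bar> \<le> B" and q: "\<And>y. \<bar>q $ y\<bar> \<le> B"
    and D: "\<And>y. \<bar>p $ y - q $ y\<bar> \<le> D"
  shows "\<bar>hamiltonian G \<xi> p - hamiltonian G \<xi> q\<bar> \<le> hamiltonian_lip B * D"
proof -
  have D0: "D \<ge> 0" using D[of undefined] by linarith
  \<comment> \<open>A one-sided bound for an arbitrary pair, to be used in both orders.\<close>
  have "hamiltonian G \<xi> p - hamiltonian G \<xi> q \<le> hamiltonian_lip B * D"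
    if q: "\<And>y. \<bar>q $ y\<bar> \<le> B" and D: "\<And>y. \<bar>p $ y - q $ y\<bar> \<le> D" for p q
  proof -
    have "hamiltonian G \<xi> p - hamiltonian G \<xi> q \<le> \<bar>drift G \<xi> (p - q) (minimizer G \<xi> q)\<bar>"
      using hamiltonian_diff_le[OF \<xi>, of p q] by linarith
    also have "\<dots> \<le> real CARD('d) * (rate_bound * (1 + norm (minimizer G \<xi> q)) * D)"
      using D by (intro abs_drift_le \<xi>) auto
    also have "\<dots> \<le> hamiltonian_lip B * D"
      unfolding hamiltonian_lip_def mult.assoc
      using norm_minimizer_le[OF \<xi> q] rate_bound_pos D0
      by (intro mult_left_mono mult_right_mono add_left_mono) auto
    finally show ?thesis .
  qed
  from this[OF q D] this[OF p, of q] show ?thesis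
    using D by (fastforce simp: abs_minus_commute)
qed

lemma hamiltonian_lip_pos: "B \<ge> 0 \<Longrightarrow> hamiltonian_lip B > 0"
  unfolding hamiltonian_lip_def minimizer_bound_def
  using rate_bound_pos minimizer_lip_pos
  by (intro mult_pos_pos add_pos_nonneg add_nonneg_nonneg sum_nonneg) auto

text \<open>Within distance 1 of \<open>q\<close> all slopes are bounded by
  \<open>norm q + 1\<close>, so the local Lipschitz estimate applies.\<close>

lemma continuous_on_hamiltonian:
  assumes \<xi>: "\<xi> \<in> states G"
  shows "continuous_on UNIV (hamiltonian G \<xi>)"
  unfolding continuous_on_def
proof
  fix q :: "real^'d"
  have "\<forall>\<^sub>F p in at q. dist p q < 1" by (auto simp: eventually_at intro: exI[of _ 1])
  then have "\<forall>\<^sub>F p in at q. norm (hamiltonian G \<xi> p - hamiltonian G \<xi> q)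
      \<le> hamiltonian_lip (norm q + 1) * norm (p - q)"
  proof eventually_elim
    case (elim p)
    have "norm p \<le> norm q + norm (p - q)" by (rule norm_triangle_sub)
    then have p: "norm p \<le> norm q + 1" using elim by (simp add: dist_norm)
    have "\<bar>hamiltonian G \<xi> p - hamiltonian G \<xi> q\<bar> \<le> hamiltonian_lip (norm q + 1) * norm (p - q)"
    proof (rule hamiltonian_lipschitz[OF \<xi>])
      fix y
      show "\<bar>p $ y\<bar> \<le> norm q + 1" "\<bar>q $ y\<bar> \<le> norm q + 1" "\<bar>p $ y - q $ y\<bar> \<le> norm (p - q)"
        using component_le_norm_cart[of p y] component_le_norm_cart[of q y]
          component_le_norm_cart[of "p - q" y] p by auto
    qed
    then show ?case by simp
  qed
  moreover have "((\<lambda>p. hamiltonian_lip (norm q + 1) * norm (p - q)) \<longlongrightarrow> 0) (at q)"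
    by (auto intro!: tendsto_eq_intros)
  ultimately have "((\<lambda>p. hamiltonian G \<xi> p - hamiltonian G \<xi> q) \<longlongrightarrow> 0) (at q)"
    by (rule Lim_null_comparison)
  then show "(hamiltonian G \<xi> \<longlongrightarrow> hamiltonian G \<xi> q) (at q)"
    by (subst Lim_null)
qed

end

section \<open>The population generator\<close>

definition jump :: "'d::finite game \<Rightarrow> 'd state \<Rightarrow> 'd \<Rightarrow> 'd \<Rightarrow> 'd state" where
  "jump G \<xi> y z = (fst \<xi>, snd \<xi> + shift G y z)"

text \<open>The rate at which the players in \<open>z\<close> collectively move to \<open>y\<close>.
  The shifted measure is the population as such a player sees it: itself removed from
  \<open>z\<close>, the player of \<open>\<xi>\<close> added at \<open>fst \<xi>\<close>.\<close>

definition jump_rate ::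
  "'d::finite game \<Rightarrow> 'd control \<Rightarrow> real \<Rightarrow> 'd state \<Rightarrow> 'd \<Rightarrow> 'd \<Rightarrow> real" where
  "jump_rate G \<beta> t \<xi> y z = real (players G) * snd \<xi> $ z *
    (rate0 G (z, snd \<xi> + shift G (fst \<xi>) z) $ y
      + rate1 G (z, snd \<xi> + shift G (fst \<xi>) z) $ y * \<beta> t (z, snd \<xi> + shift G (fst \<xi>) z) $ y)"

lemma gen_mu_eq:
  "gen_mu G \<beta> \<phi> t \<xi> =
    (\<Sum>(y, z)\<in>{(y, z). y \<noteq> z}. jump_rate G \<beta> t \<xi> y z * (\<phi> (jump G \<xi> y z) - \<phi> \<xi>))"
  by (simp add: gen_mu_def jump_rate_def jump_def case_prod_unfold)

lemma gen_mu_diff: "gen_mu G \<beta> \<phi> t \<xi> - gen_mu G \<beta> \<psi> t \<xi> = gen_mu G \<beta> (\<lambda>\<eta>. \<phi> \<eta> - \<psi> \<eta>) t \<xi>"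
  unfolding gen_mu_eq sum_subtractf[symmetric]
  by (rule sum.cong) (auto simp: algebra_simps)

context convex_game
begin

lemma jump_in_states:
  assumes "\<xi> \<in> states G" "snd \<xi> $ z \<noteq> 0"
  shows "jump G \<xi> y z \<in> states G" "(z, snd \<xi> + shift G y z) \<in> states G"
  using simplex_grid_shift[OF N _ assms(2)] assms(1) by (auto simp: states_def jump_def)

lemma jump_rate_nonneg:
  assumes \<xi>: "\<xi> \<in> states G" and \<beta>: "\<And>\<eta>. \<eta> \<in> states G \<Longrightarrow> \<beta> t \<eta> \<in> nonneg_vecs (fst \<eta>)"
  shows "jump_rate G \<beta> t \<xi> y z \<ge> 0"
proof (cases "snd \<xi> $ z = 0")
  case False
  note in_states = jump_in_states(2)[OF \<xi> False, of "fst \<xi>"]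
  have "snd \<xi> $ z \<ge> 0" using \<xi> by (auto simp: states_def simplex_grid_nonneg)
  then show ?thesis
    using rate_bounds[OF in_states] \<beta>[OF in_states]
    unfolding jump_rate_def by (intro mult_nonneg_nonneg add_nonneg_nonneg) (auto simp: nonneg_vecs_def)
qed (simp add: jump_rate_def)

lemma abs_jump_rate_le:
  assumes \<xi>: "\<xi> \<in> states G" and B: "\<And>\<eta>. \<eta> \<in> states G \<Longrightarrow> norm (\<beta> t \<eta>) \<le> B"
  shows "\<bar>jump_rate G \<beta> t \<xi> y z\<bar> \<le> real (players G) * (rate_bound * (1 + B))"
proof (cases "snd \<xi> $ z = 0")
  case True
  have "B \<ge> 0" using order.trans[OF norm_ge_zero B[OF \<xi>]] .
  then have "0 \<le> real (players G) * (rate_bound * (1 + B))"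
    using rate_bound_pos by (intro mult_nonneg_nonneg) auto
  moreover have "jump_rate G \<beta> t \<xi> y z = 0"
    using True by (simp add: jump_rate_def)
  ultimately show ?thesis by simp
next
  case False
  let ?\<eta> = "(z, snd \<xi> + shift G (fst \<xi>) z)"
  note in_states = jump_in_states(2)[OF \<xi> False, of "fst \<xi>"]
  have "\<bar>rate0 G ?\<eta> $ y + rate1 G ?\<eta> $ y * \<beta> t ?\<eta> $ y\<bar>
      \<le> \<bar>rate0 G ?\<eta> $ y\<bar> + \<bar>rate1 G ?\<eta> $ y\<bar> * \<bar>\<beta> t ?\<eta> $ y\<bar>"
    by (rule order.trans[OF abs_triangle_ineq]) (simp add: abs_mult)
  also have "\<dots> \<le> rate_bound + rate_bound * B"
    using rate_bounds[OF in_states, of y] component_le_norm_cart[of "\<beta> t ?\<eta>" y] B[OF in_states]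
    by (intro add_mono mult_mono) auto
  finally have 1: "\<bar>rate0 G ?\<eta> $ y + rate1 G ?\<eta> $ y * \<beta> t ?\<eta> $ y\<bar> \<le> rate_bound * (1 + B)"
    by (simp add: distrib_left)
  have 2: "0 \<le> snd \<xi> $ z" "snd \<xi> $ z \<le> 1"
    using \<xi> by (auto simp: states_def simplex_grid_nonneg simplex_grid_le_1)
  have "\<bar>jump_rate G \<beta> t \<xi> y z\<bar> = real (players G) *
      (snd \<xi> $ z * \<bar>rate0 G ?\<eta> $ y + rate1 G ?\<eta> $ y * \<beta> t ?\<eta> $ y\<bar>)"
    using 2 by (simp add: jump_rate_def abs_mult)
  also have "\<dots> \<le> real (players G) * (1 * (rate_bound * (1 + B)))"
    using 1 2 by (intro mult_left_mono mult_mono) auto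
  finally show ?thesis by simp
qed

lemma abs_jump_rate_diff_le:
  assumes \<xi>: "\<xi> \<in> states G" and D: "\<And>\<eta>. \<eta> \<in> states G \<Longrightarrow> norm (\<beta> t \<eta> - \<beta>' t \<eta>) \<le> D"
  shows "\<bar>jump_rate G \<beta> t \<xi> y z - jump_rate G \<beta>' t \<xi> y z\<bar> \<le> real (players G) * (rate_bound * D)"
proof (cases "snd \<xi> $ z = 0")
  case True
  have "D \<ge> 0" using order.trans[OF norm_ge_zero D[OF \<xi>]] .
  then have "0 \<le> real (players G) * (rate_bound * (D))"
    using rate_bound_pos by (intro mult_nonneg_nonneg) auto
  moreover have "jump_rate G \<beta> t \<xi> y z = 0" "jump_rate G \<beta>' t \<xi> y z = 0"
    using True by (simp_all add: jump_rate_def)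
  ultimately show ?thesis by simp
next
  case False
  let ?\<eta> = "(z, snd \<xi> + shift G (fst \<xi>) z)"
  note in_states = jump_in_states(2)[OF \<xi> False, of "fst \<xi>"]
  have 2: "0 \<le> snd \<xi> $ z" "snd \<xi> $ z \<le> 1"
    using \<xi> by (auto simp: states_def simplex_grid_nonneg simplex_grid_le_1)
  have 3: "\<bar>(\<beta> t ?\<eta> - \<beta>' t ?\<eta>) $ y\<bar> \<le> D"
    using component_le_norm_cart D[OF in_states] by (rule order.trans)
  have "jump_rate G \<beta> t \<xi> y z - jump_rate G \<beta>' t \<xi> y z =
      real (players G) * (snd \<xi> $ z * (rate1 G ?\<eta> $ y * (\<beta> t ?\<eta> - \<beta>' t ?\<eta>) $ y))"
    by (simp add: jump_rate_def algebra_simps)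
  then have "\<bar>jump_rate G \<beta> t \<xi> y z - jump_rate G \<beta>' t \<xi> y z\<bar> =
      real (players G) * (snd \<xi> $ z * (rate1 G ?\<eta> $ y * \<bar>(\<beta> t ?\<eta> - \<beta>' t ?\<eta>) $ y\<bar>))"
    using 2 rate_bounds[OF in_states, of y] by (simp add: abs_mult)
  also have "\<dots> \<le> real (players G) * (1 * (rate_bound * D))"
    using 2 3 rate_bounds[OF in_states, of y] rate_bound_pos
    by (intro mult_left_mono mult_mono mult_nonneg_nonneg) auto
  finally show ?thesis by simp
qed

text \<open>One term per ordered pair of distinct states; the factor 2 bounds an increment by twice
  the supremum.\<close>

definition mu_const :: real where
  "mu_const = real (card {(y, z). (y::'d) \<noteq> z}) * (2 * real (players G) * rate_bound)"

lemma mu_const_nonneg: "mu_const \<ge> 0"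
  using rate_bound_pos by (simp add: mu_const_def)

text \<open>At a minimum all increments are nonnegative, and so are the rates. Their size does not
  matter, which later makes the bounds on values independent of the control.\<close>

lemma gen_mu_nonneg:
  assumes \<xi>: "\<xi> \<in> states G" and \<beta>: "\<And>\<eta>. \<eta> \<in> states G \<Longrightarrow> \<beta> t \<eta> \<in> nonneg_vecs (fst \<eta>)"
    and min: "\<And>\<eta>. \<eta> \<in> states G \<Longrightarrow> \<phi> \<xi> \<le> \<phi> \<eta>"
  shows "gen_mu G \<beta> \<phi> t \<xi> \<ge> 0"
  unfolding gen_mu_eq
proof (rule sum_nonneg, clarify)
  fix y z
  show "0 \<le> jump_rate G \<beta> t \<xi> y z * (\<phi> (jump G \<xi> y z) - \<phi> \<xi>)"
  \<comment> \<open>A jump from an empty state \<open>z\<close> may leave the grid, where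
    \<open>min\<close> says nothing; its rate is zero.\<close>
  proof (cases "snd \<xi> $ z = 0")
    case False
    then show ?thesis
      using jump_rate_nonneg[where \<beta> = \<beta>, OF \<xi> \<beta>] min[OF jump_in_states(1)[OF \<xi> False]]
      by (intro mult_nonneg_nonneg) auto
  qed (simp add: jump_rate_def)
qed

lemma abs_gen_mu_le:
  assumes \<xi>: "\<xi> \<in> states G" and B: "\<And>\<eta>. \<eta> \<in> states G \<Longrightarrow> norm (\<beta> t \<eta>) \<le> B"
    and D: "\<And>\<eta>. \<eta> \<in> states G \<Longrightarrow> \<bar>\<phi> \<eta>\<bar> \<le> D"
  shows "\<bar>gen_mu G \<beta> \<phi> t \<xi>\<bar> \<le> mu_const * (1 + B) * D"
proof -
  have D0: "D \<ge> 0" using D[OF \<xi>] by linarith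
  have B0: "B \<ge> 0" using order.trans[OF norm_ge_zero B[OF \<xi>]] .
  have "\<bar>jump_rate G \<beta> t \<xi> y z * (\<phi> (jump G \<xi> y z) - \<phi> \<xi>)\<bar>
      \<le> real (players G) * (rate_bound * (1 + B)) * (2 * D)" for y z
  proof (cases "snd \<xi> $ z = 0")
    case True
    then show ?thesis using D0 B0 rate_bound_pos by (simp add: jump_rate_def)
  next
    case False
    have "\<bar>\<phi> (jump G \<xi> y z) - \<phi> \<xi>\<bar> \<le> 2 * D"
      using D[OF \<xi>] D[OF jump_in_states(1)[OF \<xi> False, of y]] by linarith
    then show ?thesis
      unfolding abs_mult using abs_jump_rate_le[where \<beta> = \<beta>, OF \<xi> B] B0 rate_bound_pos
      by (intro mult_mono) auto
  qed
  then have "\<bar>gen_mu G \<beta> \<phi> t \<xi>\<bar> \<le>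
      (\<Sum>(y, z)\<in>{(y::'d, z). y \<noteq> z}. real (players G) * (rate_bound * (1 + B)) * (2 * D))"
    unfolding gen_mu_eq by (intro order.trans[OF sum_abs] sum_mono) (auto simp: case_prod_unfold)
  then show ?thesis by (simp add: mu_const_def mult_ac)
qed

text \<open>The rates are affine in the control, so the \<open>rate0\<close> parts cancel.\<close>

lemma abs_gen_mu_control_diff_le:
  assumes \<xi>: "\<xi> \<in> states G"
    and D: "\<And>\<eta>. \<eta> \<in> states G \<Longrightarrow> norm (\<beta> t \<eta> - \<beta>' t \<eta>) \<le> D"
    and B: "\<And>\<eta>. \<eta> \<in> states G \<Longrightarrow> \<bar>\<phi> \<eta>\<bar> \<le> B"
  shows "\<bar>gen_mu G \<beta> \<phi> t \<xi> - gen_mu G \<beta>' \<phi> t \<xi>\<bar> \<le> mu_const * B * D"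
proof -
  have D0: "D \<ge> 0" using order.trans[OF norm_ge_zero D[OF \<xi>]] .
  have B0: "B \<ge> 0" using B[OF \<xi>] by linarith
  have "\<bar>(jump_rate G \<beta> t \<xi> y z - jump_rate G \<beta>' t \<xi> y z) * (\<phi> (jump G \<xi> y z) - \<phi> \<xi>)\<bar>
      \<le> real (players G) * (rate_bound * D) * (2 * B)" for y z
  proof (cases "snd \<xi> $ z = 0")
    case True
    then show ?thesis using D0 B0 rate_bound_pos by (simp add: jump_rate_def)
  next
    case False
    have "\<bar>\<phi> (jump G \<xi> y z) - \<phi> \<xi>\<bar> \<le> 2 * B"
      using B[OF \<xi>] B[OF jump_in_states(1)[OF \<xi> False, of y]] by linarith
    then show ?thesis
      unfolding abs_mult using abs_jump_rate_diff_le[where \<beta> = \<beta> and \<beta>' = \<beta>', OF \<xi> D] D0 rate_bound_pos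
      by (intro mult_mono) auto
  qed
  then have "\<bar>\<Sum>(y, z)\<in>{(y::'d, z). y \<noteq> z}.
        (jump_rate G \<beta> t \<xi> y z - jump_rate G \<beta>' t \<xi> y z) * (\<phi> (jump G \<xi> y z) - \<phi> \<xi>)\<bar> \<le>
      (\<Sum>(y, z)\<in>{(y::'d, z). y \<noteq> z}. real (players G) * (rate_bound * D) * (2 * B))"
    by (intro order.trans[OF sum_abs] sum_mono) (auto simp: case_prod_unfold)
  then show ?thesis
    by (simp add: gen_mu_eq mu_const_def mult_ac case_prod_unfold right_diff_distrib sum_subtractf)
qed

text \<open>Points outside the state space enter only with rate zero.\<close>

lemma gen_mu_cong:
  assumes \<xi>: "\<xi> \<in> states G"
    and "\<And>\<eta>. \<eta> \<in> states G \<Longrightarrow> \<beta> t \<eta> = \<beta>' t \<eta>" "\<And>\<eta>. \<eta> \<in> states G \<Longrightarrow> \<phi> \<eta> = \<psi> \<eta>"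
  shows "gen_mu G \<beta> \<phi> t \<xi> = gen_mu G \<beta>' \<psi> t \<xi>"
  unfolding gen_mu_eq
proof (rule sum.cong[OF refl], clarify)
  fix y z
  show "jump_rate G \<beta> t \<xi> y z * (\<phi> (jump G \<xi> y z) - \<phi> \<xi>) =
      jump_rate G \<beta>' t \<xi> y z * (\<psi> (jump G \<xi> y z) - \<psi> \<xi>)"
    using assms jump_in_states[OF \<xi>, of z]
    by (cases "snd \<xi> $ z = 0") (auto simp: jump_rate_def)
qed

lemma continuous_on_gen_mu:
  assumes \<xi>: "\<xi> \<in> states G"
    and \<beta>: "\<And>\<eta>. \<eta> \<in> states G \<Longrightarrow> continuous_on I (\<lambda>t. \<beta> t \<eta>)"
    and \<phi>: "\<And>\<eta>. \<eta> \<in> states G \<Longrightarrow> continuous_on I (\<lambda>t. \<phi> t \<eta>)"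
  shows "continuous_on I (\<lambda>t. gen_mu G \<beta> (\<phi> t) t \<xi>)"
  unfolding gen_mu_eq case_prod_unfold
proof (rule continuous_on_sum)
  fix p
  show "continuous_on I (\<lambda>t. jump_rate G \<beta> t \<xi> (fst p) (snd p) *
      (\<phi> t (jump G \<xi> (fst p) (snd p)) - \<phi> t \<xi>))"
  proof (cases "snd \<xi> $ snd p = 0")
    case False
    then show ?thesis
      unfolding jump_rate_def
      by (intro continuous_intros \<phi> \<beta> \<xi> jump_in_states)
  qed (simp add: jump_rate_def)
qed

section \<open>The Hamilton-Jacobi-Bellman equation\<close>

text \<open>Minus the time derivative of a solution. The map \<open>c\<close> acts only inside the
  Hamiltonian: the population generator is linear in \<open>w\<close> and, for a bounded control,
  already globally Lipschitz.\<close>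

definition hjb :: "(real \<Rightarrow> real) \<Rightarrow> 'd control \<Rightarrow> (real \<Rightarrow> 'd state \<Rightarrow> real) \<Rightarrow> real \<Rightarrow> 'd state \<Rightarrow> real" where
  "hjb c \<beta> w t \<xi> = hamiltonian G \<xi> (slope (\<lambda>\<eta>. c (w t \<eta>)) \<xi>) + gen_mu G \<beta> (w t) t \<xi>"

text \<open>
  The Hamiltonian is only locally Lipschitz, so existence is proved for the equation truncated by
  a monotone \<open>c\<close>; \<open>c = id\<close> is the original equation.
\<close>

definition HJB_solution ::
  "(real \<Rightarrow> real) \<Rightarrow> 'd control \<Rightarrow> (real \<Rightarrow> 'd state \<Rightarrow> real) \<Rightarrow> bool" where
  "HJB_solution c \<beta> w \<longleftrightarrow> (\<forall>\<xi>\<in>states G. w (horizon G) \<xi> = final G \<xi> \<and>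
     (\<forall>t\<in>{0..horizon G}.
        ((\<lambda>s. w s \<xi>) has_real_derivative - hjb c \<beta> w t \<xi>) (at t within {0..horizon G})))"

definition nonneg_control :: "'d control \<Rightarrow> bool" where
  "nonneg_control \<beta> \<longleftrightarrow> (\<forall>t\<in>{0..horizon G}. \<forall>\<xi>\<in>states G. \<beta> t \<xi> \<in> nonneg_vecs (fst \<xi>))"

lemma nonneg_control_feedback: "nonneg_control (feedback G w)"
  by (simp add: nonneg_control_def feedback_eq minimizer_in)

lemma controls_nonneg: "\<beta> \<in> controls G \<Longrightarrow> nonneg_control \<beta>"
  by (simp add: controls_def nonneg_control_def)

lemma controls_continuous:
  "\<beta> \<in> controls G \<Longrightarrow> \<eta> \<in> states G \<Longrightarrow> continuous_on {0..horizon G} (\<lambda>t. \<beta> t \<eta>)"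
  by (auto simp: controls_def intro: lipschitz_on_continuous_on)

lemma controls_bounded:
  assumes "\<beta> \<in> controls G"
  obtains B where "B \<ge> 0"
    "\<And>t \<eta>. t \<in> {0..horizon G} \<Longrightarrow> \<eta> \<in> states G \<Longrightarrow> norm (\<beta> t \<eta>) \<le> B"
proof -
  have "\<exists>b. \<forall>t\<in>{0..horizon G}. norm (\<beta> t \<eta>) \<le> b" if "\<eta> \<in> states G" for \<eta>
    using compact_imp_bounded[OF compact_continuous_image[OF controls_continuous[OF assms that]]]
    by (auto simp: bounded_iff)
  then obtain b where b: "\<And>t \<eta>. \<eta> \<in> states G \<Longrightarrow> t \<in> {0..horizon G} \<Longrightarrow> norm (\<beta> t \<eta>) \<le> b \<eta>"
    by metis
  have "norm (\<beta> t \<eta>) \<le> (\<Sum>\<eta>\<in>states G. \<bar>b \<eta>\<bar>)" if "t \<in> {0..horizon G}" "\<eta> \<in> states G" for t \<eta>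
    using b[OF that(2,1)] member_le_sum[OF that(2), of "\<lambda>\<eta>. \<bar>b \<eta>\<bar>"] finite_states[of G] by simp
  moreover have "(\<Sum>\<eta>\<in>states G. \<bar>b \<eta>\<bar>) \<ge> 0" by (rule sum_nonneg) simp
  ultimately show ?thesis using that by blast
qed

text \<open>Final cost plus the running cost of the zero control over the horizon, with sums over
  states in place of maxima.\<close>

definition value_bound :: real where
  "value_bound = (\<Sum>\<xi>\<in>states G. final G \<xi>) + (\<Sum>\<xi>\<in>states G. running G \<xi> 0) * horizon G"

lemma value_bound_nonneg: "value_bound \<ge> 0"
  unfolding value_bound_def using T final_nonneg running_nonneg
  by (intro add_nonneg_nonneg mult_nonneg_nonneg sum_nonneg) auto

text \<open>The minimum principle with the barriers \<open>0\<close> and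
  \<open>?f + ?l * (horizon G - t)\<close>. A monotone \<open>c\<close> keeps extremal states
  extremal, so the signs of the slopes are known there also for the truncated equation.\<close>

lemma HJB_solution_bounds:
  assumes sol: "HJB_solution c \<beta> w" and c: "mono c" and \<beta>: "nonneg_control \<beta>"
    and t: "t \<in> {0..horizon G}" and \<xi>: "\<xi> \<in> states G"
  shows "w t \<xi> \<in> {0..value_bound}"
proof -
  let ?f = "\<Sum>\<xi>\<in>states G. final G \<xi>" and ?l = "\<Sum>\<xi>\<in>states G. running G \<xi> 0"
  have der: "((\<lambda>s. w s \<xi>) has_real_derivative - hjb c \<beta> w t \<xi>) (at t within {0..horizon G})"
    if "t \<in> {0..horizon G}" "\<xi> \<in> states G" for t \<xi>
    using sol that by (auto simp: HJB_solution_def)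
  have fin: "w (horizon G) \<xi> = final G \<xi>" if "\<xi> \<in> states G" for \<xi>
    using sol that by (auto simp: HJB_solution_def)
  have "0 \<le> w t \<xi>"
  proof (rule finite_minimum_principle[OF finite_states der _ _ t \<xi>])
    show "0 \<le> w (horizon G) \<xi>" if "\<xi> \<in> states G" for \<xi>
      using fin[OF that] final_nonneg[OF that] by simp
    fix t \<xi> assume t: "t \<in> {0..horizon G}" and \<xi>: "\<xi> \<in> states G"
      and min: "\<And>\<eta>. \<eta> \<in> states G \<Longrightarrow> w t \<xi> \<le> w t \<eta>"
    have "hamiltonian G \<xi> (slope (\<lambda>\<eta>. c (w t \<eta>)) \<xi>) \<ge> 0"
      using min[OF state_fst_swap[OF \<xi>]] c
      by (intro hamiltonian_nonneg \<xi>) (simp add: slope_nth monoD)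
    moreover have "gen_mu G \<beta> (w t) t \<xi> \<ge> 0"
      using \<beta> t min by (intro gen_mu_nonneg \<xi>) (auto simp: nonneg_control_def)
    ultimately show "- hjb c \<beta> w t \<xi> \<le> 0" by (simp add: hjb_def)
  qed
  moreover have "0 \<le> ?f + ?l * (horizon G - t) - w t \<xi>"
  proof (rule finite_minimum_principle[where u' = "\<lambda>t \<xi>. - ?l + hjb c \<beta> w t \<xi>"
        and u = "\<lambda>t \<xi>. ?f + ?l * (horizon G - t) - w t \<xi>", OF finite_states _ _ _ t \<xi>])
    show "0 \<le> ?f + ?l * (horizon G - horizon G) - w (horizon G) \<xi>" if "\<xi> \<in> states G" for \<xi>
      using fin[OF that] member_le_sum[OF that _ finite_states, of "final G"] final_nonneg by simp
    show "((\<lambda>s. ?f + ?l * (horizon G - s) - w s \<xi>) has_real_derivative - ?l + hjb c \<beta> w t \<xi>)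
        (at t within {0..horizon G})" if "t \<in> {0..horizon G}" "\<xi> \<in> states G" for t \<xi>
      using der[OF that] by (auto intro!: derivative_eq_intros)
    fix t \<xi> assume t: "t \<in> {0..horizon G}" and \<xi>: "\<xi> \<in> states G"
      and min: "\<And>\<eta>. \<eta> \<in> states G \<Longrightarrow>
        ?f + ?l * (horizon G - t) - w t \<xi> \<le> ?f + ?l * (horizon G - t) - w t \<eta>"
    then have max: "\<And>\<eta>. \<eta> \<in> states G \<Longrightarrow> w t \<eta> \<le> w t \<xi>" by simp
    let ?p = "slope (\<lambda>\<eta>. c (w t \<eta>)) \<xi>"
    \<comment> \<open>At a maximum all slopes are nonpositive, so the zero control has nonpositive
      drift and bounds the Hamiltonian by \<open>running G \<xi> 0\<close>.\<close>
    have "drift G \<xi> (0 - ?p) 0 \<ge> 0"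
      using max[OF state_fst_swap[OF \<xi>]] c
      by (intro drift_nonneg \<xi>) (auto simp: slope_nth monoD)
    then have "hamiltonian G \<xi> ?p \<le> running G \<xi> 0"
      using hamiltonian_le[OF \<xi> zero_nonneg_vecs, of ?p] drift_diff[of G \<xi> 0 0 ?p]
      by (simp add: pre_hamiltonian_eq drift_def)
    also have "\<dots> \<le> ?l"
      using running_nonneg by (intro member_le_sum \<xi> finite_states) auto
    finally have "hamiltonian G \<xi> ?p \<le> ?l" .
    moreover have "gen_mu G \<beta> (\<lambda>\<eta>. 0 - w t \<eta>) t \<xi> \<ge> 0"
      using \<beta> t max by (intro gen_mu_nonneg \<xi>) (auto simp: nonneg_control_def)
    then have "gen_mu G \<beta> (w t) t \<xi> \<le> 0"
      using gen_mu_diff[of G \<beta> "\<lambda>_. 0" t \<xi> "w t"] gen_mu_eq[of G \<beta> "\<lambda>_. 0" t \<xi>] by simp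
    ultimately show "- ?l + hjb c \<beta> w t \<xi> \<le> 0" by (simp add: hjb_def)
  qed
  moreover have "?f + ?l * (horizon G - t) \<le> value_bound"
    unfolding value_bound_def using t running_nonneg
    by (intro add_left_mono mult_left_mono sum_nonneg) auto
  ultimately show ?thesis by auto
qed

text \<open>The a priori bounds hold for the truncated equation too. Its solution therefore stays
  where \<open>c\<close> is the identity and solves the original equation.\<close>

lemma HJB_solution_exists:
  assumes \<beta>: "\<beta> \<in> controls G"
  obtains w where "HJB_solution id \<beta> w"
proof -
  obtain B where B: "B \<ge> 0"
    "\<And>t \<eta>. t \<in> {0..horizon G} \<Longrightarrow> \<eta> \<in> states G \<Longrightarrow> norm (\<beta> t \<eta>) \<le> B"
    by (rule controls_bounded[OF \<beta>]) blast
  define c where "c = (\<lambda>r. max 0 (min r value_bound))"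
  have c_range: "c r \<in> {0..value_bound}" for r
    using value_bound_nonneg by (auto simp: c_def)
  have c_lip: "\<bar>c r - c s\<bar> \<le> \<bar>r - s\<bar>" for r s
    by (auto simp: c_def max_def min_def)
  have c_mono: "mono c" by (auto simp: c_def mono_def)
  \<comment> \<open>A slope is a difference of two values, whence the factor 2.\<close>
  define K where "K = 2 * hamiltonian_lip value_bound + mu_const * (1 + B)"
  have K: "K > 0"
    unfolding K_def using hamiltonian_lip_pos[OF value_bound_nonneg] mu_const_nonneg B(1)
    by (intro add_pos_nonneg mult_nonneg_nonneg) auto
  define F where "F = (\<lambda>t \<phi> \<xi>. hamiltonian G \<xi> (slope (\<lambda>\<eta>. c (\<phi> \<eta>)) \<xi>) + gen_mu G \<beta> \<phi> t \<xi>)"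
  have F_lip: "\<bar>F t \<phi> \<xi> - F t \<psi> \<xi>\<bar> \<le> K * D"
    if t: "t \<in> {0..horizon G}" and \<xi>: "\<xi> \<in> states G"
      and D: "\<And>\<eta>. \<eta> \<in> states G \<Longrightarrow> \<bar>\<phi> \<eta> - \<psi> \<eta>\<bar> \<le> D" for t \<xi> \<phi> \<psi> D
  proof -
    have "\<bar>hamiltonian G \<xi> (slope (\<lambda>\<eta>. c (\<phi> \<eta>)) \<xi>) - hamiltonian G \<xi> (slope (\<lambda>\<eta>. c (\<psi> \<eta>)) \<xi>)\<bar>
        \<le> hamiltonian_lip value_bound * (2 * D)"
    proof (rule hamiltonian_lipschitz[OF \<xi>])
      show "\<bar>slope (\<lambda>\<eta>. c (\<phi> \<eta>)) \<xi> $ y - slope (\<lambda>\<eta>. c (\<psi> \<eta>)) \<xi> $ y\<bar> \<le> 2 * D" for y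
        using order.trans[OF c_lip D] by (intro slope_diff_le[OF \<xi>]) auto
    qed (intro slope_bound[OF \<xi>] c_range)+
    moreover have "\<bar>gen_mu G \<beta> \<phi> t \<xi> - gen_mu G \<beta> \<psi> t \<xi>\<bar> \<le> mu_const * (1 + B) * D"
      unfolding gen_mu_diff using B(2)[OF t] D by (intro abs_gen_mu_le \<xi>) auto
    ultimately show ?thesis by (simp add: F_def K_def algebra_simps)
  qed
  have F_cont: "continuous_on {0..horizon G} (\<lambda>t. F t (u t) \<xi>)"
    if \<xi>: "\<xi> \<in> states G" and u: "\<And>\<eta>. \<eta> \<in> states G \<Longrightarrow> continuous_on {0..horizon G} (\<lambda>t. u t \<eta>)"
    for u \<xi>
  proof -
    have "continuous_on {0..horizon G} (\<lambda>t. slope (\<lambda>\<eta>. c (u t \<eta>)) \<xi>)"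
      unfolding slope_def diff_vec_def c_def
      using u state_fst_swap[OF \<xi>] \<xi> by (intro continuous_intros) auto
    then have "continuous_on {0..horizon G} (\<lambda>t. hamiltonian G \<xi> (slope (\<lambda>\<eta>. c (u t \<eta>)) \<xi>))"
      by (rule continuous_on_compose2[OF continuous_on_hamiltonian[OF \<xi>]]) auto
    then show ?thesis
      unfolding F_def
      by (intro continuous_on_add continuous_on_gen_mu \<xi> controls_continuous[OF \<beta>] u)
  qed
  obtain w where w: "\<And>\<xi>. \<xi> \<in> states G \<Longrightarrow> w (horizon G) \<xi> = final G \<xi>"
    "\<And>t \<xi>. t \<in> {0..horizon G} \<Longrightarrow> \<xi> \<in> states G \<Longrightarrow>
      ((\<lambda>s. w s \<xi>) has_real_derivative - F t (w t) \<xi>) (at t within {0..horizon G})"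
  proof (rule finite_ode_solution[of "states G" "horizon G" K F "final G",
        OF finite_states less_imp_le[OF T] K])
    show "\<bar>F t \<phi> \<xi> - F t \<psi> \<xi>\<bar> \<le> K * D"
      if "t \<in> {0..horizon G}" "\<xi> \<in> states G" "\<And>\<eta>. \<eta> \<in> states G \<Longrightarrow> \<bar>\<phi> \<eta> - \<psi> \<eta>\<bar> \<le> D"
      for t \<xi> \<phi> \<psi> D by (rule F_lip[OF that])
    show "continuous_on {0..horizon G} (\<lambda>t. F t (u t) \<xi>)"
      if "\<xi> \<in> states G" "\<And>\<eta>. \<eta> \<in> states G \<Longrightarrow> continuous_on {0..horizon G} (\<lambda>t. u t \<eta>)"
      for u \<xi> by (rule F_cont[OF that])
    fix u assume "\<And>\<xi>. \<xi> \<in> states G \<Longrightarrow> u (horizon G) \<xi> = final G \<xi>"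
      "\<And>t \<xi>. t \<in> {0..horizon G} \<Longrightarrow> \<xi> \<in> states G \<Longrightarrow>
        ((\<lambda>s. u s \<xi>) has_real_derivative - F t (u t) \<xi>) (at t within {0..horizon G})"
    then show thesis by (rule that)
  qed
  then have sol: "HJB_solution c \<beta> w"
    by (simp add: HJB_solution_def hjb_def F_def)
  have "c (w t \<xi>) = w t \<xi>" if "t \<in> {0..horizon G}" "\<xi> \<in> states G" for t \<xi>
    using HJB_solution_bounds[OF sol c_mono controls_nonneg[OF \<beta>] that] by (simp add: c_def)
  then have "slope (\<lambda>\<eta>. c (w t \<eta>)) \<xi> = slope (w t) \<xi>"
    if "t \<in> {0..horizon G}" "\<xi> \<in> states G" for t \<xi>
    using that by (intro slope_cong) auto
  then have "HJB_solution id \<beta> w"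
    using sol by (simp add: HJB_solution_def hjb_def)
  then show ?thesis by (rule that)
qed

lemma value_slope_bound:
  assumes "HJB_solution id \<beta> w" "nonneg_control \<beta>" "t \<in> {0..horizon G}" "\<xi> \<in> states G"
  shows "\<bar>slope (w t) \<xi> $ y\<bar> \<le> value_bound"
  using HJB_solution_bounds[OF assms(1) _ assms(2,3)] assms(4)
  by (intro slope_bound) (auto simp: mono_def)

lemma feedback_bounded:
  assumes "HJB_solution id \<beta> w" "nonneg_control \<beta>" "t \<in> {0..horizon G}" "\<xi> \<in> states G"
  shows "norm (feedback G w t \<xi>) \<le> minimizer_bound value_bound"
  unfolding feedback_eq using value_slope_bound[OF assms] by (intro norm_minimizer_le assms(4))

lemma feedback_diff_le:
  assumes \<xi>: "\<xi> \<in> states G" and D: "\<And>\<eta>. \<eta> \<in> states G \<Longrightarrow> \<bar>w t \<eta> - w' s \<eta>\<bar> \<le> D"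
  shows "norm (feedback G w t \<xi> - feedback G w' s \<xi>) \<le> 2 * minimizer_lip * D"
  unfolding feedback_eq
  using minimizer_lipschitz[OF \<xi> slope_diff_le[OF \<xi> D]] by (simp add: mult_ac)

text \<open>The equation bounds the time derivative of \<open>w\<close>, so \<open>w\<close> is
  Lipschitz in time, and the Lipschitz minimizer passes this on. Only bounds on \<beta> are assumed,
  so that a \<open>w\<close> coupled to its own feedback is covered.\<close>

lemma feedback_in_controls:
  assumes sol: "HJB_solution id \<beta> w" and \<beta>: "nonneg_control \<beta>" and B: "B \<ge> 0"
    "\<And>t \<eta>. t \<in> {0..horizon G} \<Longrightarrow> \<eta> \<in> states G \<Longrightarrow> norm (\<beta> t \<eta>) \<le> B"
  shows "feedback G w \<in> controls G"
proof -
  define L where "L = (\<Sum>\<xi>\<in>states G. \<bar>hamiltonian G \<xi> 0\<bar>) +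
    hamiltonian_lip value_bound * value_bound + mu_const * (1 + B) * value_bound"
  have L: "\<bar>hjb id \<beta> w t \<xi>\<bar> \<le> L" if t: "t \<in> {0..horizon G}" and \<xi>: "\<xi> \<in> states G" for t \<xi>
  proof -
    have "\<bar>hamiltonian G \<xi> (slope (w t) \<xi>) - hamiltonian G \<xi> 0\<bar> \<le> hamiltonian_lip value_bound * value_bound"
      using value_slope_bound[OF sol \<beta> t \<xi>] value_bound_nonneg
      by (intro hamiltonian_lipschitz \<xi>) auto
    moreover have "\<bar>hamiltonian G \<xi> 0\<bar> \<le> (\<Sum>\<xi>\<in>states G. \<bar>hamiltonian G \<xi> 0\<bar>)"
      by (intro member_le_sum \<xi> finite_states) auto
    moreover have "\<bar>gen_mu G \<beta> (w t) t \<xi>\<bar> \<le> mu_const * (1 + B) * value_bound"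
      using B(2)[OF t] HJB_solution_bounds[OF sol _ \<beta> t]
      by (intro abs_gen_mu_le \<xi>) (auto simp: mono_def)
    ultimately show ?thesis unfolding hjb_def L_def id_def by linarith
  qed
  have "L \<ge> 0"
    unfolding L_def
    using B(1) mu_const_nonneg hamiltonian_lip_pos[OF value_bound_nonneg] value_bound_nonneg
    by (intro add_nonneg_nonneg mult_nonneg_nonneg sum_nonneg) auto
  have w_lip: "\<bar>w s \<xi> - w t \<xi>\<bar> \<le> L * \<bar>s - t\<bar>"
    if "s \<in> {0..horizon G}" "t \<in> {0..horizon G}" "\<xi> \<in> states G" for s t \<xi>
    using field_differentiable_bound[of "{0..horizon G}" "\<lambda>t. w t \<xi>" "\<lambda>t. - hjb id \<beta> w t \<xi>" L s t]
      sol L that by (auto simp: HJB_solution_def)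
  have "(2 * minimizer_lip * L)-lipschitz_on {0..horizon G} (\<lambda>t. feedback G w t \<xi>)"
    if \<xi>: "\<xi> \<in> states G" for \<xi>
  proof (rule lipschitz_onI)
    show "0 \<le> 2 * minimizer_lip * L" using minimizer_lip_pos \<open>L \<ge> 0\<close> by simp
    show "dist (feedback G w t \<xi>) (feedback G w s \<xi>) \<le> 2 * minimizer_lip * L * dist t s"
      if ts: "t \<in> {0..horizon G}" "s \<in> {0..horizon G}" for t s
      using feedback_diff_le[where w = w and w' = w, OF \<xi> w_lip[OF ts]]
      by (simp add: dist_norm mult.assoc)
  qed
  then show ?thesis
    using nonneg_control_feedback[of w] unfolding controls_def nonneg_control_def by blast
qed

text \<open>
  At a maximum of \<open>w - w'\<close> both the Hamiltonian difference and the generator applied to \<open>w - w'\<close>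
  are nonpositive, so the exponential barrier only has to absorb the effect of changing the
  population control.
\<close>

lemma HJB_solution_stable:
  assumes sol: "HJB_solution id \<beta> w" "HJB_solution id \<beta>' w'"
    and \<beta>: "nonneg_control \<beta>" "nonneg_control \<beta>'" and \<kappa>: "\<kappa> > 0" and D0: "D \<ge> 0"
    and D: "\<And>t \<eta>. t \<in> {0..horizon G} \<Longrightarrow> \<eta> \<in> states G \<Longrightarrow>
      norm (\<beta> t \<eta> - \<beta>' t \<eta>) \<le> D * exp (\<kappa> * (horizon G - t))"
    and t: "t \<in> {0..horizon G}" and \<xi>: "\<xi> \<in> states G"
  shows "\<bar>w t \<xi> - w' t \<xi>\<bar> \<le> mu_const * value_bound / \<kappa> * D * exp (\<kappa> * (horizon G - t))"
proof -
  let ?C = "mu_const * value_bound * D"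
  \<comment> \<open>A one-sided estimate for arbitrary data, applied at the end with the two
    solutions in both orders.\<close>
  have "0 \<le> ?C / \<kappa> * exp (\<kappa> * (horizon G - t)) - (w t \<xi> - w' t \<xi>)"
    if sol: "HJB_solution id \<beta> w" "HJB_solution id \<beta>' w'"
    and \<beta>: "nonneg_control \<beta>" "nonneg_control \<beta>'"
    and D: "\<And>t \<eta>. t \<in> {0..horizon G} \<Longrightarrow> \<eta> \<in> states G \<Longrightarrow>
      norm (\<beta> t \<eta> - \<beta>' t \<eta>) \<le> D * exp (\<kappa> * (horizon G - t))" for \<beta> \<beta>' w w'
  \<comment> \<open>The barrier decreases at the rate
    \<open>?C * exp (\<kappa> * (horizon G - t))\<close>, which is the bound on the effect of
    changing the population control.\<close>
  proof (rule finite_minimum_principle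
      [where u = "\<lambda>t \<xi>. ?C / \<kappa> * exp (\<kappa> * (horizon G - t)) - (w t \<xi> - w' t \<xi>)"
        and u' = "\<lambda>t \<xi>. - ?C * exp (\<kappa> * (horizon G - t)) + (hjb id \<beta> w t \<xi> - hjb id \<beta>' w' t \<xi>)",
        OF finite_states _ _ _ t \<xi>])
    show "((\<lambda>s. ?C / \<kappa> * exp (\<kappa> * (horizon G - s)) - (w s \<xi> - w' s \<xi>)) has_real_derivative
        - ?C * exp (\<kappa> * (horizon G - t)) + (hjb id \<beta> w t \<xi> - hjb id \<beta>' w' t \<xi>))
        (at t within {0..horizon G})"
      if "t \<in> {0..horizon G}" "\<xi> \<in> states G" for t \<xi>
    proof -
      have "((\<lambda>s. w s \<xi>) has_real_derivative - hjb id \<beta> w t \<xi>) (at t within {0..horizon G})"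
        "((\<lambda>s. w' s \<xi>) has_real_derivative - hjb id \<beta>' w' t \<xi>) (at t within {0..horizon G})"
        using sol that by (auto simp: HJB_solution_def)
      then show ?thesis
        using \<kappa> by (auto intro!: derivative_eq_intros)
    qed
    show "0 \<le> ?C / \<kappa> * exp (\<kappa> * (horizon G - horizon G)) - (w (horizon G) \<xi> - w' (horizon G) \<xi>)"
      if "\<xi> \<in> states G" for \<xi>
      using sol that \<kappa> D0 mu_const_nonneg value_bound_nonneg by (simp add: HJB_solution_def)
    fix t \<xi> assume t: "t \<in> {0..horizon G}" and \<xi>: "\<xi> \<in> states G"
      and min: "\<And>\<eta>. \<eta> \<in> states G \<Longrightarrow>
        ?C / \<kappa> * exp (\<kappa> * (horizon G - t)) - (w t \<xi> - w' t \<xi>)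
          \<le> ?C / \<kappa> * exp (\<kappa> * (horizon G - t)) - (w t \<eta> - w' t \<eta>)"
    have max: "w t \<eta> - w' t \<eta> \<le> w t \<xi> - w' t \<xi>" if "\<eta> \<in> states G" for \<eta>
      using min[OF that] by linarith
    let ?p = "slope (w t) \<xi>" and ?q = "slope (w' t) \<xi>"
    have "drift G \<xi> (?q - ?p) (minimizer G \<xi> ?q) \<ge> 0"
      using max[OF state_fst_swap[OF \<xi>]]
      by (intro drift_nonneg \<xi> minimizer_in) (simp add: slope_nth algebra_simps)
    then have "hamiltonian G \<xi> ?p - hamiltonian G \<xi> ?q \<le> 0"
      using hamiltonian_diff_le[OF \<xi>, of ?p ?q] by (simp flip: drift_diff)
    moreover have "gen_mu G \<beta> (\<lambda>\<eta>. w' t \<eta> - w t \<eta>) t \<xi> \<ge> 0"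
    proof (rule gen_mu_nonneg[OF \<xi>])
      show "\<beta> t \<eta> \<in> nonneg_vecs (fst \<eta>)" if "\<eta> \<in> states G" for \<eta>
        using \<beta> t that by (simp add: nonneg_control_def)
      show "w' t \<xi> - w t \<xi> \<le> w' t \<eta> - w t \<eta>" if "\<eta> \<in> states G" for \<eta>
        using max[OF that] by linarith
    qed
    then have "gen_mu G \<beta> (w t) t \<xi> \<le> gen_mu G \<beta> (w' t) t \<xi>"
      by (simp flip: gen_mu_diff)
    \<comment> \<open>The generators are compared in two steps: above, one control and two
      functions; here, two controls on \<open>w'\<close>, which is bounded by
      \<open>value_bound\<close>.\<close>
    moreover have "\<bar>gen_mu G \<beta> (w' t) t \<xi> - gen_mu G \<beta>' (w' t) t \<xi>\<bar>
        \<le> mu_const * value_bound * (D * exp (\<kappa> * (horizon G - t)))"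
      using D[OF t] HJB_solution_bounds[OF sol(2) _ \<beta>(2) t]
      by (intro abs_gen_mu_control_diff_le \<xi>) (auto simp: mono_def)
    ultimately show "- ?C * exp (\<kappa> * (horizon G - t)) + (hjb id \<beta> w t \<xi> - hjb id \<beta>' w' t \<xi>) \<le> 0"
      by (simp add: hjb_def mult.assoc)
  qed
  from this[OF sol \<beta> D] this[OF sol(2,1) \<beta>(2,1)] show ?thesis
    using D by (simp add: norm_minus_commute abs_le_iff)
qed

end

section \<open>Best responses and the fixed point iteration\<close>

lemma controls_convex:
  assumes a: "a \<in> controls G" and b: "b \<in> controls G" and \<rho>: "\<rho> \<in> {0..1}"
  shows "(\<lambda>t \<xi>. \<rho> *\<^sub>R a t \<xi> + (1 - \<rho>) *\<^sub>R b t \<xi>) \<in> controls G"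
proof -
  obtain L where L: "\<And>\<xi>. \<xi> \<in> states G \<Longrightarrow> L-lipschitz_on {0..horizon G} (\<lambda>t. a t \<xi>)"
    using a by (auto simp: controls_def)
  obtain L' where L': "\<And>\<xi>. \<xi> \<in> states G \<Longrightarrow> L'-lipschitz_on {0..horizon G} (\<lambda>t. b t \<xi>)"
    using b by (auto simp: controls_def)
  have "(\<bar>\<rho>\<bar> * L + \<bar>1 - \<rho>\<bar> * L')-lipschitz_on {0..horizon G} (\<lambda>t. \<rho> *\<^sub>R a t \<xi> + (1 - \<rho>) *\<^sub>R b t \<xi>)"
    if "\<xi> \<in> states G" for \<xi>
    by (intro lipschitz_on_add lipschitz_on_cmult L L' that)
  moreover have "\<rho> *\<^sub>R a t \<xi> + (1 - \<rho>) *\<^sub>R b t \<xi> \<in> nonneg_vecs (fst \<xi>)"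
    if "t \<in> {0..horizon G}" "\<xi> \<in> states G" for t \<xi>
    using a b \<rho> that by (intro convex_nonneg_vecs) (auto simp: controls_def)
  ultimately show ?thesis unfolding controls_def by blast
qed

locale controlled_chains = convex_game G \<gamma> for G :: "'d::finite game" and \<gamma> :: real +
  fixes \<P> :: "('d, 'w) chain_laws" and \<Xi> :: "real \<Rightarrow> 'w \<Rightarrow> 'd state"
  assumes chains: "realizes_chains G \<P> \<Xi>"
begin

text \<open>The Hamiltonian is an infimum, so every control costs at least \<open>w\<close>, and the
  feedback of \<open>w\<close> attains this. The infimum in \<open>val\<close> is thus a
  minimum.\<close>

lemma val_eq_HJB_solution:
  assumes sol: "HJB_solution id \<beta> w" and \<beta>: "\<beta> \<in> controls G"
    and t: "t \<in> {0..horizon G}" and \<xi>: "\<xi> \<in> states G"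
  shows "val G \<P> \<Xi> \<beta> t \<xi> = w t \<xi>"
proof -
  note nonneg = controls_nonneg[OF \<beta>]
  obtain B where B: "B \<ge> 0"
    "\<And>t \<eta>. t \<in> {0..horizon G} \<Longrightarrow> \<eta> \<in> states G \<Longrightarrow> norm (\<beta> t \<eta>) \<le> B"
    by (rule controls_bounded[OF \<beta>]) blast
  have feedback: "feedback G w \<in> controls G"
    by (rule feedback_in_controls[OF sol nonneg B])
  have chain: "markov_chain (states G) (horizon G)
      (\<lambda>\<phi> s \<zeta>. gen_x G \<alpha> \<phi> s \<zeta> + gen_mu G \<beta> \<phi> s \<zeta>) (\<P> \<alpha> \<beta> t \<xi>) \<Xi> t \<xi>" if "\<alpha> \<in> controls G" for \<alpha>
    using chains that \<beta> t \<xi> by (simp add: realizes_chains_def)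
  have tT: "t \<le> horizon G" using t by simp
  have der: "((\<lambda>s. w s \<eta>) has_real_derivative - hjb id \<beta> w s \<eta>) (at s within {t..horizon G})"
    if "s \<in> {t..horizon G}" "\<eta> \<in> states G" for s \<eta>
    using sol that t unfolding HJB_solution_def
    by (auto intro!: DERIV_subset[of _ _ s "{0..horizon G}" "{t..horizon G}"])
  have cost_cont: "continuous_on {t..horizon G} (\<lambda>u. running G \<eta> (\<alpha> u \<eta>))"
    if "\<alpha> \<in> controls G" "\<eta> \<in> states G" for \<alpha> \<eta>
  proof (rule continuous_on_compose2[OF running_cont[OF that(2)]])
    show "continuous_on {t..horizon G} (\<lambda>u. \<alpha> u \<eta>)"
      using t by (intro continuous_on_subset[OF controls_continuous[OF that]]) auto
    show "(\<lambda>u. \<alpha> u \<eta>) ` {t..horizon G} \<subseteq> nonneg_vecs (fst \<eta>)"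
      using controls_nonneg[OF that(1)] that(2) t by (auto simp: nonneg_control_def)
  qed
  have final: "w (horizon G) \<eta> = final G \<eta>" if "\<eta> \<in> states G" for \<eta>
    using sol that by (simp add: HJB_solution_def)
  have cost_eq: "cost G \<P> \<Xi> t \<xi> \<alpha> \<beta> = (LINT \<omega>|\<P> \<alpha> \<beta> t \<xi>.
      (LBINT u:{t..horizon G}. running G (\<Xi> u \<omega>) (\<alpha> u (\<Xi> u \<omega>))) + w (horizon G) (\<Xi> (horizon G) \<omega>))"
    if "\<alpha> \<in> controls G" for \<alpha>
    unfolding cost_def
    using chain_in_states[OF chain[OF that] finite_states, of "horizon G"] tT final
    by (intro Bochner_Integration.integral_cong) auto
  have ge: "w t \<xi> \<le> cost G \<P> \<Xi> t \<xi> \<alpha> \<beta>" if \<alpha>: "\<alpha> \<in> controls G" for \<alpha>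
    unfolding cost_eq[OF \<alpha>]
  proof (rule chain_cost_ge[where c = "\<lambda>u \<eta>. running G \<eta> (\<alpha> u \<eta>)", OF chain[OF \<alpha>] finite_states tT der cost_cont[OF \<alpha>]])
    fix s \<eta> assume s: "s \<in> {t..<horizon G}" and \<eta>: "\<eta> \<in> states G"
    have "\<alpha> s \<eta> \<in> nonneg_vecs (fst \<eta>)"
      using controls_nonneg[OF \<alpha>] s \<eta> t by (auto simp: nonneg_control_def)
    then show "0 \<le> - hjb id \<beta> w s \<eta> + (gen_x G \<alpha> (w s) s \<eta> + gen_mu G \<beta> (w s) s \<eta>) + running G \<eta> (\<alpha> s \<eta>)"
      using hamiltonian_le[OF \<eta>, of "\<alpha> s \<eta>" "slope (w s) \<eta>"]
      by (simp add: hjb_def gen_x_eq_drift pre_hamiltonian_eq)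
  qed
  have eq: "cost G \<P> \<Xi> t \<xi> (feedback G w) \<beta> = w t \<xi>"
    unfolding cost_eq[OF feedback]
  proof (rule chain_cost_eq[where c = "\<lambda>u \<eta>. running G \<eta> (feedback G w u \<eta>)",
        OF chain[OF feedback] finite_states tT der cost_cont[OF feedback]])
    fix s \<eta> assume "s \<in> {t..<horizon G}" and \<eta>: "\<eta> \<in> states G"
    show "- hjb id \<beta> w s \<eta> + (gen_x G (feedback G w) (w s) s \<eta> + gen_mu G \<beta> (w s) s \<eta>)
        + running G \<eta> (feedback G w s \<eta>) = 0"
      by (simp add: hjb_def gen_x_eq_drift pre_hamiltonian_eq hamiltonian_eq[OF \<eta>] feedback_eq)
  qed
  show ?thesis
    unfolding val_def using ge eq feedback
    by (intro cInf_eq_minimum image_eqI[of _ _ "feedback G w"]) auto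
qed

text \<open>Verification identifies \<open>val\<close> with a solution only on the time interval and
  the state space; this transfers the equation to \<open>val\<close> itself.\<close>

lemma HJB_solution_cong:
  assumes sol: "HJB_solution id \<beta> w"
    and \<beta>: "\<And>t \<xi>. t \<in> {0..horizon G} \<Longrightarrow> \<xi> \<in> states G \<Longrightarrow> \<beta>' t \<xi> = \<beta> t \<xi>"
    and w: "\<And>t \<xi>. t \<in> {0..horizon G} \<Longrightarrow> \<xi> \<in> states G \<Longrightarrow> w' t \<xi> = w t \<xi>"
  shows "HJB_solution id \<beta>' w'"
  unfolding HJB_solution_def
proof (intro ballI conjI)
  fix \<xi> assume \<xi>: "\<xi> \<in> states G"
  show "w' (horizon G) \<xi> = final G \<xi>"
    using sol \<xi> w[OF _ \<xi>, of "horizon G"] T by (simp add: HJB_solution_def)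
  fix t assume t: "t \<in> {0..horizon G}"
  have "hjb id \<beta>' w' t \<xi> = hjb id \<beta> w t \<xi>"
    using slope_cong[where \<phi> = "w' t" and \<psi> = "w t", OF \<xi> w[OF t]]
      gen_mu_cong[where \<beta> = \<beta>' and \<beta>' = \<beta>, OF \<xi> \<beta>[OF t] w[OF t]]
    by (simp add: hjb_def)
  then have "((\<lambda>s. w s \<xi>) has_real_derivative - hjb id \<beta>' w' t \<xi>) (at t within {0..horizon G})"
    using sol t \<xi> by (simp add: HJB_solution_def)
  then show "((\<lambda>s. w' s \<xi>) has_real_derivative - hjb id \<beta>' w' t \<xi>) (at t within {0..horizon G})"
    by (rule has_field_derivative_transform_within[of _ _ _ _ 1]) (use t w \<xi> in auto)
qed

lemma val_HJB_solution:
  assumes \<beta>: "\<beta> \<in> controls G"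
  shows "HJB_solution id \<beta> (val G \<P> \<Xi> \<beta>)"
proof -
  obtain w where w: "HJB_solution id \<beta> w" by (rule HJB_solution_exists[OF \<beta>])
  show ?thesis
    by (rule HJB_solution_cong[OF w refl val_eq_HJB_solution[OF w \<beta>]])
qed

lemma best_response_in_controls:
  assumes \<beta>: "\<beta> \<in> controls G"
  shows "best_response G \<P> \<Xi> \<beta> \<in> controls G"
proof -
  obtain B where "B \<ge> 0"
    "\<And>t \<eta>. t \<in> {0..horizon G} \<Longrightarrow> \<eta> \<in> states G \<Longrightarrow> norm (\<beta> t \<eta>) \<le> B"
    by (rule controls_bounded[OF \<beta>]) blast
  then show ?thesis
    unfolding best_response_def
    by (rule feedback_in_controls[OF val_HJB_solution[OF \<beta>] controls_nonneg[OF \<beta>]])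
qed

text \<open>The factor \<open>2 * minimizer_lip\<close> comes from passing from values to feedbacks,
  the rest from \<open>HJB_solution_stable\<close> without its \<open>1 / \<kappa>\<close>. Adding 1
  ensures positivity.\<close>

definition response_const :: real where
  "response_const = 2 * minimizer_lip * (mu_const * value_bound) + 1"

lemma response_const_pos: "response_const > 0"
  unfolding response_const_def using minimizer_lip_pos mu_const_nonneg value_bound_nonneg
  by (intro add_nonneg_pos mult_nonneg_nonneg) auto

text \<open>
  With the weight \<open>exp (\<kappa> (T - t))\<close>, the best response contracts by any prescribed factor once
  \<open>\<kappa>\<close> is large; here by \<open>1/2\<close>.
\<close>

definition \<kappa> :: real where "\<kappa> = 2 * response_const"

definition weight :: "real \<Rightarrow> real" where "weight t = exp (\<kappa> * (horizon G - t))"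

lemma kappa_pos: "\<kappa> > 0"
  using response_const_pos by (simp add: \<kappa>_def)

lemma weight_ge_1: "t \<in> {0..horizon G} \<Longrightarrow> 1 \<le> weight t"
  and weight_le: "t \<in> {0..horizon G} \<Longrightarrow> weight t \<le> weight 0"
  and weight_pos: "weight t > 0"
  using kappa_pos by (auto simp: weight_def)

lemma val_stable:
  assumes \<beta>: "\<beta> \<in> controls G" "\<beta>' \<in> controls G" and "D \<ge> 0"
    and "\<And>t \<eta>. t \<in> {0..horizon G} \<Longrightarrow> \<eta> \<in> states G \<Longrightarrow> norm (\<beta> t \<eta> - \<beta>' t \<eta>) \<le> D * weight t"
    and "t \<in> {0..horizon G}" "\<xi> \<in> states G"
  shows "\<bar>val G \<P> \<Xi> \<beta> t \<xi> - val G \<P> \<Xi> \<beta>' t \<xi>\<bar> \<le> mu_const * value_bound / \<kappa> * D * weight t"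
  unfolding weight_def
  by (rule HJB_solution_stable[OF val_HJB_solution[OF \<beta>(1)] val_HJB_solution[OF \<beta>(2)]
      controls_nonneg[OF \<beta>(1)] controls_nonneg[OF \<beta>(2)] kappa_pos])
    (use assms in \<open>auto simp: weight_def\<close>)

lemma best_response_contraction:
  assumes \<beta>: "\<beta> \<in> controls G" "\<beta>' \<in> controls G" and D0: "D \<ge> 0"
    and D: "\<And>t \<eta>. t \<in> {0..horizon G} \<Longrightarrow> \<eta> \<in> states G \<Longrightarrow> norm (\<beta> t \<eta> - \<beta>' t \<eta>) \<le> D * weight t"
    and t: "t \<in> {0..horizon G}" and \<xi>: "\<xi> \<in> states G"
  shows "norm (best_response G \<P> \<Xi> \<beta> t \<xi> - best_response G \<P> \<Xi> \<beta>' t \<xi>) \<le> D / 2 * weight t"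
proof -
  have "norm (best_response G \<P> \<Xi> \<beta> t \<xi> - best_response G \<P> \<Xi> \<beta>' t \<xi>)
      \<le> 2 * minimizer_lip * (mu_const * value_bound / \<kappa> * D * weight t)"
    unfolding best_response_def using val_stable[OF \<beta> D0 D t] by (intro feedback_diff_le \<xi>)
  also have "\<dots> = (response_const - 1) / \<kappa> * (D * weight t)"
    by (simp add: response_const_def)
  also have "\<dots> \<le> 1 / 2 * (D * weight t)"
    using kappa_pos D0 weight_pos[of t]
    by (intro mult_right_mono) (auto simp: \<kappa>_def divide_simps)
  finally show ?thesis by simp
qed

lemma best_response_bounded:
  assumes "\<beta> \<in> controls G" "t \<in> {0..horizon G}" "\<xi> \<in> states G"
  shows "norm (best_response G \<P> \<Xi> \<beta> t \<xi>) \<le> minimizer_bound value_bound"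
  unfolding best_response_def
  using feedback_bounded[OF val_HJB_solution controls_nonneg] assms by blast

section \<open>Equilibria and the N-NLL equation\<close>

text \<open>Equilibria are best responses and hence bounded. Applying the contraction
  \<open>n\<close> times to this crude bound and letting \<open>n\<close> grow leaves distance
  zero.\<close>

lemma markov_perfect_eq_unique:
  assumes "markov_perfect_eq G \<P> \<Xi> a" "markov_perfect_eq G \<P> \<Xi> b"
    and t: "t \<in> {0..horizon G}" and \<xi>: "\<xi> \<in> states G"
  shows "a t \<xi> = b t \<xi>"
proof -
  have a: "a \<in> controls G" "\<And>t \<xi>. t \<in> {0..horizon G} \<Longrightarrow> \<xi> \<in> states G \<Longrightarrow> a t \<xi> = best_response G \<P> \<Xi> a t \<xi>"
    and b: "b \<in> controls G" "\<And>t \<xi>. t \<in> {0..horizon G} \<Longrightarrow> \<xi> \<in> states G \<Longrightarrow> b t \<xi> = best_response G \<P> \<Xi> b t \<xi>"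
    using assms(1,2) by (simp_all add: markov_perfect_eq_def)
  define C where "C = 2 * minimizer_bound value_bound"
  have diff_le: "norm (a t \<xi> - b t \<xi>) \<le> C" if "t \<in> {0..horizon G}" "\<xi> \<in> states G" for t \<xi>
    using best_response_bounded[OF a(1) that] best_response_bounded[OF b(1) that]
      a(2)[OF that] b(2)[OF that] norm_triangle_ineq4[of "a t \<xi>" "b t \<xi>"]
    by (simp add: C_def)
  have C0: "C \<ge> 0" using order.trans[OF norm_ge_zero diff_le[OF t \<xi>]] .
  have le: "norm (a t \<xi> - b t \<xi>) \<le> C * (1/2) ^ n * weight t"
    if "t \<in> {0..horizon G}" "\<xi> \<in> states G" for n t \<xi>
    using that
  proof (induction n arbitrary: t \<xi>)
    case 0
    then show ?case
      using diff_le[OF 0] mult_left_mono[OF weight_ge_1[OF 0(1)] C0] by simp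
  next
    case (Suc n)
    have "norm (best_response G \<P> \<Xi> a t \<xi> - best_response G \<P> \<Xi> b t \<xi>) \<le> C * (1/2) ^ n / 2 * weight t"
      by (rule best_response_contraction[OF a(1) b(1)]) (use Suc C0 in auto)
    then show ?case using a(2)[OF Suc.prems] b(2)[OF Suc.prems] by simp
  qed
  have "(\<lambda>n. C * (1/2) ^ n * weight t) \<longlonglongrightarrow> C * 0 * weight t"
    by (intro tendsto_intros LIMSEQ_power_zero) auto
  then have "norm (a t \<xi> - b t \<xi>) \<le> C * 0 * weight t"
    by (rule LIMSEQ_le_const) (use le[OF t \<xi>] in auto)
  then show ?thesis by simp
qed

text \<open>The population control is the feedback itself, so its regularity is not known
  beforehand. Its bound comes from the slopes of \<open>w\<close>, which are bounded for any
  nonnegative control; Lipschitz continuity then follows.\<close>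

lemma feedback_control_if_HJB_solution:
  assumes "HJB_solution id (feedback G w) w"
  shows "feedback G w \<in> controls G"
proof (rule feedback_in_controls[OF assms nonneg_control_feedback])
  have bound: "norm (feedback G w t \<eta>) \<le> minimizer_bound value_bound"
    if "t \<in> {0..horizon G}" "\<eta> \<in> states G" for t \<eta>
    by (rule feedback_bounded[OF assms nonneg_control_feedback that])
  then show "norm (feedback G w t \<eta>) \<le> \<bar>minimizer_bound value_bound\<bar>"
    if "t \<in> {0..horizon G}" "\<eta> \<in> states G" for t \<eta>
    using bound[OF that] by simp
qed simp

text \<open>By verification \<open>w\<close> is the value against its own feedback, so the best
  response reproduces that feedback.\<close>

lemma feedback_markov_perfect_eq:
  assumes sol: "HJB_solution id (feedback G w) w"
  shows "markov_perfect_eq G \<P> \<Xi> (feedback G w)"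
  unfolding markov_perfect_eq_def
proof (intro conjI ballI)
  show control: "feedback G w \<in> controls G"
    by (rule feedback_control_if_HJB_solution[OF sol])
  fix t \<xi> assume t: "t \<in> {0..horizon G}" and \<xi>: "\<xi> \<in> states G"
  have "slope (val G \<P> \<Xi> (feedback G w) t) \<xi> = slope (w t) \<xi>"
    by (rule slope_cong[OF \<xi> val_eq_HJB_solution[OF sol control t]])
  then show "feedback G w t \<xi> = best_response G \<P> \<Xi> (feedback G w) t \<xi>"
    unfolding best_response_def feedback_eq[of G w t \<xi>]
      feedback_eq[of G "val G \<P> \<Xi> (feedback G w)" t \<xi>]
    by simp
qed

text \<open>Both sides state the same coupled equation. The continuous derivative demanded of a
  classical solution is recovered from the continuity in time of the right-hand side.\<close>

lemma NLL_solution_iff: "NLL_solution G w \<longleftrightarrow> HJB_solution id (feedback G w) w"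
proof
  assume nll: "NLL_solution G w"
  show "HJB_solution id (feedback G w) w"
    unfolding HJB_solution_def
  proof (intro ballI conjI)
    fix \<xi> assume \<xi>: "\<xi> \<in> states G"
    then obtain w' where fin: "w (horizon G) \<xi> = final G \<xi>"
      and w': "\<And>t. t \<in> {0..horizon G} \<Longrightarrow>
        ((\<lambda>s. w s \<xi>) has_real_derivative w' t) (at t within {0..horizon G}) \<and>
        - w' t = hamiltonian G \<xi> (slope (w t) \<xi>) + gen_mu G (feedback G w) (w t) t \<xi>"
      using nll unfolding NLL_solution_def slope_def by (cases \<xi>) fastforce
    show "w (horizon G) \<xi> = final G \<xi>" by (rule fin)
    fix t assume "t \<in> {0..horizon G}"
    moreover from w'[OF this] have "w' t = - hjb id (feedback G w) w t \<xi>"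
      by (simp add: hjb_def)
    ultimately show "((\<lambda>s. w s \<xi>) has_real_derivative - hjb id (feedback G w) w t \<xi>)
        (at t within {0..horizon G})"
      using w' by fastforce
  qed
next
  assume sol: "HJB_solution id (feedback G w) w"
  note control = feedback_control_if_HJB_solution[OF sol]
  have der: "((\<lambda>s. w s \<xi>) has_real_derivative - hjb id (feedback G w) w t \<xi>) (at t within {0..horizon G})"
    if "t \<in> {0..horizon G}" "\<xi> \<in> states G" for t \<xi>
    using sol that by (simp add: HJB_solution_def)
  have contw: "continuous_on {0..horizon G} (\<lambda>t. w t \<xi>)" if "\<xi> \<in> states G" for \<xi>
    using der[OF _ that] by (rule DERIV_continuous_on)
  have cont: "continuous_on {0..horizon G} (\<lambda>t. hjb id (feedback G w) w t \<xi>)" if \<xi>: "\<xi> \<in> states G" for \<xi>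
  proof -
    have "continuous_on {0..horizon G} (\<lambda>t. slope (w t) \<xi>)"
      unfolding slope_def diff_vec_def
      using contw state_fst_swap[OF \<xi>] \<xi> by (intro continuous_intros) auto
    then have "continuous_on {0..horizon G} (\<lambda>t. hamiltonian G \<xi> (slope (w t) \<xi>))"
      by (rule continuous_on_compose2[OF continuous_on_hamiltonian[OF \<xi>]]) auto
    then show ?thesis
      unfolding hjb_def id_def
      by (intro continuous_on_add continuous_on_gen_mu \<xi> controls_continuous[OF control] contw)
  qed
  have "\<exists>w'. continuous_on {0..horizon G} w' \<and>
      (\<forall>t\<in>{0..horizon G}.
         ((\<lambda>s. w s \<xi>) has_real_derivative w' t) (at t within {0..horizon G}) \<and>
         - w' t = hamiltonian G \<xi> (slope (w t) \<xi>) + gen_mu G (feedback G w) (w t) t \<xi>)"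
    if \<xi>: "\<xi> \<in> states G" for \<xi>
  proof (intro exI conjI ballI)
    show "continuous_on {0..horizon G} (\<lambda>t. - hjb id (feedback G w) w t \<xi>)"
      using cont[OF \<xi>] by (rule continuous_on_minus)
    show "((\<lambda>s. w s \<xi>) has_real_derivative - hjb id (feedback G w) w t \<xi>) (at t within {0..horizon G})"
      if "t \<in> {0..horizon G}" for t
      using that \<xi> by (rule der)
    show "- (- hjb id (feedback G w) w t \<xi>) =
        hamiltonian G \<xi> (slope (w t) \<xi>) + gen_mu G (feedback G w) (w t) t \<xi>" for t
      by (simp add: hjb_def)
  qed
  moreover have "w (horizon G) \<xi> = final G \<xi>" if "\<xi> \<in> states G" for \<xi>
    using sol that by (simp add: HJB_solution_def)
  ultimately show "NLL_solution G w"
    unfolding NLL_solution_def slope_def by fastforce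
qed

text \<open>The feedbacks of both solutions are equilibria and hence agree; so both functions solve
  the equation for one and the same control and equal its value.\<close>

lemma NLL_solution_unique:
  assumes "NLL_solution G w" "NLL_solution G w'" and t: "t \<in> {0..horizon G}" and \<xi>: "\<xi> \<in> states G"
  shows "w t \<xi> = w' t \<xi>"
proof -
  have sol: "HJB_solution id (feedback G w) w" "HJB_solution id (feedback G w') w'"
    using assms(1,2) by (simp_all add: NLL_solution_iff)
  have "HJB_solution id (feedback G w) w'"
    using markov_perfect_eq_unique[OF sol[THEN feedback_markov_perfect_eq]]
    by (intro HJB_solution_cong[OF sol(2)]) auto
  then show ?thesis
    using val_eq_HJB_solution[OF _ feedback_control_if_HJB_solution[OF sol(1)] t \<xi>] sol(1) by metis
qed

section \<open>Convergence of the averaged iteration\<close>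

context
  fixes \<beta> :: "nat \<Rightarrow> 'd control" and \<rho> :: real
  assumes rho: "0 \<le> \<rho>" "\<rho> < 1"
    and beta_0: "\<beta> 0 \<in> controls G"
    and beta_Suc: "\<And>n. \<beta> (Suc n) =
      (\<lambda>t \<xi>. \<rho> *\<^sub>R \<beta> n t \<xi> + (1 - \<rho>) *\<^sub>R best_response G \<P> \<Xi> (\<beta> n) t \<xi>)"
begin

lemma beta_controls: "\<beta> n \<in> controls G"
  using rho
  by (induction n) (auto simp: beta_0 beta_Suc intro!: controls_convex best_response_in_controls)

text \<open>Averaging keeps a share \<open>\<rho>\<close> of the old increment and halves the rest,
  which gives the factor \<open>\<rho> + (1 - \<rho>) / 2 = (1 + \<rho>) / 2 < 1\<close>.\<close>

lemma beta_step_le: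
  obtains C where "C \<ge> 0"
    and "\<And>n t \<xi>. t \<in> {0..horizon G} \<Longrightarrow> \<xi> \<in> states G \<Longrightarrow>
      norm (\<beta> (Suc n) t \<xi> - \<beta> n t \<xi>) \<le> C * ((1 + \<rho>) / 2) ^ n * weight t"
proof -
  obtain C where C0: "C \<ge> 0" and C: "\<And>t \<xi>. t \<in> {0..horizon G} \<Longrightarrow> \<xi> \<in> states G \<Longrightarrow>
      norm (\<beta> 1 t \<xi> - \<beta> 0 t \<xi>) \<le> C"
  proof -
    obtain B where B: "B \<ge> 0"
      "\<And>t \<eta>. t \<in> {0..horizon G} \<Longrightarrow> \<eta> \<in> states G \<Longrightarrow> norm (\<beta> 0 t \<eta>) \<le> B"
      by (rule controls_bounded[OF beta_controls]) blast
    obtain B' where B': "B' \<ge> 0"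
      "\<And>t \<eta>. t \<in> {0..horizon G} \<Longrightarrow> \<eta> \<in> states G \<Longrightarrow> norm (\<beta> 1 t \<eta>) \<le> B'"
      by (rule controls_bounded[OF beta_controls]) blast
    show ?thesis
    proof (rule that)
      show "B' + B \<ge> 0" using B(1) B'(1) by simp
      show "norm (\<beta> 1 t \<xi> - \<beta> 0 t \<xi>) \<le> B' + B" if "t \<in> {0..horizon G}" "\<xi> \<in> states G" for t \<xi>
        using B(2)[OF that] B'(2)[OF that] norm_triangle_ineq4[of "\<beta> 1 t \<xi>" "\<beta> 0 t \<xi>"] by linarith
    qed
  qed
  have "norm (\<beta> (Suc n) t \<xi> - \<beta> n t \<xi>) \<le> C * ((1 + \<rho>) / 2) ^ n * weight t"
    if "t \<in> {0..horizon G}" "\<xi> \<in> states G" for n t \<xi>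
    using that
  proof (induction n arbitrary: t \<xi>)
    case 0
    then show ?case
      using C[OF 0] mult_left_mono[OF weight_ge_1[OF 0(1)] C0] by simp
  next
    case (Suc n)
    let ?D = "C * ((1 + \<rho>) / 2) ^ n"
    let ?b = "\<beta> (Suc n) t \<xi> - \<beta> n t \<xi>"
    let ?r = "best_response G \<P> \<Xi> (\<beta> (Suc n)) t \<xi> - best_response G \<P> \<Xi> (\<beta> n) t \<xi>"
    have r: "norm ?r \<le> ?D / 2 * weight t"
      by (rule best_response_contraction[OF beta_controls beta_controls]) (use Suc C0 rho in auto)
    have "\<beta> (Suc (Suc n)) t \<xi> - \<beta> (Suc n) t \<xi> = \<rho> *\<^sub>R ?b + (1 - \<rho>) *\<^sub>R ?r"
      unfolding beta_Suc[of "Suc n"] by (subst (2) beta_Suc) (simp add: algebra_simps)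
    then have "norm (\<beta> (Suc (Suc n)) t \<xi> - \<beta> (Suc n) t \<xi>) \<le> \<rho> * norm ?b + (1 - \<rho>) * norm ?r"
      using norm_triangle_ineq[of "\<rho> *\<^sub>R ?b" "(1 - \<rho>) *\<^sub>R ?r"] rho by simp
    also have "\<dots> \<le> \<rho> * (?D * weight t) + (1 - \<rho>) * (?D / 2 * weight t)"
      using Suc r rho by (intro add_mono mult_left_mono) auto
    also have "\<dots> = C * ((1 + \<rho>) / 2) ^ Suc n * weight t"
      by (simp add: field_simps)
    finally show ?case .
  qed
  with C0 show ?thesis by (rule that)
qed

text \<open>By stability the values inherit the geometric rate of the controls; replacing the weight
  by its largest value \<open>weight 0\<close> makes the estimate uniform.\<close>

lemma val_beta_converges:
  obtains w where "uniform_limit ({0..horizon G} \<times> states G)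
    (\<lambda>n (t, \<xi>). val G \<P> \<Xi> (\<beta> n) t \<xi>) (\<lambda>(t, \<xi>). w t \<xi>) sequentially"
proof -
  obtain C where C0: "C \<ge> 0" and C: "\<And>n t \<xi>. t \<in> {0..horizon G} \<Longrightarrow> \<xi> \<in> states G \<Longrightarrow>
      norm (\<beta> (Suc n) t \<xi> - \<beta> n t \<xi>) \<le> C * ((1 + \<rho>) / 2) ^ n * weight t"
    by (rule beta_step_le) blast
  let ?K = "mu_const * value_bound / \<kappa>"
  have K: "?K \<ge> 0" using mu_const_nonneg value_bound_nonneg kappa_pos by simp
  have "norm ((case p of (t, \<xi>) \<Rightarrow> val G \<P> \<Xi> (\<beta> (Suc n)) t \<xi>) - (case p of (t, \<xi>) \<Rightarrow> val G \<P> \<Xi> (\<beta> n) t \<xi>))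
      \<le> ?K * C * weight 0 * ((1 + \<rho>) / 2) ^ n"
    if p: "p \<in> {0..horizon G} \<times> states G" for n p
  proof -
    obtain t \<xi> where p_eq: "p = (t, \<xi>)" and t: "t \<in> {0..horizon G}" and \<xi>: "\<xi> \<in> states G"
      using p by auto
    let ?D = "C * ((1 + \<rho>) / 2) ^ n"
    have D: "?D \<ge> 0" using C0 rho by simp
    have "\<bar>val G \<P> \<Xi> (\<beta> (Suc n)) t \<xi> - val G \<P> \<Xi> (\<beta> n) t \<xi>\<bar> \<le> ?K * ?D * weight t"
      by (rule val_stable[OF beta_controls beta_controls D C t \<xi>])
    also have "\<dots> \<le> ?K * ?D * weight 0"
      by (rule mult_left_mono[OF weight_le[OF t] mult_nonneg_nonneg[OF K D]])
    finally show ?thesis by (simp add: p_eq mult_ac)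
  qed
  then obtain l where "uniform_limit ({0..horizon G} \<times> states G)
      (\<lambda>n (t, \<xi>). val G \<P> \<Xi> (\<beta> n) t \<xi>) l sequentially"
    by (rule geometric_uniform_limit) (use rho in auto)
  then show ?thesis using that[of "\<lambda>t \<xi>. l (t, \<xi>)"] by simp
qed

lemma beta_converges:
  obtains b where "uniform_limit ({0..horizon G} \<times> states G)
    (\<lambda>n (t, \<xi>). \<beta> n t \<xi>) (\<lambda>(t, \<xi>). b t \<xi>) sequentially"
proof -
  obtain C where C0: "C \<ge> 0" and C: "\<And>n t \<xi>. t \<in> {0..horizon G} \<Longrightarrow> \<xi> \<in> states G \<Longrightarrow>
      norm (\<beta> (Suc n) t \<xi> - \<beta> n t \<xi>) \<le> C * ((1 + \<rho>) / 2) ^ n * weight t"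
    by (rule beta_step_le) blast
  have "norm ((case p of (t, \<xi>) \<Rightarrow> \<beta> (Suc n) t \<xi>) - (case p of (t, \<xi>) \<Rightarrow> \<beta> n t \<xi>))
      \<le> C * weight 0 * ((1 + \<rho>) / 2) ^ n"
    if p: "p \<in> {0..horizon G} \<times> states G" for n p
  proof -
    obtain t \<xi> where p_eq: "p = (t, \<xi>)" and t: "t \<in> {0..horizon G}" and \<xi>: "\<xi> \<in> states G"
      using p by auto
    have "norm (\<beta> (Suc n) t \<xi> - \<beta> n t \<xi>) \<le> C * ((1 + \<rho>) / 2) ^ n * weight t"
      by (rule C[OF t \<xi>])
    also have "\<dots> \<le> C * ((1 + \<rho>) / 2) ^ n * weight 0"
      using weight_le[OF t] C0 rho by (intro mult_left_mono) auto
    finally show ?thesis by (simp add: p_eq mult_ac)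
  qed
  then obtain l where "uniform_limit ({0..horizon G} \<times> states G) (\<lambda>n (t, \<xi>). \<beta> n t \<xi>) l sequentially"
    by (rule geometric_uniform_limit) (use rho in auto)
  then show ?thesis using that[of "\<lambda>t \<xi>. l (t, \<xi>)"] by simp
qed

lemma best_response_limit:
  assumes w: "uniform_limit ({0..horizon G} \<times> states G)
    (\<lambda>n (t, \<xi>). val G \<P> \<Xi> (\<beta> n) t \<xi>) (\<lambda>(t, \<xi>). w t \<xi>) sequentially"
  shows "uniform_limit ({0..horizon G} \<times> states G)
    (\<lambda>n (t, \<xi>). best_response G \<P> \<Xi> (\<beta> n) t \<xi>) (\<lambda>(t, \<xi>). feedback G w t \<xi>) sequentially"
proof (rule uniform_limitI)
  fix e :: real assume "e > 0"
  \<comment> \<open>Makes the Lipschitz bound for feedbacks equal to \<open>e / 2\<close>.\<close>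
  let ?d = "e / (4 * minimizer_lip)"
  have "?d > 0" using \<open>e > 0\<close> minimizer_lip_pos by simp
  from uniform_limitD[OF w this]
  show "\<forall>\<^sub>F n in sequentially. \<forall>p\<in>{0..horizon G} \<times> states G.
      dist (case p of (t, \<xi>) \<Rightarrow> best_response G \<P> \<Xi> (\<beta> n) t \<xi>) (case p of (t, \<xi>) \<Rightarrow> feedback G w t \<xi>) < e"
  proof eventually_elim
    case (elim n)
    have "norm (best_response G \<P> \<Xi> (\<beta> n) t \<xi> - feedback G w t \<xi>) < e"
      if t: "t \<in> {0..horizon G}" and \<xi>: "\<xi> \<in> states G" for t \<xi>
    proof -
      have "norm (best_response G \<P> \<Xi> (\<beta> n) t \<xi> - feedback G w t \<xi>) \<le> 2 * minimizer_lip * ?d"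
        unfolding best_response_def
      proof (rule feedback_diff_le[OF \<xi>])
        show "\<bar>val G \<P> \<Xi> (\<beta> n) t \<eta> - w t \<eta>\<bar> \<le> ?d" if "\<eta> \<in> states G" for \<eta>
          using elim[rule_format, of "(t, \<eta>)"] t that by (simp add: dist_real_def)
      qed
      then show ?thesis using \<open>e > 0\<close> minimizer_lip_pos by simp
    qed
    then show ?case by (auto simp: dist_norm)
  qed
qed

text \<open>In the limit the recursion reads \<open>b = \<rho> b + (1 - \<rho>) feedback\<close>,
  and \<rho> < 1 forces both to coincide.\<close>

lemma beta_limit:
  assumes w: "uniform_limit ({0..horizon G} \<times> states G)
    (\<lambda>n (t, \<xi>). val G \<P> \<Xi> (\<beta> n) t \<xi>) (\<lambda>(t, \<xi>). w t \<xi>) sequentially"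
  shows "uniform_limit ({0..horizon G} \<times> states G)
    (\<lambda>n (t, \<xi>). \<beta> n t \<xi>) (\<lambda>(t, \<xi>). feedback G w t \<xi>) sequentially"
proof -
  obtain b where b: "uniform_limit ({0..horizon G} \<times> states G)
      (\<lambda>n (t, \<xi>). \<beta> n t \<xi>) (\<lambda>(t, \<xi>). b t \<xi>) sequentially"
    by (rule beta_converges)
  have "b t \<xi> = feedback G w t \<xi>" if "t \<in> {0..horizon G}" "\<xi> \<in> states G" for t \<xi>
  proof -
    have lim: "(\<lambda>n. \<beta> n t \<xi>) \<longlonglongrightarrow> b t \<xi>"
      and "(\<lambda>n. best_response G \<P> \<Xi> (\<beta> n) t \<xi>) \<longlonglongrightarrow> feedback G w t \<xi>"
      using tendsto_uniform_limitI[OF b, of "(t, \<xi>)"]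
        tendsto_uniform_limitI[OF best_response_limit[OF w], of "(t, \<xi>)"] that by auto
    then have "(\<lambda>n. \<beta> (Suc n) t \<xi>) \<longlonglongrightarrow> \<rho> *\<^sub>R b t \<xi> + (1 - \<rho>) *\<^sub>R feedback G w t \<xi>"
      unfolding beta_Suc by (intro tendsto_intros)
    then have "\<rho> *\<^sub>R b t \<xi> + (1 - \<rho>) *\<^sub>R feedback G w t \<xi> = b t \<xi>"
      using LIMSEQ_Suc[OF lim] by (rule LIMSEQ_unique)
    then have "(1 - \<rho>) *\<^sub>R (feedback G w t \<xi> - b t \<xi>) = 0" by (simp add: algebra_simps)
    then show ?thesis using rho by simp
  qed
  then show ?thesis
    using b by (subst uniform_limit_cong'[where g = "\<lambda>n (t, \<xi>). \<beta> n t \<xi>" and i = "\<lambda>(t, \<xi>). b t \<xi>"]) auto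
qed

text \<open>On the bounded ranges at hand the right-hand side is Lipschitz jointly in value and
  control, so the time derivatives converge uniformly and the equation passes to the limit.\<close>

lemma limit_HJB_solution:
  assumes w: "uniform_limit ({0..horizon G} \<times> states G)
    (\<lambda>n (t, \<xi>). val G \<P> \<Xi> (\<beta> n) t \<xi>) (\<lambda>(t, \<xi>). w t \<xi>) sequentially"
  shows "HJB_solution id (feedback G w) w"
proof -
  let ?v = "\<lambda>n. val G \<P> \<Xi> (\<beta> n)"
  note sol = val_HJB_solution[OF beta_controls]
  have lim: "(\<lambda>n. ?v n t \<xi>) \<longlonglongrightarrow> w t \<xi>" if "t \<in> {0..horizon G}" "\<xi> \<in> states G" for t \<xi>
    using tendsto_uniform_limitI[OF w, of "(t, \<xi>)"] that by simp
  have v_range: "?v n t \<xi> \<in> {0..value_bound}" if "t \<in> {0..horizon G}" "\<xi> \<in> states G" for n t \<xi>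
    using HJB_solution_bounds[OF sol _ controls_nonneg[OF beta_controls] that] by (simp add: mono_def)
  have w_range: "w t \<xi> \<in> {0..value_bound}" if "t \<in> {0..horizon G}" "\<xi> \<in> states G" for t \<xi>
    by (rule closed_sequentially[OF _ v_range[OF that] lim[OF that]]) auto
  define B where "B = \<bar>minimizer_bound value_bound\<bar>"
  have feedback_le: "norm (feedback G w t \<xi>) \<le> B" if t: "t \<in> {0..horizon G}" and \<xi>: "\<xi> \<in> states G" for t \<xi>
    unfolding feedback_eq B_def
    by (rule order.trans[OF norm_minimizer_le[OF \<xi> slope_bound[OF \<xi> w_range[OF t]]] abs_ge_self])
  \<comment> \<open>Three summands for three changes: the slope in the Hamiltonian, the function
    under \<open>gen_mu\<close>, and the control. Here \<open>2 + B\<close> is 1 plus the bound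
    \<open>1 + B\<close> on iterates close to the feedback.\<close>
  define K where "K = 2 * hamiltonian_lip value_bound + mu_const * (2 + B) + mu_const * value_bound"
  have K: "K > 0"
    unfolding K_def B_def using hamiltonian_lip_pos[OF value_bound_nonneg] mu_const_nonneg value_bound_nonneg
    by (intro add_pos_nonneg mult_nonneg_nonneg) auto
  have hjb_diff: "\<bar>hjb id (\<beta> n) (?v n) t \<xi> - hjb id (feedback G w) w t \<xi>\<bar> \<le> K * D"
    if t: "t \<in> {0..horizon G}" and \<xi>: "\<xi> \<in> states G" and D: "0 \<le> D" "D \<le> 1"
      and v: "\<And>\<eta>. \<eta> \<in> states G \<Longrightarrow> \<bar>?v n t \<eta> - w t \<eta>\<bar> \<le> D"
      and b: "\<And>\<eta>. \<eta> \<in> states G \<Longrightarrow> norm (\<beta> n t \<eta> - feedback G w t \<eta>) \<le> D"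
    for n t \<xi> D
  proof -
    have beta_le: "norm (\<beta> n t \<eta>) \<le> 1 + B" if "\<eta> \<in> states G" for \<eta>
      using norm_triangle_sub[of "\<beta> n t \<eta>" "feedback G w t \<eta>"] b[OF that] feedback_le[OF t that] D(2)
      by linarith
    have "\<bar>hamiltonian G \<xi> (slope (?v n t) \<xi>) - hamiltonian G \<xi> (slope (w t) \<xi>)\<bar>
        \<le> hamiltonian_lip value_bound * (2 * D)"
      by (intro hamiltonian_lipschitz \<xi> slope_bound[OF \<xi>] slope_diff_le[OF \<xi>] v v_range w_range t)
    moreover have "\<bar>gen_mu G (\<beta> n) (?v n t) t \<xi> - gen_mu G (\<beta> n) (w t) t \<xi>\<bar> \<le> mu_const * (1 + (1 + B)) * D"
      unfolding gen_mu_diff by (intro abs_gen_mu_le \<xi> v beta_le)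
    moreover have "\<bar>gen_mu G (\<beta> n) (w t) t \<xi> - gen_mu G (feedback G w) (w t) t \<xi>\<bar> \<le> mu_const * value_bound * D"
      using w_range[OF t] by (intro abs_gen_mu_control_diff_le \<xi> b) auto
    moreover have "K * D = hamiltonian_lip value_bound * (2 * D) + mu_const * (1 + (1 + B)) * D
        + mu_const * value_bound * D"
      by (simp add: K_def algebra_simps)
    ultimately show ?thesis unfolding hjb_def id_def by linarith
  qed
  show ?thesis
    unfolding HJB_solution_def
  proof (intro ballI conjI)
    fix \<xi> assume \<xi>: "\<xi> \<in> states G"
    have "?v n (horizon G) \<xi> = final G \<xi>" for n
      using sol \<xi> by (simp add: HJB_solution_def)
    then show "w (horizon G) \<xi> = final G \<xi>"
      using lim[OF _ \<xi>, of "horizon G"] T by (simp add: LIMSEQ_const_iff)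
    fix t assume t: "t \<in> {0..horizon G}"
    show "((\<lambda>s. w s \<xi>) has_real_derivative - hjb id (feedback G w) w t \<xi>) (at t within {0..horizon G})"
    proof (rule has_real_derivative_uniform_limit[OF _ _ lim[OF _ \<xi>] t])
      show "((\<lambda>s. ?v n s \<xi>) has_real_derivative - hjb id (\<beta> n) (?v n) t \<xi>) (at t within {0..horizon G})"
        if "t \<in> {0..horizon G}" for n t
        using sol \<xi> that by (simp add: HJB_solution_def)
      show "uniform_limit {0..horizon G} (\<lambda>n s. - hjb id (\<beta> n) (?v n) s \<xi>)
          (\<lambda>s. - hjb id (feedback G w) w s \<xi>) sequentially"
      proof (rule uniform_limitI)
        fix e :: real assume "e > 0"
        \<comment> \<open>Capped at 1 because the bound on the iterates assumes distance at most 1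
          from the limit.\<close>
        define D where "D = min 1 (e / (2 * K))"
        have D: "D > 0" "D \<le> 1" using \<open>e > 0\<close> K by (auto simp: D_def)
        have "K * D \<le> K * (e / (2 * K))"
          using K by (intro mult_left_mono) (auto simp: D_def)
        also have "\<dots> < e" using K \<open>e > 0\<close> by simp
        finally have KD: "K * D < e" .
        from uniform_limitD[OF w D(1)] uniform_limitD[OF beta_limit[OF w] D(1)]
        show "\<forall>\<^sub>F n in sequentially. \<forall>s\<in>{0..horizon G}.
            dist (- hjb id (\<beta> n) (?v n) s \<xi>) (- hjb id (feedback G w) w s \<xi>) < e"
        proof eventually_elim
          case (elim n)
          show ?case
          proof
            fix s assume s: "s \<in> {0..horizon G}"
            have "\<bar>hjb id (\<beta> n) (?v n) s \<xi> - hjb id (feedback G w) w s \<xi>\<bar> \<le> K * D"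
            proof (rule hjb_diff[OF s \<xi> less_imp_le[OF D(1)] D(2)])
              show "\<bar>?v n s \<eta> - w s \<eta>\<bar> \<le> D" "norm (\<beta> n s \<eta> - feedback G w s \<eta>) \<le> D"
                if "\<eta> \<in> states G" for \<eta>
                using elim(1)[rule_format, of "(s, \<eta>)"] elim(2)[rule_format, of "(s, \<eta>)"] s that
                by (simp_all add: dist_norm)
            qed
            then show "dist (- hjb id (\<beta> n) (?v n) s \<xi>) (- hjb id (feedback G w) w s \<xi>) < e"
              using KD by (simp add: dist_real_def abs_minus_commute)
          qed
        qed
      qed
    qed
  qed
qed

end

end

theorem theorem3p2:
  fixes G :: "'d::finite game"
    and \<P> :: "('d, 'w) chain_laws"
    and \<Xi> :: "real \<Rightarrow> 'w \<Rightarrow> 'd state"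
    and \<gamma> c\<^sub>a \<rho> :: real
    and \<beta> \<alpha> :: "nat \<Rightarrow> 'd control"
    and v :: "nat \<Rightarrow> real \<Rightarrow> 'd state \<Rightarrow> real"
  assumes N: "players G \<ge> 1"
    and T: "horizon G > 0"
    and rate0: "\<And>\<xi>. \<xi> \<in> states G \<Longrightarrow> rate0 G \<xi> \<in> nonneg_vecs (fst \<xi>)"
    and rate1: "\<And>\<xi>. \<xi> \<in> states G \<Longrightarrow> rate1 G \<xi> \<in> nonneg_vecs (fst \<xi>)"
    and final_nonneg: "\<And>\<xi>. \<xi> \<in> states G \<Longrightarrow> final G \<xi> \<ge> 0"
    and running_nonneg:
      "\<And>\<xi> a. \<xi> \<in> states G \<Longrightarrow> a \<in> nonneg_vecs (fst \<xi>) \<Longrightarrow> running G \<xi> a \<ge> 0"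
    and running_cont:
      "\<And>\<xi>. \<xi> \<in> states G \<Longrightarrow> continuous_on (nonneg_vecs (fst \<xi>)) (running G \<xi>)"
    and gamma: "\<gamma> > 0"
    and running_convex:
      "\<And>\<xi> a a' \<tau>. \<xi> \<in> states G \<Longrightarrow> a \<in> nonneg_vecs (fst \<xi>) \<Longrightarrow> a' \<in> nonneg_vecs (fst \<xi>) \<Longrightarrow>
         \<tau> \<in> {0..1} \<Longrightarrow>
         \<tau> * running G \<xi> a' + (1 - \<tau>) * running G \<xi> a
           - running G \<xi> (\<tau> *\<^sub>R a' + (1 - \<tau>) *\<^sub>R a) \<ge> \<gamma> * \<tau> * (1 - \<tau>) * (norm (a' - a))\<^sup>2"
    and chains: "realizes_chains G \<P> \<Xi>"
    and ca_pos: "c\<^sub>a > 0"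
    and ca_bound:
      "\<And>b t \<xi>. b \<in> controls G \<Longrightarrow> t \<in> {0..horizon G} \<Longrightarrow> \<xi> \<in> states G \<Longrightarrow>
         norm (best_response G \<P> \<Xi> b t \<xi>) \<le> c\<^sub>a"
    and rho: "0 \<le> \<rho>" "\<rho> < 1"
    and beta0: "\<beta> 0 \<in> bounded_controls G c\<^sub>a"
    and v_step: "\<And>n. n \<ge> 1 \<Longrightarrow> v n = val G \<P> \<Xi> (\<beta> (n - 1))"
    and alpha_step: "\<And>n. n \<ge> 1 \<Longrightarrow> \<alpha> n = best_response G \<P> \<Xi> (\<beta> (n - 1))"
    and beta_step:
      "\<And>n. n \<ge> 1 \<Longrightarrow> \<beta> n = (\<lambda>t \<xi>. \<rho> *\<^sub>R \<beta> (n - 1) t \<xi> + (1 - \<rho>) *\<^sub>R \<alpha> n t \<xi>)"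
  shows "\<exists>w. NLL_solution G w \<and>
           (\<forall>w'. NLL_solution G w' \<longrightarrow> (\<forall>t\<in>{0..horizon G}. \<forall>\<xi>\<in>states G. w' t \<xi> = w t \<xi>)) \<and>
           uniform_limit ({0..horizon G} \<times> states G)
             (\<lambda>n (t, \<xi>). v n t \<xi>) (\<lambda>(t, \<xi>). w t \<xi>) sequentially \<and>
           markov_perfect_eq G \<P> \<Xi> (feedback G w) \<and>
           (\<forall>a. markov_perfect_eq G \<P> \<Xi> a \<longrightarrow>
              (\<forall>t\<in>{0..horizon G}. \<forall>\<xi>\<in>states G. a t \<xi> = feedback G w t \<xi>)) \<and>
           uniform_limit ({0..horizon G} \<times> states G)
             (\<lambda>n (t, \<xi>). \<alpha> n t \<xi>) (\<lambda>(t, \<xi>). feedback G w t \<xi>) sequentially"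
proof -
  interpret controlled_chains G \<gamma> \<P> \<Xi>
    by unfold_locales (fact N T rate0 rate1 final_nonneg running_nonneg running_cont gamma
        running_convex chains)+
  have beta_0: "\<beta> 0 \<in> controls G"
    using beta0 by (simp add: bounded_controls_def)
  have beta_Suc: "\<beta> (Suc n) =
      (\<lambda>t \<xi>. \<rho> *\<^sub>R \<beta> n t \<xi> + (1 - \<rho>) *\<^sub>R best_response G \<P> \<Xi> (\<beta> n) t \<xi>)" for n
    using beta_step[of "Suc n"] alpha_step[of "Suc n"] by simp
  note iteration = rho beta_0 beta_Suc
  obtain w where w: "uniform_limit ({0..horizon G} \<times> states G)
      (\<lambda>n (t, \<xi>). val G \<P> \<Xi> (\<beta> n) t \<xi>) (\<lambda>(t, \<xi>). w t \<xi>) sequentially"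
    by (rule val_beta_converges[OF iteration])
  note sol = limit_HJB_solution[OF iteration w]
  have nll: "NLL_solution G w"
    using sol by (simp add: NLL_solution_iff)
  \<comment> \<open>The recursion fixes \<open>v n\<close> and \<open>\<alpha> n\<close> only for
    \<open>n \<ge> 1\<close>, through the control with index \<open>n - 1\<close>; shifting by one
    discards the arbitrary terms at 0.\<close>
  have "uniform_limit ({0..horizon G} \<times> states G)
      (\<lambda>n (t, \<xi>). v n t \<xi>) (\<lambda>(t, \<xi>). w t \<xi>) sequentially"
    by (rule filterlim_sequentially_Suc[THEN iffD1]) (use w in \<open>simp add: v_step\<close>)
  moreover have "uniform_limit ({0..horizon G} \<times> states G)
      (\<lambda>n (t, \<xi>). \<alpha> n t \<xi>) (\<lambda>(t, \<xi>). feedback G w t \<xi>) sequentially"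
    by (rule filterlim_sequentially_Suc[THEN iffD1])
      (use best_response_limit[OF iteration w] in \<open>simp add: alpha_step\<close>)
  ultimately show ?thesis
    using nll NLL_solution_unique[OF _ nll] feedback_markov_perfect_eq[OF sol]
      markov_perfect_eq_unique[OF _ feedback_markov_perfect_eq[OF sol]]
    by (intro exI[of _ w] conjI allI impI ballI) blast+
qed

end
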